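(* Let $\mathcal U$ and $\mathcal T$ be $\mathrm{Hom}$-finite Krull-Schmidt $K$-categories which are quasi-hereditary with respect to filtrations $\{\mathcal U_j\}_{0\le j\le n}$ and $\{\mathcal T_j\}_{j\ge0}$ of additively closed subcategories, and let $M:\mathcal U\otimes_K\mathcal T^{op}\to\mathrm{mod}\,K$ be a functor with $M_T:=M(-,T)\in\mathcal F({}_{\mathcal U}\Delta)$ for all $T\in\mathcal T$. Let $\Lambda=\begin{pmatrix}\mathcal T&0\\ M&\mathcal U\end{pmatrix}$ with its filtration $\{\Lambda_j\}_{j\ge0}$. Let $F=(F^{(1)},f,F^{(2)})\in\mathrm{Mod}\,\Lambda$ and let $\{F^{[j]}\}_{j\ge0}=\{((F^{[j]})^{(1)},f^{[j]},(F^{[j]})^{(2)})\}_{j\ge0}$ be its trace filtration with respect to $\{\Lambda_j\}$. Then: (i) $(F^{[j]})^{(1)}\cong0$ if $0\le j\le n$, and $(F^{[j]})^{(2)}\cong F^{(2)}$ if $j>n$. (ii) If $F=(F^{(1)},f,F^{(2)})\in\mathcal F({}_\Lambda\Delta)$, then $F^{(1)}\in\mathcal F({}_{\mathcal T}\Delta)$ and $F^{(2)}\in\mathcal F({}_{\mathcal U}\Delta)$. (iii) $\mathcal F_f({}_\Lambda\Delta)=\{(F^{(1)},f,F^{(2)}):F^{(1)}\in\mathcal F_f({}_{\mathcal T}\Delta)\text{ and }F^{(2)}\in\mathcal F_f({}_{\mathcal U}\Delta)\}$.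
   Context: $K$ is a field; categories are skeletally small and functors between $K$-categories are $K$-linear. A Krull-Schmidt category is an additive category in which every object is a finite direct sum of indecomposables with local endomorphism rings; $\mathrm{Ind}\,\mathcal B$ denotes the indecomposable objects of $\mathcal B$. $\mathrm{Mod}\,\mathcal C$ is the category of additive covariant functors $\mathcal C\to\mathbf{Ab}$. Quasi-hereditary categories. Let $\mathcal C$ be a $\mathrm{Hom}$-finite Krull-Schmidt $K$-category. A full additive subcategory is additively closed if closed under direct summands and isomorphisms. $I_{\mathcal B}(X,Y)\subseteq\mathcal C(X,Y)$ is the set of morphisms factoring through an object of $\mathcal B$. A two-sided ideal $I$ is heredity if $I^2=I$, $I\,\mathrm{rad}_{\mathcal C}\,I=0$, and $I(X,-)$ is a finitely generated projective $\mathcal C$-module for all $X$. For an exhaustive filtration $\mathcal B_0\subset\mathcal B_1\subset\cdots$ of $\mathcal C$ by full additive subcategories ($\bigcup_j\mathcal B_j=\mathcal C$; in the finite case $0\le j\le n$, $\mathcal B_n=\mathcal C$), $\mathcal C$ is quasi-hereditary with respect to $\{\mathcal B_j\}$ if $0=I_{\mathcal B_0}\subset I_{\mathcal B_1}\subset\cdots$ has union $\mathcal C(-,?)$ and $I_{\mathcal B_j}/I_{\mathcal B_{j-1}}$ is heredity in $\mathcal C/I_{\mathcal B_{j-1}}$ for all $j\ge1$. Standard and filtered modules. The standard modules are ${}_{\mathcal C}\Delta_E(j)=\mathcal C(E,-)/I_{\mathcal B_{j-1}}(E,-)$, $E\in\mathrm{Ind}\,\mathcal B_j-\mathrm{Ind}\,\mathcal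 B_{j-1}$; ${}_{\mathcal C}\Delta(j)$ is the class of these and ${}_{\mathcal C}\Delta$ the class of all standard modules. The trace filtration of $F$ is $\{F^{[j]}\}_{j\ge 0}$, with $F^{[j]}$ the sum of the images of all morphisms $\mathcal C(E,-)\to F$, $E\in\mathcal B_j$. $\mathcal F({}_{\mathcal C}\Delta)$ is the full subcategory of those $F$ such that $F^{[j]}/F^{[j-1]}$ is a finite direct sum of modules in ${}_{\mathcal C}\Delta(j)$ for all $j\ge1$. $\mathcal F_f({}_{\mathcal C}\Delta)$ is the class of $\mathcal C$-modules $N$ having a finite filtration $0=N_0\subseteq N_1\subseteq\cdots\subseteq N_r=N$ with each $N_{i+1}/N_i$ a finite direct sum of modules in ${}_{\mathcal C}\Delta$. Triangular matrix category. $\mathcal U\otimes_K\mathcal T^{op}$ has objects pairs $(U,T)$ and morphism spaces the tensor products of morphism spaces. $\Lambda$ has objects $\begin{pmatrix}T&0\\ M&U\end{pmatrix}$, $T\in\mathcal T$, $U\in\mathcal U$; morphisms from $\begin{pmatrix}T&0\\ M&U\end{pmatrix}$ to $\begin{pmatrix}T'&0\\ M&U'\end{pmatrix}$ are matrices $\begin{pmatrix}t&0\\ m&u\end{pmatrix}$ with $t\in\mathcal T(T,T')$, $m\in M(U',T)$, $u\in\mathcal U(U,U')$; composition is $\begin{pmatrix}t_2&0\\ m_2&u_2\end{pmatrix}\begin{pmatrix}t_1&0\\ m_1&u_1\end{pmatrix}=\begin{pmatrix}t_2t_1&0\\ M(1\otimes t_1^{op})(m_2)+M(u_2\otimes1)(m_1)&u_2u_1\end{pmatrix}$.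 The filtration $\{\Lambda_j\}$ consists of full subcategories: $\Lambda_0$ is the zero subcategory; for $1\le j\le n$, $\Lambda_j$ has objects $\begin{pmatrix}0&0\\ M&U\end{pmatrix}$, $U\in\mathcal U_j$; for $j\ge1$, $\Lambda_{n+j}$ has objects $\begin{pmatrix}T&0\\ M&U\end{pmatrix}$, $T\in\mathcal T_j$, $U\in\mathcal U$. Under the stated hypotheses $\Lambda$ is a $\mathrm{Hom}$-finite Krull-Schmidt category, quasi-hereditary with respect to $\{\Lambda_j\}$, and ${}_\Lambda\Delta$ is formed with respect to $\{\Lambda_j\}$. $\Lambda$-modules as triples. There is an equivalence between $\mathrm{Mod}\,\Lambda$ and the category of triples $(A,f,B)$ with $A\in\mathrm{Mod}\,\mathcal T$, $B\in\mathrm{Mod}\,\mathcal U$ and $f:A\to\mathbb G(B)$ a morphism of $\mathcal T$-modules, where $\mathbb G(B)(T)=\mathrm{Hom}_{\mathcal U}(M_T,B)$. The triple of a $\Lambda$-module $F$ has $F^{(1)}(T)=F\begin{pmatrix}T&0\\ M&0\end{pmatrix}$, $F^{(2)}(U)=F\begin{pmatrix}0&0\\ M&U\end{pmatrix}$; conversely $(A,f,B)$ corresponds to the module with value $A(T)\amalg B(U)$ on $\begin{pmatrix}T&0\\ M&U\end{pmatrix}$, on which $\begin{pmatrix}t&0\\ m&u\end{pmatrix}$ acts by $(x,y)\mapsto(A(t)x,\ (f_T(x))_{U'}(m)+B(u)y)$. Modules are identified with their triples. *)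

theory Defs
  imports "HOL-Algebra.Module" "HOL-Algebra.AbelCoset" "HOL-Algebra.Product_Groups" "HOL-Library.Multiset"
begin

section \<open>\<open>K\<close>-linear categories\<close>

text \<open>
  Hom sets are indexed by source and target, so that the same element of the morphism type may occur
  in several of them; they are \<^locale>\<open>module\<close>s over \<open>K\<close>, whose multiplicative record
  components are not used.  \<open>Cmp C X Y Z g f\<close> is \<open>g \<circ> f\<close> for
  \<open>f : X \<rightarrow> Y\<close> and \<open>g : Y \<rightarrow> Z\<close>.
\<close>

record ('o, 'm, 'k) kcat =
  Ob  :: "'o set"
  Hom :: "'o \<Rightarrow> 'o \<Rightarrow> ('k, 'm) module"
  Cmp :: "'o \<Rightarrow> 'o \<Rightarrow> 'o \<Rightarrow> 'm \<Rightarrow> 'm \<Rightarrow> 'm"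
  Idm :: "'o \<Rightarrow> 'm"

abbreviation Mor :: "('o, 'm, 'k) kcat \<Rightarrow> 'o \<Rightarrow> 'o \<Rightarrow> 'm set"
  where "Mor C X Y \<equiv> carrier (Hom C X Y)"

locale k_category = field K for K (structure) +
  fixes C :: "('o, 'm, 'a) kcat"
  assumes Hom_module: "\<lbrakk>X \<in> Ob C; Y \<in> Ob C\<rbrakk> \<Longrightarrow> module K (Hom C X Y)"
    and Idm_closed: "X \<in> Ob C \<Longrightarrow> Idm C X \<in> Mor C X X"
    and Cmp_closed: "\<lbrakk>X \<in> Ob C; Y \<in> Ob C; Z \<in> Ob C; f \<in> Mor C X Y; g \<in> Mor C Y Z\<rbrakk>
          \<Longrightarrow> Cmp C X Y Z g f \<in> Mor C X Z"
    and Cmp_Idm_left: "\<lbrakk>X \<in> Ob C; Y \<in> Ob C; f \<in> Mor C X Y\<rbrakk> \<Longrightarrow> Cmp C X Y Y (Idm C Y) f = f"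
    and Cmp_Idm_right: "\<lbrakk>X \<in> Ob C; Y \<in> Ob C; f \<in> Mor C X Y\<rbrakk> \<Longrightarrow> Cmp C X X Y f (Idm C X) = f"
    and Cmp_assoc: "\<lbrakk>W \<in> Ob C; X \<in> Ob C; Y \<in> Ob C; Z \<in> Ob C;
          f \<in> Mor C W X; g \<in> Mor C X Y; h \<in> Mor C Y Z\<rbrakk>
          \<Longrightarrow> Cmp C W Y Z h (Cmp C W X Y g f) = Cmp C W X Z (Cmp C X Y Z h g) f"
    and Cmp_add_left: "\<lbrakk>X \<in> Ob C; Y \<in> Ob C; Z \<in> Ob C; f \<in> Mor C X Y; g \<in> Mor C Y Z; g' \<in> Mor C Y Z\<rbrakk>
          \<Longrightarrow> Cmp C X Y Z (g \<oplus>\<^bsub>Hom C Y Z\<^esub> g') f = Cmp C X Y Z g f \<oplus>\<^bsub>Hom C X Z\<^esub> Cmp C X Y Z g' f"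
    and Cmp_add_right: "\<lbrakk>X \<in> Ob C; Y \<in> Ob C; Z \<in> Ob C; f \<in> Mor C X Y; f' \<in> Mor C X Y; g \<in> Mor C Y Z\<rbrakk>
          \<Longrightarrow> Cmp C X Y Z g (f \<oplus>\<^bsub>Hom C X Y\<^esub> f') = Cmp C X Y Z g f \<oplus>\<^bsub>Hom C X Z\<^esub> Cmp C X Y Z g f'"
    and Cmp_smult_left: "\<lbrakk>X \<in> Ob C; Y \<in> Ob C; Z \<in> Ob C; a \<in> carrier K; f \<in> Mor C X Y; g \<in> Mor C Y Z\<rbrakk>
          \<Longrightarrow> Cmp C X Y Z (a \<odot>\<^bsub>Hom C Y Z\<^esub> g) f = a \<odot>\<^bsub>Hom C X Z\<^esub> Cmp C X Y Z g f"
    and Cmp_smult_right: "\<lbrakk>X \<in> Ob C; Y \<in> Ob C; Z \<in> Ob C; a \<in> carrier K; f \<in> Mor C X Y; g \<in> Mor C Y Z\<rbrakk>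
          \<Longrightarrow> Cmp C X Y Z g (a \<odot>\<^bsub>Hom C X Y\<^esub> f) = a \<odot>\<^bsub>Hom C X Z\<^esub> Cmp C X Y Z g f"

definition full_sub :: "('o, 'm, 'k) kcat \<Rightarrow> 'o set \<Rightarrow> ('o, 'm, 'k) kcat"
  where "full_sub C B = C\<lparr>Ob := B\<rparr>"

definition op_cat :: "('o, 'm, 'k) kcat \<Rightarrow> ('o, 'm, 'k) kcat"
  where "op_cat C = \<lparr>Ob = Ob C, Hom = (\<lambda>X Y. Hom C Y X),
           Cmp = (\<lambda>X Y Z g f. Cmp C Z Y X f g), Idm = Idm C\<rparr>"

definition is_iso :: "('o, 'm, 'k) kcat \<Rightarrow> 'o \<Rightarrow> 'o \<Rightarrow> 'm \<Rightarrow> bool"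
  where "is_iso C X Y f \<longleftrightarrow> f \<in> Mor C X Y \<and>
           (\<exists>g\<in>Mor C Y X. Cmp C X Y X g f = Idm C X \<and> Cmp C Y X Y f g = Idm C Y)"

definition isomorphic :: "('o, 'm, 'k) kcat \<Rightarrow> 'o \<Rightarrow> 'o \<Rightarrow> bool"
  where "isomorphic C X Y \<longleftrightarrow> (\<exists>f. is_iso C X Y f)"

definition zero_object :: "('o, 'm, 'k) kcat \<Rightarrow> 'o \<Rightarrow> bool"
  where "zero_object C Z \<longleftrightarrow> Z \<in> Ob C \<and>
           (\<forall>X\<in>Ob C. Mor C X Z = {\<zero>\<^bsub>Hom C X Z\<^esub>} \<and> Mor C Z X = {\<zero>\<^bsub>Hom C Z X\<^esub>})"

text \<open>\<open>Z\<close> is a direct sum (biproduct) of the objects in the list; for the empty list, a zero object.\<close>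

definition direct_sum :: "('o, 'm, 'k) kcat \<Rightarrow> 'o list \<Rightarrow> 'o \<Rightarrow> bool"
  where "direct_sum C Xs Z \<longleftrightarrow> set Xs \<subseteq> Ob C \<and> Z \<in> Ob C \<and>
    (\<exists>inj prj.
      (\<forall>k<length Xs. inj k \<in> Mor C (Xs ! k) Z \<and> prj k \<in> Mor C Z (Xs ! k)) \<and>
      (\<forall>k<length Xs. \<forall>l<length Xs. Cmp C (Xs ! l) Z (Xs ! k) (prj k) (inj l) =
          (if k = l then Idm C (Xs ! k) else \<zero>\<^bsub>Hom C (Xs ! l) (Xs ! k)\<^esub>)) \<and>
      (\<Oplus>\<^bsub>Hom C Z Z\<^esub>k\<in>{..<length Xs}. Cmp C Z (Xs ! k) Z (inj k) (prj k)) = Idm C Z)"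

definition additive_cat :: "('o, 'm, 'k) kcat \<Rightarrow> bool"
  where "additive_cat C \<longleftrightarrow> (\<forall>Xs. set Xs \<subseteq> Ob C \<longrightarrow> (\<exists>Z. direct_sum C Xs Z))"

definition indecomposable :: "('o, 'm, 'k) kcat \<Rightarrow> 'o \<Rightarrow> bool"
  where "indecomposable C X \<longleftrightarrow> X \<in> Ob C \<and> \<not> zero_object C X \<and>
           (\<forall>Y Z. direct_sum C [Y, Z] X \<longrightarrow> zero_object C Y \<or> zero_object C Z)"

definition End_ring :: "('o, 'm, 'k) kcat \<Rightarrow> 'o \<Rightarrow> 'm ring"
  where "End_ring C X = \<lparr>carrier = Mor C X X, monoid.mult = Cmp C X X X, one = Idm C X,
           zero = \<zero>\<^bsub>Hom C X X\<^esub>, add = add (Hom C X X)\<rparr>"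

definition local_ring :: "('a, 'b) ring_scheme \<Rightarrow> bool"
  where "local_ring R \<longleftrightarrow> ring R \<and> \<one>\<^bsub>R\<^esub> \<noteq> \<zero>\<^bsub>R\<^esub> \<and>
           (\<forall>a\<in>carrier R - Units R. \<forall>b\<in>carrier R - Units R. a \<oplus>\<^bsub>R\<^esub> b \<notin> Units R)"

definition krull_schmidt :: "('o, 'm, 'k) kcat \<Rightarrow> bool"
  where "krull_schmidt C \<longleftrightarrow> additive_cat C \<and>
    (\<forall>X\<in>Ob C. \<exists>Es. direct_sum C Es X \<and>
       (\<forall>E\<in>set Es. indecomposable C E \<and> local_ring (End_ring C E)))"

definition fin_dim :: "('k, 'x) ring_scheme \<Rightarrow> ('k, 'v) module \<Rightarrow> bool"
  where "fin_dim K V \<longleftrightarrow> (\<exists>S. finite S \<and> S \<subseteq> carrier V \<and>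
    (\<forall>v\<in>carrier V. \<exists>c\<in>S \<rightarrow> carrier K. v = (\<Oplus>\<^bsub>V\<^esub>s\<in>S. c s \<odot>\<^bsub>V\<^esub> s)))"

definition hom_finite :: "('k, 'x) ring_scheme \<Rightarrow> ('o, 'm, 'k) kcat \<Rightarrow> bool"
  where "hom_finite K C \<longleftrightarrow> (\<forall>X\<in>Ob C. \<forall>Y\<in>Ob C. fin_dim K (Hom C X Y))"


section \<open>Modules over a category\<close>

text \<open>
  A \<open>C\<close>-module is an additive covariant functor from \<open>C\<close> to abelian groups.
  Abelian groups are \<^locale>\<open>comm_group\<close>s, hence written multiplicatively; the additive group of
  a hom space \<open>V\<close> is \<open>add_group V\<close>, which is \<^term>\<open>add_monoid V\<close> without the record
  extension of \<open>V\<close>.  \<open>act F X Y f\<close> is the action of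
  \<open>f : X \<rightarrow> Y\<close>.
\<close>

definition add_group :: "('k, 'v) module \<Rightarrow> 'v monoid"
  where "add_group V = \<lparr>carrier = carrier V, monoid.mult = add V, one = \<zero>\<^bsub>V\<^esub>\<rparr>"

record ('o, 'm, 'a) cmod =
  val :: "'o \<Rightarrow> 'a monoid"
  act :: "'o \<Rightarrow> 'o \<Rightarrow> 'm \<Rightarrow> 'a \<Rightarrow> 'a"

definition Modules :: "('o, 'm, 'k) kcat \<Rightarrow> ('o, 'm, 'a) cmod set"
  where "Modules C = {F.
    (\<forall>X\<in>Ob C. comm_group (val F X)) \<and>
    (\<forall>X\<in>Ob C. \<forall>Y\<in>Ob C. \<forall>f\<in>Mor C X Y. act F X Y f \<in> hom (val F X) (val F Y)) \<and>
    (\<forall>X\<in>Ob C. \<forall>x\<in>carrier (val F X). act F X X (Idm C X) x = x) \<and>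
    (\<forall>X\<in>Ob C. \<forall>Y\<in>Ob C. \<forall>Z\<in>Ob C. \<forall>f\<in>Mor C X Y. \<forall>g\<in>Mor C Y Z. \<forall>x\<in>carrier (val F X).
       act F X Z (Cmp C X Y Z g f) x = act F Y Z g (act F X Y f x)) \<and>
    (\<forall>X\<in>Ob C. \<forall>Y\<in>Ob C. \<forall>f\<in>Mor C X Y. \<forall>g\<in>Mor C X Y. \<forall>x\<in>carrier (val F X).
       act F X Y (f \<oplus>\<^bsub>Hom C X Y\<^esub> g) x = act F X Y f x \<otimes>\<^bsub>val F Y\<^esub> act F X Y g x)}"

definition Mod_hom ::
    "('o, 'm, 'k) kcat \<Rightarrow> ('o, 'm, 'a) cmod \<Rightarrow> ('o, 'm, 'b) cmod \<Rightarrow> ('o \<Rightarrow> 'a \<Rightarrow> 'b) set"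
  where "Mod_hom C F G = {\<eta>.
    (\<forall>X\<in>Ob C. \<eta> X \<in> hom (val F X) (val G X)) \<and>
    (\<forall>X\<in>Ob C. \<forall>Y\<in>Ob C. \<forall>f\<in>Mor C X Y. \<forall>x\<in>carrier (val F X).
       \<eta> Y (act F X Y f x) = act G X Y f (\<eta> X x))}"

definition Mod_epi ::
    "('o, 'm, 'k) kcat \<Rightarrow> ('o, 'm, 'a) cmod \<Rightarrow> ('o, 'm, 'b) cmod \<Rightarrow> ('o \<Rightarrow> 'a \<Rightarrow> 'b) set"
  where "Mod_epi C F G =
    {\<eta> \<in> Mod_hom C F G. \<forall>X\<in>Ob C. \<eta> X ` carrier (val F X) = carrier (val G X)}"

definition Mod_iso :: "('o, 'm, 'k) kcat \<Rightarrow> ('o, 'm, 'a) cmod \<Rightarrow> ('o, 'm, 'b) cmod \<Rightarrow> bool"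
  where "Mod_iso C F G \<longleftrightarrow> (\<exists>\<eta>\<in>Mod_hom C F G. \<forall>X\<in>Ob C. \<eta> X \<in> iso (val F X) (val G X))"

definition zero_Mod :: "('o, 'm, unit) cmod"
  where "zero_Mod = \<lparr>val = (\<lambda>X. singleton_group ()), act = (\<lambda>X Y f x. ())\<rparr>"

definition submodule :: "('o, 'm, 'k) kcat \<Rightarrow> ('o \<Rightarrow> 'a set) \<Rightarrow> ('o, 'm, 'a) cmod \<Rightarrow> bool"
  where "submodule C N F \<longleftrightarrow> (\<forall>X\<in>Ob C. subgroup (N X) (val F X)) \<and>
    (\<forall>X\<in>Ob C. \<forall>Y\<in>Ob C. \<forall>f\<in>Mor C X Y. act F X Y f ` N X \<subseteq> N Y)"

definition restrict_Mod :: "('o, 'm, 'a) cmod \<Rightarrow> ('o \<Rightarrow> 'a set) \<Rightarrow> ('o, 'm, 'a) cmod"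
  where "restrict_Mod F N = F\<lparr>val := (\<lambda>X. (val F X)\<lparr>carrier := N X\<rparr>)\<rparr>"

text \<open>A coset \<open>S\<close> of \<open>N X\<close> is sent to the coset of \<open>N Y\<close> containing the image of \<open>S\<close>.\<close>

definition quot_Mod :: "('o, 'm, 'a) cmod \<Rightarrow> ('o \<Rightarrow> 'a set) \<Rightarrow> ('o, 'm, 'a set) cmod"
  where "quot_Mod F N = \<lparr>val = (\<lambda>X. val F X Mod N X),
           act = (\<lambda>X Y f S. N Y <#>\<^bsub>val F Y\<^esub> (act F X Y f ` S))\<rparr>"

definition dsum_Mod :: "('o, 'm, 'a) cmod list \<Rightarrow> ('o, 'm, nat \<Rightarrow> 'a) cmod"
  where "dsum_Mod Fs =
    \<lparr>val = (\<lambda>X. product_group {..<length Fs} (\<lambda>i. val (Fs ! i) X)),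
     act = (\<lambda>X Y f x. \<lambda>i\<in>{..<length Fs}. act (Fs ! i) X Y f (x i))\<rparr>"

definition rep :: "('o, 'm, 'k) kcat \<Rightarrow> 'o \<Rightarrow> ('o, 'm, 'm) cmod"
  where "rep C E = \<lparr>val = (\<lambda>X. add_group (Hom C E X)), act = (\<lambda>X Y f g. Cmp C E X Y f g)\<rparr>"

definition finitely_generated :: "('o, 'm, 'k) kcat \<Rightarrow> ('o, 'm, 'a) cmod \<Rightarrow> bool"
  where "finitely_generated C P \<longleftrightarrow>
    (\<exists>Xs. set Xs \<subseteq> Ob C \<and> Mod_epi C (dsum_Mod (map (rep C) Xs)) P \<noteq> {})"

text \<open>
  The lifting property is required against epimorphisms of modules whose elements have the
  type of the morphisms of \<open>C\<close>.  For finitely generated \<open>P\<close> over an additive \<open>C\<close>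
  this already is projectivity: \<open>P\<close> is a quotient of some representable module, and lifting its
  identity makes it a direct summand of that module.
\<close>

definition projective :: "('o, 'm, 'k) kcat \<Rightarrow> ('o, 'm, 'm) cmod \<Rightarrow> bool"
  where "projective C P \<longleftrightarrow> P \<in> Modules C \<and>
    (\<forall>A \<in> (Modules C :: ('o, 'm, 'm) cmod set). \<forall>B \<in> (Modules C :: ('o, 'm, 'm) cmod set).
     \<forall>p \<in> Mod_epi C A B. \<forall>g \<in> Mod_hom C P B.
       (\<exists>h \<in> Mod_hom C P A. \<forall>X\<in>Ob C. \<forall>x\<in>carrier (val P X). p X (h X x) = g X x))"


section \<open>Ideals and quasi-hereditary categories\<close>

definition two_sided_ideal :: "('o, 'm, 'k) kcat \<Rightarrow> ('o \<Rightarrow> 'o \<Rightarrow> 'm set) \<Rightarrow> bool"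
  where "two_sided_ideal C I \<longleftrightarrow>
    (\<forall>X\<in>Ob C. \<forall>Y\<in>Ob C. subgroup (I X Y) (add_monoid (Hom C X Y))) \<and>
    (\<forall>X\<in>Ob C. \<forall>Y\<in>Ob C. \<forall>Z\<in>Ob C. \<forall>f\<in>I X Y. \<forall>g\<in>Mor C Y Z. Cmp C X Y Z g f \<in> I X Z) \<and>
    (\<forall>X\<in>Ob C. \<forall>Y\<in>Ob C. \<forall>Z\<in>Ob C. \<forall>f\<in>Mor C X Y. \<forall>g\<in>I Y Z. Cmp C X Y Z g f \<in> I X Z)"

definition ideal_mult :: "('o, 'm, 'k) kcat \<Rightarrow>
    ('o \<Rightarrow> 'o \<Rightarrow> 'm set) \<Rightarrow> ('o \<Rightarrow> 'o \<Rightarrow> 'm set) \<Rightarrow> 'o \<Rightarrow> 'o \<Rightarrow> 'm set"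
  where "ideal_mult C I J X Z = generate (add_monoid (Hom C X Z))
    {Cmp C X Y Z g f | Y g f. Y \<in> Ob C \<and> f \<in> J X Y \<and> g \<in> I Y Z}"

definition radical :: "('o, 'm, 'k) kcat \<Rightarrow> 'o \<Rightarrow> 'o \<Rightarrow> 'm set"
  where "radical C X Y = {h \<in> Mor C X Y.
    \<forall>g\<in>Mor C Y X. is_iso C X X (Idm C X \<ominus>\<^bsub>Hom C X X\<^esub> Cmp C X Y X g h)}"

definition heredity_ideal :: "('o, 'm, 'k) kcat \<Rightarrow> ('o \<Rightarrow> 'o \<Rightarrow> 'm set) \<Rightarrow> bool"
  where "heredity_ideal C I \<longleftrightarrow> two_sided_ideal C I \<and>
    (\<forall>X\<in>Ob C. \<forall>Y\<in>Ob C. ideal_mult C I I X Y = I X Y) \<and>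
    (\<forall>X\<in>Ob C. \<forall>Y\<in>Ob C. ideal_mult C (ideal_mult C I (radical C)) I X Y = {\<zero>\<^bsub>Hom C X Y\<^esub>}) \<and>
    (\<forall>X\<in>Ob C. let P = restrict_Mod (rep C X) (I X) in finitely_generated C P \<and> projective C P)"

definition ideal_through :: "('o, 'm, 'k) kcat \<Rightarrow> 'o set \<Rightarrow> 'o \<Rightarrow> 'o \<Rightarrow> 'm set"
  where "ideal_through C B X Y = {Cmp C X E Y g f | E f g. E \<in> B \<and> f \<in> Mor C X E \<and> g \<in> Mor C E Y}"

definition quot_space :: "('k, 'm) module \<Rightarrow> 'm set \<Rightarrow> ('k, 'm set) module"
  where "quot_space V N = \<lparr>carrier = a_rcosets\<^bsub>V\<^esub> N, monoid.mult = undefined, one = undefined,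
           zero = N, add = set_add V, smult = (\<lambda>a S. N <+>\<^bsub>V\<^esub> ((\<lambda>v. a \<odot>\<^bsub>V\<^esub> v) ` S))\<rparr>"

text \<open>As for modules, the composite of two cosets is the coset containing all composites of representatives.\<close>

definition quot_cat :: "('o, 'm, 'k) kcat \<Rightarrow> ('o \<Rightarrow> 'o \<Rightarrow> 'm set) \<Rightarrow> ('o, 'm set, 'k) kcat"
  where "quot_cat C I = \<lparr>Ob = Ob C,
     Hom = (\<lambda>X Y. quot_space (Hom C X Y) (I X Y)),
     Cmp = (\<lambda>X Y Z S R. I X Z <+>\<^bsub>Hom C X Z\<^esub> {Cmp C X Y Z g f | g f. g \<in> S \<and> f \<in> R}),
     Idm = (\<lambda>X. I X X +>\<^bsub>Hom C X X\<^esub> Idm C X)\<rparr>"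

definition quot_ideal :: "('o, 'm, 'k) kcat \<Rightarrow>
    ('o \<Rightarrow> 'o \<Rightarrow> 'm set) \<Rightarrow> ('o \<Rightarrow> 'o \<Rightarrow> 'm set) \<Rightarrow> 'o \<Rightarrow> 'o \<Rightarrow> 'm set set"
  where "quot_ideal C J I X Y = (\<lambda>f. I X Y +>\<^bsub>Hom C X Y\<^esub> f) ` J X Y"

text \<open>Full subcategories are given by their sets of objects.\<close>

definition additive_subcat :: "('o, 'm, 'k) kcat \<Rightarrow> 'o set \<Rightarrow> bool"
  where "additive_subcat C B \<longleftrightarrow> B \<subseteq> Ob C \<and>
    (\<forall>Xs. set Xs \<subseteq> B \<longrightarrow> (\<exists>Z\<in>B. direct_sum C Xs Z))"

definition additively_closed :: "('o, 'm, 'k) kcat \<Rightarrow> 'o set \<Rightarrow> bool"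
  where "additively_closed C B \<longleftrightarrow> additive_subcat C B \<and>
    (\<forall>X\<in>B. \<forall>Y\<in>Ob C. isomorphic C X Y \<longrightarrow> Y \<in> B) \<and>
    (\<forall>X Y Z. direct_sum C [X, Y] Z \<and> Z \<in> B \<longrightarrow> X \<in> B)"

text \<open>
  A filtration is a sequence \<open>B\<close> of which only the entries with index in \<open>J\<close> are relevant:
  \<open>J = {..n}\<close> for a finite filtration and \<open>J = UNIV\<close> for an infinite one.
\<close>

definition exhaustive_filtration :: "('o, 'm, 'k) kcat \<Rightarrow> nat set \<Rightarrow> (nat \<Rightarrow> 'o set) \<Rightarrow> bool"
  where "exhaustive_filtration C J B \<longleftrightarrow> (\<forall>j\<in>J. additive_subcat C (B j)) \<and>
    (\<forall>j. Suc j \<in> J \<longrightarrow> B j \<subseteq> B (Suc j)) \<and> (\<Union>j\<in>J. B j) = Ob C"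

definition quasi_hereditary :: "('o, 'm, 'k) kcat \<Rightarrow> nat set \<Rightarrow> (nat \<Rightarrow> 'o set) \<Rightarrow> bool"
  where "quasi_hereditary C J B \<longleftrightarrow> exhaustive_filtration C J B \<and>
    (\<forall>X\<in>Ob C. \<forall>Y\<in>Ob C. ideal_through C (B 0) X Y = {\<zero>\<^bsub>Hom C X Y\<^esub>}) \<and>
    (\<forall>X\<in>Ob C. \<forall>Y\<in>Ob C. \<forall>j. Suc j \<in> J \<longrightarrow>
       ideal_through C (B j) X Y \<subseteq> ideal_through C (B (Suc j)) X Y) \<and>
    (\<forall>X\<in>Ob C. \<forall>Y\<in>Ob C. (\<Union>j\<in>J. ideal_through C (B j) X Y) = Mor C X Y) \<and>
    (\<forall>j\<in>J. j \<ge> 1 \<longrightarrow> heredity_ideal (quot_cat C (ideal_through C (B (j - 1))))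
       (quot_ideal C (ideal_through C (B j)) (ideal_through C (B (j - 1)))))"


section \<open>Standard modules and filtered modules\<close>

definition Ind :: "('o, 'm, 'k) kcat \<Rightarrow> 'o set \<Rightarrow> 'o set"
  where "Ind C B = {E. indecomposable (full_sub C B) E}"

definition standard :: "('o, 'm, 'k) kcat \<Rightarrow> (nat \<Rightarrow> 'o set) \<Rightarrow> nat \<Rightarrow> ('o, 'm, 'm set) cmod set"
  where "standard C B j = {quot_Mod (rep C E) (ideal_through C (B (j - 1)) E) | E.
           E \<in> Ind C (B j) - Ind C (B (j - 1))}"

definition trace_filt ::
    "('o, 'm, 'k) kcat \<Rightarrow> (nat \<Rightarrow> 'o set) \<Rightarrow> ('o, 'm, 'a) cmod \<Rightarrow> nat \<Rightarrow> 'o \<Rightarrow> 'a set"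
  where "trace_filt C B F j X =
    generate (val F X) (\<Union>E\<in>B j. \<Union>\<eta>\<in>Mod_hom C (rep C E) F. \<eta> X ` Mor C E X)"

definition trace_Mod ::
    "('o, 'm, 'k) kcat \<Rightarrow> (nat \<Rightarrow> 'o set) \<Rightarrow> ('o, 'm, 'a) cmod \<Rightarrow> nat \<Rightarrow> ('o, 'm, 'a) cmod"
  where "trace_Mod C B F j = restrict_Mod F (trace_filt C B F j)"

definition filt :: "('o, 'm, 'k) kcat \<Rightarrow> nat set \<Rightarrow> (nat \<Rightarrow> 'o set) \<Rightarrow> ('o, 'm, 'a) cmod set"
  where "filt C J B = {F \<in> Modules C. \<forall>j\<in>J. j \<ge> 1 \<longrightarrow>
    (\<exists>Ds. set Ds \<subseteq> standard C B j \<and>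
       Mod_iso C (quot_Mod (trace_Mod C B F j) (trace_filt C B F (j - 1))) (dsum_Mod Ds))}"

definition filt_fin :: "('o, 'm, 'k) kcat \<Rightarrow> nat set \<Rightarrow> (nat \<Rightarrow> 'o set) \<Rightarrow> ('o, 'm, 'a) cmod set"
  where "filt_fin C J B = {F \<in> Modules C. \<exists>r N.
    (\<forall>i\<le>r. submodule C (N i) F) \<and>
    (\<forall>X\<in>Ob C. N 0 X = {\<one>\<^bsub>val F X\<^esub>} \<and> N r X = carrier (val F X) \<and> (\<forall>i<r. N i X \<subseteq> N (Suc i) X)) \<and>
    (\<forall>i<r. \<exists>Ds. set Ds \<subseteq> (\<Union>j\<in>J - {0}. standard C B j) \<and>
       Mod_iso C (quot_Mod (restrict_Mod F (N (Suc i))) (N i)) (dsum_Mod Ds))}"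


section \<open>Tensor product of categories\<close>

text \<open>
  The tensor product \<open>V \<otimes> W\<close> is the set of finite formal sums of pairs
  (multisets, with \<open>{#(v, w)#}\<close> for the pure tensor) modulo the congruence generated by
  the bilinearity relations.  No negatives are needed in the formal sums: because of
  \<open>tens_zero\<close>, \<open>(\<ominus> v, w)\<close> represents the inverse of \<open>(v, w)\<close>.
\<close>

inductive tens_eq :: "('k, 'x) ring_scheme \<Rightarrow> ('k, 'v) module \<Rightarrow> ('k, 'w) module \<Rightarrow>
    ('v \<times> 'w) multiset \<Rightarrow> ('v \<times> 'w) multiset \<Rightarrow> bool"
  for K V W where
  tens_refl: "set_mset x \<subseteq> carrier V \<times> carrier W \<Longrightarrow> tens_eq K V W x x"
| tens_sym: "tens_eq K V W x y \<Longrightarrow> tens_eq K V W y x"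
| tens_trans: "\<lbrakk>tens_eq K V W x y; tens_eq K V W y z\<rbrakk> \<Longrightarrow> tens_eq K V W x z"
| tens_plus: "\<lbrakk>tens_eq K V W x y; tens_eq K V W x' y'\<rbrakk> \<Longrightarrow> tens_eq K V W (x + x') (y + y')"
| tens_zero: "w \<in> carrier W \<Longrightarrow> tens_eq K V W {#(\<zero>\<^bsub>V\<^esub>, w)#} {#}"
| tens_add_left: "\<lbrakk>v \<in> carrier V; v' \<in> carrier V; w \<in> carrier W\<rbrakk>
    \<Longrightarrow> tens_eq K V W {#(v \<oplus>\<^bsub>V\<^esub> v', w)#} {#(v, w), (v', w)#}"
| tens_add_right: "\<lbrakk>v \<in> carrier V; w \<in> carrier W; w' \<in> carrier W\<rbrakk>
    \<Longrightarrow> tens_eq K V W {#(v, w \<oplus>\<^bsub>W\<^esub> w')#} {#(v, w), (v, w')#}"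
| tens_smult: "\<lbrakk>a \<in> carrier K; v \<in> carrier V; w \<in> carrier W\<rbrakk>
    \<Longrightarrow> tens_eq K V W {#(a \<odot>\<^bsub>V\<^esub> v, w)#} {#(v, a \<odot>\<^bsub>W\<^esub> w)#}"

definition tens_class :: "('k, 'x) ring_scheme \<Rightarrow> ('k, 'v) module \<Rightarrow> ('k, 'w) module \<Rightarrow>
    ('v \<times> 'w) multiset \<Rightarrow> ('v \<times> 'w) multiset set"
  where "tens_class K V W x = {y. tens_eq K V W x y}"

abbreviation pure_tens :: "('k, 'x) ring_scheme \<Rightarrow> ('k, 'v) module \<Rightarrow> ('k, 'w) module \<Rightarrow>
    'v \<Rightarrow> 'w \<Rightarrow> ('v \<times> 'w) multiset set"
  where "pure_tens K V W v w \<equiv> tens_class K V W {#(v, w)#}"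

definition tensor :: "('k, 'x) ring_scheme \<Rightarrow> ('k, 'v) module \<Rightarrow> ('k, 'w) module \<Rightarrow>
    ('k, ('v \<times> 'w) multiset set) module"
  where "tensor K V W =
    \<lparr>carrier = tens_class K V W ` {x. set_mset x \<subseteq> carrier V \<times> carrier W},
     monoid.mult = undefined, one = undefined,
     zero = tens_class K V W {#},
     add = (\<lambda>S R. \<Union>x\<in>S. \<Union>y\<in>R. tens_class K V W (x + y)),
     smult = (\<lambda>a S. \<Union>x\<in>S. tens_class K V W {#(a \<odot>\<^bsub>V\<^esub> v, w). (v, w) \<in># x#})\<rparr>"

text \<open>Composition is the bilinear extension of \<open>(g \<otimes> g') \<circ> (f \<otimes> f') = (g \<circ> f) \<otimes> (g' \<circ> f')\<close>.\<close>

definition tensor_cat :: "('k, 'x) ring_scheme \<Rightarrow> ('o, 'm, 'k) kcat \<Rightarrow> ('p, 'l, 'k) kcat \<Rightarrow>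
    ('o \<times> 'p, ('m \<times> 'l) multiset set, 'k) kcat"
  where "tensor_cat K C D = \<lparr>Ob = Ob C \<times> Ob D,
     Hom = (\<lambda>(X, X') (Y, Y'). tensor K (Hom C X Y) (Hom D X' Y')),
     Cmp = (\<lambda>(X, X') (Y, Y') (Z, Z') S R. \<Union>y\<in>S. \<Union>x\<in>R.
       tens_class K (Hom C X Z) (Hom D X' Z')
         (\<Sum>(g, g')\<in>#y. {#(Cmp C X Y Z g f, Cmp D X' Y' Z' g' f'). (f, f') \<in># x#})),
     Idm = (\<lambda>(X, X'). pure_tens K (Hom C X X) (Hom D X' X') (Idm C X) (Idm D X'))\<rparr>"


section \<open>\<open>K\<close>-linear functors to finite-dimensional vector spaces\<close>

record ('o, 'm, 'k, 'v) kfun =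
  fobj :: "'o \<Rightarrow> ('k, 'v) module"
  farr :: "'o \<Rightarrow> 'o \<Rightarrow> 'm \<Rightarrow> 'v \<Rightarrow> 'v"

locale modK_functor = k_category K C for K (structure) and C :: "('o, 'm, 'a) kcat" +
  fixes M :: "('o, 'm, 'a, 'v) kfun"
  assumes fobj_module: "X \<in> Ob C \<Longrightarrow> module K (fobj M X)"
    and fobj_fin_dim: "X \<in> Ob C \<Longrightarrow> fin_dim K (fobj M X)"
    and farr_closed: "\<lbrakk>X \<in> Ob C; Y \<in> Ob C; f \<in> Mor C X Y; x \<in> carrier (fobj M X)\<rbrakk>
          \<Longrightarrow> farr M X Y f x \<in> carrier (fobj M Y)"
    and farr_add: "\<lbrakk>X \<in> Ob C; Y \<in> Ob C; f \<in> Mor C X Y; x \<in> carrier (fobj M X); y \<in> carrier (fobj M X)\<rbrakk>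
          \<Longrightarrow> farr M X Y f (x \<oplus>\<^bsub>fobj M X\<^esub> y) = farr M X Y f x \<oplus>\<^bsub>fobj M Y\<^esub> farr M X Y f y"
    and farr_smult: "\<lbrakk>X \<in> Ob C; Y \<in> Ob C; f \<in> Mor C X Y; a \<in> carrier K; x \<in> carrier (fobj M X)\<rbrakk>
          \<Longrightarrow> farr M X Y f (a \<odot>\<^bsub>fobj M X\<^esub> x) = a \<odot>\<^bsub>fobj M Y\<^esub> farr M X Y f x"
    and farr_Idm: "\<lbrakk>X \<in> Ob C; x \<in> carrier (fobj M X)\<rbrakk> \<Longrightarrow> farr M X X (Idm C X) x = x"
    and farr_Cmp: "\<lbrakk>X \<in> Ob C; Y \<in> Ob C; Z \<in> Ob C; f \<in> Mor C X Y; g \<in> Mor C Y Z; x \<in> carrier (fobj M X)\<rbrakk>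
          \<Longrightarrow> farr M X Z (Cmp C X Y Z g f) x = farr M Y Z g (farr M X Y f x)"
    and farr_add_arrow: "\<lbrakk>X \<in> Ob C; Y \<in> Ob C; f \<in> Mor C X Y; g \<in> Mor C X Y; x \<in> carrier (fobj M X)\<rbrakk>
          \<Longrightarrow> farr M X Y (f \<oplus>\<^bsub>Hom C X Y\<^esub> g) x = farr M X Y f x \<oplus>\<^bsub>fobj M Y\<^esub> farr M X Y g x"
    and farr_smult_arrow: "\<lbrakk>X \<in> Ob C; Y \<in> Ob C; a \<in> carrier K; f \<in> Mor C X Y; x \<in> carrier (fobj M X)\<rbrakk>
          \<Longrightarrow> farr M X Y (a \<odot>\<^bsub>Hom C X Y\<^esub> f) x = a \<odot>\<^bsub>fobj M Y\<^esub> farr M X Y f x"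


section \<open>The triangular matrix category\<close>

text \<open>
  \<open>act_left K U T M X X' S u\<close> is \<open>M(u \<otimes> 1) : M(X, S) \<rightarrow> M(X', S)\<close> for \<open>u : X \<rightarrow> X'\<close>, and
  \<open>act_right K U T M X S S' t\<close> is \<open>M(1 \<otimes> t\<^sup>o\<^sup>p) : M(X, S') \<rightarrow> M(X, S)\<close> for \<open>t : S \<rightarrow> S'\<close>.
\<close>

type_synonym ('u, 'p, 't, 'q, 'k, 'v) bifun = "('u \<times> 't, ('p \<times> 'q) multiset set, 'k, 'v) kfun"

definition act_left :: "('k, 'x) ring_scheme \<Rightarrow> ('u, 'p, 'k) kcat \<Rightarrow> ('t, 'q, 'k) kcat \<Rightarrow>
    ('u, 'p, 't, 'q, 'k, 'v) bifun \<Rightarrow> 'u \<Rightarrow> 'u \<Rightarrow> 't \<Rightarrow> 'p \<Rightarrow> 'v \<Rightarrow> 'v"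
  where "act_left K U T M X X' S u =
    farr M (X, S) (X', S) (pure_tens K (Hom U X X') (Hom (op_cat T) S S) u (Idm T S))"

definition act_right :: "('k, 'x) ring_scheme \<Rightarrow> ('u, 'p, 'k) kcat \<Rightarrow> ('t, 'q, 'k) kcat \<Rightarrow>
    ('u, 'p, 't, 'q, 'k, 'v) bifun \<Rightarrow> 'u \<Rightarrow> 't \<Rightarrow> 't \<Rightarrow> 'q \<Rightarrow> 'v \<Rightarrow> 'v"
  where "act_right K U T M X S S' t =
    farr M (X, S') (X, S) (pure_tens K (Hom U X X) (Hom (op_cat T) S' S) (Idm U X) t)"

definition M_at :: "('k, 'x) ring_scheme \<Rightarrow> ('u, 'p, 'k) kcat \<Rightarrow> ('t, 'q, 'k) kcat \<Rightarrow>
    ('u, 'p, 't, 'q, 'k, 'v) bifun \<Rightarrow> 't \<Rightarrow> ('u, 'p, 'v) cmod"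
  where "M_at K U T M S = \<lparr>val = (\<lambda>X. add_group (fobj M (X, S))),
           act = (\<lambda>X X' u. act_left K U T M X X' S u)\<rparr>"

text \<open>
  The pair \<open>(S, X)\<close> stands for the object with diagonal entries \<open>S\<close> of \<open>T\<close> and
  \<open>X\<close> of \<open>U\<close>; the triple \<open>(t, m, u)\<close> for the morphism with diagonal entries \<open>t\<close>, \<open>u\<close>
  and lower left entry \<open>m\<close>.
\<close>

definition tri_cat :: "('k, 'x) ring_scheme \<Rightarrow> ('u, 'p, 'k) kcat \<Rightarrow> ('t, 'q, 'k) kcat \<Rightarrow>
    ('u, 'p, 't, 'q, 'k, 'v) bifun \<Rightarrow> ('t \<times> 'u, 'q \<times> 'v \<times> 'p, 'k) kcat"
  where "tri_cat K U T M = \<lparr>Ob = Ob T \<times> Ob U,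
     Hom = (\<lambda>(S, X) (S', X').
       \<lparr>carrier = Mor T S S' \<times> carrier (fobj M (X', S)) \<times> Mor U X X',
        monoid.mult = undefined, one = undefined,
        zero = (\<zero>\<^bsub>Hom T S S'\<^esub>, \<zero>\<^bsub>fobj M (X', S)\<^esub>, \<zero>\<^bsub>Hom U X X'\<^esub>),
        add = (\<lambda>(t, m, u) (t', m', u').
          (t \<oplus>\<^bsub>Hom T S S'\<^esub> t', m \<oplus>\<^bsub>fobj M (X', S)\<^esub> m', u \<oplus>\<^bsub>Hom U X X'\<^esub> u')),
        smult = (\<lambda>a (t, m, u). (a \<odot>\<^bsub>Hom T S S'\<^esub> t, a \<odot>\<^bsub>fobj M (X', S)\<^esub> m, a \<odot>\<^bsub>Hom U X X'\<^esub> u))\<rparr>),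
     Cmp = (\<lambda>(S, X) (S', X') (S'', X'') (t2, m2, u2) (t1, m1, u1).
       (Cmp T S S' S'' t2 t1,
        act_right K U T M X'' S S' t1 m2 \<oplus>\<^bsub>fobj M (X'', S)\<^esub> act_left K U T M X' X'' S u2 m1,
        Cmp U X X' X'' u2 u1)),
     Idm = (\<lambda>(S, X). (Idm T S, \<zero>\<^bsub>fobj M (X, S)\<^esub>, Idm U X))\<rparr>"

definition tri_filt :: "('k, 'x) ring_scheme \<Rightarrow> ('u, 'p, 'k) kcat \<Rightarrow> ('t, 'q, 'k) kcat \<Rightarrow>
    ('u, 'p, 't, 'q, 'k, 'v) bifun \<Rightarrow> nat \<Rightarrow> (nat \<Rightarrow> 'u set) \<Rightarrow> (nat \<Rightarrow> 't set) \<Rightarrow> nat \<Rightarrow> ('t \<times> 'u) set"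
  where "tri_filt K U T M n Uf Tf j =
    (if j = 0 then {Z. zero_object (tri_cat K U T M) Z}
     else if j \<le> n then {Z. zero_object T Z} \<times> Uf j
     else Tf (j - n) \<times> Ob U)"

text \<open>
  The triple \<open>(F1, f, F2)\<close> of a module \<open>F\<close> over the triangular matrix category, where
  \<open>f S x X m\<close> stands for \<open>(f\<^sub>S(x))\<^sub>X(m)\<close>.  That \<open>f\<close> corresponds to the action
  of the morphisms with lower left entry \<open>m\<close> and zero diagonal is read off from the
  inverse construction \<open>(x, y) \<mapsto> (A(t) x, (f\<^sub>S(x))\<^sub>X(m) + B(u) y)\<close>.
\<close>

definition zero_ob :: "('o, 'm, 'k) kcat \<Rightarrow> 'o"
  where "zero_ob C = (SOME Z. zero_object C Z)"

definition triple_of :: "('u, 'p, 'k) kcat \<Rightarrow> ('t, 'q, 'k) kcat \<Rightarrow>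
    ('u, 'p, 't, 'q, 'k, 'v) bifun \<Rightarrow> ('t \<times> 'u, 'q \<times> 'v \<times> 'p, 'a) cmod \<Rightarrow>
    ('t, 'q, 'a) cmod \<times> ('t \<Rightarrow> 'a \<Rightarrow> 'u \<Rightarrow> 'v \<Rightarrow> 'a) \<times> ('u, 'p, 'a) cmod"
  where "triple_of U T M F = (let Z = zero_ob U; W = zero_ob T in
    (\<lparr>val = (\<lambda>S. val F (S, Z)),
      act = (\<lambda>S S' t. act F (S, Z) (S', Z) (t, \<zero>\<^bsub>fobj M (Z, S)\<^esub>, \<zero>\<^bsub>Hom U Z Z\<^esub>))\<rparr>,
     \<lambda>S x X m. act F (S, Z) (W, X) (\<zero>\<^bsub>Hom T S W\<^esub>, m, \<zero>\<^bsub>Hom U Z X\<^esub>) x,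
     \<lparr>val = (\<lambda>X. val F (W, X)),
      act = (\<lambda>X X' u. act F (W, X) (W, X') (\<zero>\<^bsub>Hom T W W\<^esub>, \<zero>\<^bsub>fobj M (X', W)\<^esub>, u))\<rparr>))"

end

theory Submission
  imports Defs
begin

text \<open>
  Fix zero objects \<open>Z\<close> of \<open>U\<close> and \<open>W\<close> of \<open>T\<close>.  Then \<open>S \<mapsto> (S, Z)\<close> and \<open>X \<mapsto> (W, X)\<close> embed \<open>T\<close> and
  \<open>U\<close> as full subcategories of the triangular matrix category, the components of the triple of a
  module are its restrictions to these two corners, and every object \<open>(S, X)\<close> is the direct sum of its
  two corners.  The filtration is \<open>j \<mapsto> Tf (j - n) \<times> Uf (min j n)\<close> throughout.  Morphisms from \<open>(S, X)\<close> to
  \<open>(S', Z)\<close> factor through \<open>(S, Z)\<close>, so that traces, ideals and indecomposables restrict to the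
  corners; a standard module of the \<open>U\<close>-part of the filtration restricts to a standard module over
  \<open>U\<close> and to zero over \<open>T\<close>, and vice versa for the \<open>T\<close>-part, because every morphism into
  some \<open>(W, X)\<close> lies in the ideal which is factored out.

  Conversely, a module that vanishes on one corner is determined by its restriction to the other.  Given
  finite filtrations of \<open>F1\<close> and \<open>F2\<close>, one filters \<open>F\<close> first through \<open>(0, F2)\<close> and then through
  \<open>(F1, F2)/(0, F2)\<close>; each factor vanishes on one corner.
\<close>

section \<open>Modules over a category\<close>

text \<open>The two corners are not symmetric. A morphism from \<open>(S, X)\<close> to
  \<open>(S', Z)\<close> has only a \<open>T\<close>-entry, whereas M(X, S) supplies morphisms from
  \<open>(S, Z)\<close> to \<open>(W, X)\<close>. So every object is cosupported relative to the
  \<open>T\<close>-corner, but relative to the \<open>U\<close>-corner this is only available for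
  objects with zero \<open>T\<close>-entry. Hence traces are compared with those over
  \<open>T\<close> at every index, and with those over \<open>U\<close> up to \<open>n\<close>;
  beyond \<open>n\<close> the trace is all of \<open>F2\<close>. For the same reason a pair of
  submodules of \<open>F1\<close> and \<open>F2\<close> need not form a submodule of
  \<open>F\<close>: the action of \<open>M\<close> must carry the first into the second. In the
  filtration of \<open>F\<close> this holds at each stage for a trivial reason, as the first is zero
  or the second is everything. Both corners are instances of one locale, modelled on the passage
  from a ring R to eRe for an idempotent e. Morphisms of the matrix category are triples, so the
  restriction of a standard module agrees with a standard module over the corner only up to
  isomorphism. This is why isomorphisms have to be carried through quotients and direct
  sums.\<close>

abbreviation trivial :: "'a monoid \<Rightarrow> bool"
  where "trivial G \<equiv> carrier G = {\<one>\<^bsub>G\<^esub>}"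

lemma ModulesD:
  assumes "F \<in> Modules C"
  shows Modules_comm_group: "X \<in> Ob C \<Longrightarrow> comm_group (val F X)"
    and Modules_act_hom: "\<lbrakk>X \<in> Ob C; Y \<in> Ob C; f \<in> Mor C X Y\<rbrakk> \<Longrightarrow> act F X Y f \<in> hom (val F X) (val F Y)"
    and Modules_act_Idm: "\<lbrakk>X \<in> Ob C; x \<in> carrier (val F X)\<rbrakk> \<Longrightarrow> act F X X (Idm C X) x = x"
    and Modules_act_Cmp: "\<lbrakk>X \<in> Ob C; Y \<in> Ob C; Z \<in> Ob C; f \<in> Mor C X Y; g \<in> Mor C Y Z; x \<in> carrier (val F X)\<rbrakk>
      \<Longrightarrow> act F X Z (Cmp C X Y Z g f) x = act F Y Z g (act F X Y f x)"
    and Modules_act_add: "\<lbrakk>X \<in> Ob C; Y \<in> Ob C; f \<in> Mor C X Y; g \<in> Mor C X Y; x \<in> carrier (val F X)\<rbrakk>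
      \<Longrightarrow> act F X Y (f \<oplus>\<^bsub>Hom C X Y\<^esub> g) x = act F X Y f x \<otimes>\<^bsub>val F Y\<^esub> act F X Y g x"
  using assms unfolding Modules_def by blast+

lemma Modules_group: "F \<in> Modules C \<Longrightarrow> X \<in> Ob C \<Longrightarrow> group (val F X)"
  by (simp add: Modules_comm_group comm_group.axioms(2))

lemma Modules_act_closed:
  "\<lbrakk>F \<in> Modules C; X \<in> Ob C; Y \<in> Ob C; f \<in> Mor C X Y; x \<in> carrier (val F X)\<rbrakk>
    \<Longrightarrow> act F X Y f x \<in> carrier (val F Y)"
  by (rule hom_in_carrier[OF Modules_act_hom])

lemma Modules_act_mult:
  "\<lbrakk>F \<in> Modules C; X \<in> Ob C; Y \<in> Ob C; f \<in> Mor C X Y; x \<in> carrier (val F X); y \<in> carrier (val F X)\<rbrakk>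
    \<Longrightarrow> act F X Y f (x \<otimes>\<^bsub>val F X\<^esub> y) = act F X Y f x \<otimes>\<^bsub>val F Y\<^esub> act F X Y f y"
  by (rule hom_mult[OF Modules_act_hom])

lemma Modules_act_one:
  "\<lbrakk>F \<in> Modules C; X \<in> Ob C; Y \<in> Ob C; f \<in> Mor C X Y\<rbrakk> \<Longrightarrow> act F X Y f \<one>\<^bsub>val F X\<^esub> = \<one>\<^bsub>val F Y\<^esub>"
  by (rule hom_one[OF Modules_act_hom]) (simp_all add: Modules_group)

lemma Mod_homD:
  assumes "\<eta> \<in> Mod_hom C F G"
  shows Mod_hom_hom: "X \<in> Ob C \<Longrightarrow> \<eta> X \<in> hom (val F X) (val G X)"
    and Mod_hom_natural: "\<lbrakk>X \<in> Ob C; Y \<in> Ob C; f \<in> Mor C X Y; x \<in> carrier (val F X)\<rbrakk>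
      \<Longrightarrow> \<eta> Y (act F X Y f x) = act G X Y f (\<eta> X x)"
  using assms unfolding Mod_hom_def by blast+

definition natural_iso ::
    "('o, 'm, 'k) kcat \<Rightarrow> ('o, 'm, 'a) cmod \<Rightarrow> ('o, 'm, 'b) cmod \<Rightarrow> ('o \<Rightarrow> 'a \<Rightarrow> 'b) \<Rightarrow> bool"
  where "natural_iso C F G \<eta> \<longleftrightarrow> \<eta> \<in> Mod_hom C F G \<and> (\<forall>X\<in>Ob C. \<eta> X \<in> iso (val F X) (val G X))"

lemma Mod_isoE:
  assumes "Mod_iso C F G"
  obtains \<eta> where "natural_iso C F G \<eta>"
  using assms unfolding Mod_iso_def natural_iso_def by blast

lemma natural_isoI:
  assumes "\<And>X. X \<in> Ob C \<Longrightarrow> \<eta> X \<in> iso (val F X) (val G X)"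
    and "\<And>X Y f x. \<lbrakk>X \<in> Ob C; Y \<in> Ob C; f \<in> Mor C X Y; x \<in> carrier (val F X)\<rbrakk>
      \<Longrightarrow> \<eta> Y (act F X Y f x) = act G X Y f (\<eta> X x)"
  shows "natural_iso C F G \<eta>"
  unfolding natural_iso_def Mod_hom_def using assms by (auto simp: iso_def)

lemma natural_iso_imp_Mod_iso: "natural_iso C F G \<eta> \<Longrightarrow> Mod_iso C F G"
  unfolding Mod_iso_def natural_iso_def by blast

lemmas Mod_isoI = natural_iso_imp_Mod_iso[OF natural_isoI]

lemma natural_isoD:
  assumes "natural_iso C F G \<eta>"
  shows "X \<in> Ob C \<Longrightarrow> \<eta> X \<in> iso (val F X) (val G X)"
    and "\<lbrakk>X \<in> Ob C; Y \<in> Ob C; f \<in> Mor C X Y; x \<in> carrier (val F X)\<rbrakk>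
      \<Longrightarrow> \<eta> Y (act F X Y f x) = act G X Y f (\<eta> X x)"
  using assms Mod_hom_natural[of \<eta> C F G] unfolding natural_iso_def by blast+

lemma iso_closed: "h \<in> iso G H \<Longrightarrow> x \<in> carrier G \<Longrightarrow> h x \<in> carrier H"
  by (auto simp: iso_def hom_def)

lemma Mod_iso_cong:
  assumes "\<And>X. X \<in> Ob C \<Longrightarrow> val F X = val G X"
    and "\<And>X Y f x. \<lbrakk>X \<in> Ob C; Y \<in> Ob C; f \<in> Mor C X Y; x \<in> carrier (val F X)\<rbrakk>
      \<Longrightarrow> act F X Y f x = act G X Y f x"
  shows "Mod_iso C F G"
proof (rule Mod_isoI[where \<eta> = "\<lambda>X x. x"])
  show "(\<lambda>x. x) \<in> iso (val F X) (val G X)" if "X \<in> Ob C" for X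
    using assms(1)[OF that] iso_set_refl[of "val F X"] by simp
qed (use assms(2) in blast)

lemma Mod_iso_trans:
  assumes "Mod_iso C F G" and "Mod_iso C G H"
  shows "Mod_iso C F H"
proof -
  from assms(1) obtain \<alpha> where "natural_iso C F G \<alpha>"
    by (rule Mod_isoE)
  note \<alpha> = natural_isoD[OF this]
  from assms(2) obtain \<beta> where "natural_iso C G H \<beta>"
    by (rule Mod_isoE)
  note \<beta> = natural_isoD[OF this]
  show ?thesis
  proof (rule Mod_isoI[where \<eta> = "\<lambda>X. \<beta> X \<circ> \<alpha> X"])
    show "\<beta> X \<circ> \<alpha> X \<in> iso (val F X) (val H X)" if "X \<in> Ob C" for X
      using iso_set_trans \<alpha>(1) \<beta>(1) that unfolding compose_def by blast
  next
    fix X Y f x assume "X \<in> Ob C" "Y \<in> Ob C" "f \<in> Mor C X Y" "x \<in> carrier (val F X)"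
    then show "(\<beta> Y \<circ> \<alpha> Y) (act F X Y f x) = act H X Y f ((\<beta> X \<circ> \<alpha> X) x)"
      using \<alpha> \<beta> iso_closed[OF \<alpha>(1)] by simp
  qed
qed

text \<open>The bijections are inverted componentwise; the module laws of the source make the
  inverses multiplicative and let naturality be read off on preimages.\<close>

lemma Mod_iso_sym:
  assumes "Mod_iso C F G" and F: "F \<in> Modules C"
  shows "Mod_iso C G F"
proof -
  from assms(1) obtain \<alpha> where "natural_iso C F G \<alpha>"
    by (rule Mod_isoE)
  note \<alpha> = natural_isoD[OF this]
  have bij: "bij_betw (\<alpha> X) (carrier (val F X)) (carrier (val G X))" if "X \<in> Ob C" for X
    using \<alpha>(1)[OF that] by (simp add: iso_def)
  show ?thesis
  proof (rule Mod_isoI[where \<eta> = "\<lambda>X. inv_into (carrier (val F X)) (\<alpha> X)"])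
    show "inv_into (carrier (val F X)) (\<alpha> X) \<in> iso (val G X) (val F X)" if "X \<in> Ob C" for X
      using group.iso_set_sym[OF Modules_group[OF F that] \<alpha>(1)[OF that]] .
  next
    fix X Y f x assume *: "X \<in> Ob C" "Y \<in> Ob C" "f \<in> Mor C X Y" "x \<in> carrier (val G X)"
    then obtain y where y: "y \<in> carrier (val F X)" "x = \<alpha> X y"
      using bij[of X] by (auto simp: bij_betw_def)
    have "act G X Y f x = \<alpha> Y (act F X Y f y)" using \<alpha>(2) * y by simp
    then show "inv_into (carrier (val F Y)) (\<alpha> Y) (act G X Y f x)
        = act F X Y f (inv_into (carrier (val F X)) (\<alpha> X) x)"
      using y * bij[of X] bij[of Y] Modules_act_closed[OF F *(1-3) y(1)]
      by (simp add: bij_betw_def)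
  qed
qed

section \<open>Submodules and quotient modules\<close>

lemma submoduleD:
  assumes "submodule C N F"
  shows submodule_subgroup: "X \<in> Ob C \<Longrightarrow> subgroup (N X) (val F X)"
    and submodule_act: "\<lbrakk>X \<in> Ob C; Y \<in> Ob C; f \<in> Mor C X Y; x \<in> N X\<rbrakk> \<Longrightarrow> act F X Y f x \<in> N Y"
  using assms unfolding submodule_def by blast+

lemma submodule_subset: "submodule C N F \<Longrightarrow> X \<in> Ob C \<Longrightarrow> N X \<subseteq> carrier (val F X)"
  by (rule subgroup.subset[OF submodule_subgroup])

lemma val_restrict_Mod [simp]: "val (restrict_Mod F N) X = (val F X)\<lparr>carrier := N X\<rparr>"
  and act_restrict_Mod [simp]: "act (restrict_Mod F N) = act F"
  by (simp_all add: restrict_Mod_def)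

lemma restrict_Mod_Modules:
  assumes F: "F \<in> Modules C" and N: "submodule C N F"
  shows "restrict_Mod F N \<in> Modules C"
proof -
  have "comm_group (val (restrict_Mod F N) X)" if "X \<in> Ob C" for X
  proof -
    interpret comm_group "val F X" using Modules_comm_group[OF F that] .
    interpret N: subgroup "N X" "val F X" using submodule_subgroup[OF N that] .
    show ?thesis
      unfolding val_restrict_Mod
      by (rule group.group_comm_groupI[OF N.subgroup_is_group[OF group_axioms]]) (simp add: m_comm)
  qed
  moreover have "act F X Y f \<in> hom (val (restrict_Mod F N) X) (val (restrict_Mod F N) Y)"
    if "X \<in> Ob C" "Y \<in> Ob C" "f \<in> Mor C X Y" for X Y f
    using that submodule_act[OF N] submodule_subset[OF N, of X] Modules_act_mult[OF F]
    by (auto simp: hom_def subset_iff)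
  ultimately show ?thesis
    using submodule_subset[OF N] ModulesD[OF F] by (auto simp: Modules_def subset_iff)
qed

lemma submodule_restrict_Mod:
  assumes F: "F \<in> Modules C" and N: "submodule C N F" and N': "submodule C N' F"
    and "\<And>X. X \<in> Ob C \<Longrightarrow> N X \<subseteq> N' X"
  shows "submodule C N (restrict_Mod F N')"
proof -
  have "subgroup (N X) ((val F X)\<lparr>carrier := N' X\<rparr>)" if "X \<in> Ob C" for X
    using group.subgroup_incl[OF Modules_group[OF F that]] submodule_subgroup[OF N that]
      submodule_subgroup[OF N' that] assms(4)[OF that] by blast
  then show ?thesis
    using submodule_act[OF N] by (auto simp: submodule_def)
qed

lemma val_quot_Mod [simp]: "val (quot_Mod F N) X = val F X Mod N X"
  by (simp add: quot_Mod_def)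

lemma carrier_quot_Mod:
  "carrier (val (quot_Mod F N) X) = {N X #>\<^bsub>val F X\<^esub> x | x. x \<in> carrier (val F X)}"
  by (auto simp: quot_Mod_def FactGroup_def RCOSETS_def)

text \<open>The action sends the coset of \<open>x\<close> into the coset of the image of
  \<open>x\<close>, and the factor \<open>N Y\<close> in \<open>quot_Mod\<close> fills up the
  latter. The laws of quotient modules can then be checked on representatives.\<close>

lemma act_quot_Mod:
  assumes F: "F \<in> Modules C" and N: "submodule C N F"
    and X: "X \<in> Ob C" and Y: "Y \<in> Ob C" and f: "f \<in> Mor C X Y" and x: "x \<in> carrier (val F X)"
  shows "act (quot_Mod F N) X Y f (N X #>\<^bsub>val F X\<^esub> x) = N Y #>\<^bsub>val F Y\<^esub> act F X Y f x"
proof -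
  interpret X: group "val F X" using Modules_group[OF F X] .
  interpret Y: group "val F Y" using Modules_group[OF F Y] .
  interpret NX: subgroup "N X" "val F X" using submodule_subgroup[OF N X] .
  interpret NY: subgroup "N Y" "val F Y" using submodule_subgroup[OF N Y] .
  let ?a = "act F X Y f"
  note [simp] = Modules_act_closed[OF F X Y f] Modules_act_mult[OF F X Y f] submodule_act[OF N X Y f] x
  have "N Y <#>\<^bsub>val F Y\<^esub> (?a ` (N X #>\<^bsub>val F X\<^esub> x)) = N Y #>\<^bsub>val F Y\<^esub> ?a x" (is "?L = ?R")
  proof
    show "?L \<subseteq> ?R"
    proof
      fix y assume "y \<in> ?L"
      then obtain n m where nm: "n \<in> N Y" "m \<in> N X" "y = n \<otimes>\<^bsub>val F Y\<^esub> ?a (m \<otimes>\<^bsub>val F X\<^esub> x)"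
        by (auto simp: set_mult_def r_coset_def)
      then have "y = (n \<otimes>\<^bsub>val F Y\<^esub> ?a m) \<otimes>\<^bsub>val F Y\<^esub> ?a x"
        by (simp add: Y.m_assoc)
      then show "y \<in> ?R" using nm by (auto simp: r_coset_def)
    qed
    show "?R \<subseteq> ?L"
    proof
      fix y assume "y \<in> ?R"
      then obtain n where n: "n \<in> N Y" "y = n \<otimes>\<^bsub>val F Y\<^esub> ?a x" by (auto simp: r_coset_def)
      moreover have "x \<in> N X #>\<^bsub>val F X\<^esub> x"
        by (rule X.rcos_self[OF x NX.subgroup_axioms])
      ultimately show "y \<in> ?L" by (auto simp: set_mult_def)
    qed
  qed
  then show ?thesis by (simp add: quot_Mod_def)
qed

lemma (in k_category) Hom_abelian_group: "X \<in> Ob C \<Longrightarrow> Y \<in> Ob C \<Longrightarrow> abelian_group (Hom C X Y)"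
  by (rule module.axioms(2)[OF Hom_module])

lemma (in k_category) Hom_add_closed:
  "\<lbrakk>X \<in> Ob C; Y \<in> Ob C; f \<in> Mor C X Y; g \<in> Mor C X Y\<rbrakk> \<Longrightarrow> f \<oplus>\<^bsub>Hom C X Y\<^esub> g \<in> Mor C X Y"
  by (simp add: abelian_group.axioms(1)[OF Hom_abelian_group] abelian_monoid.a_closed)

lemma (in k_category) quot_Mod_Modules:
  assumes F: "F \<in> Modules C" and N: "submodule C N F"
  shows "quot_Mod F N \<in> Modules C"
proof -
  note act = act_quot_Mod[OF F N]
  have nor: "normal (N X) (val F X)" if "X \<in> Ob C" for X
    using comm_group.subgroup_imp_normal[OF Modules_comm_group[OF F that]]
      submodule_subgroup[OF N that] .
  have mult: "(N X #>\<^bsub>val F X\<^esub> x) <#>\<^bsub>val F X\<^esub> (N X #>\<^bsub>val F X\<^esub> y)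
      = N X #>\<^bsub>val F X\<^esub> (x \<otimes>\<^bsub>val F X\<^esub> y)"
    if "X \<in> Ob C" "x \<in> carrier (val F X)" "y \<in> carrier (val F X)" for X x y
    using normal.rcos_sum[OF nor] that by simp
  have closed: "N X #>\<^bsub>val F X\<^esub> x \<in> carrier (val F X Mod N X)"
    if "x \<in> carrier (val F X)" for X x
    using that by (auto simp: FactGroup_def RCOSETS_def)
  have el: "\<exists>x\<in>carrier (val F X). S = N X #>\<^bsub>val F X\<^esub> x"
    if "S \<in> carrier (val F X Mod N X)" for X S
    using that by (auto simp: FactGroup_def RCOSETS_def)
  note ac = Modules_act_closed[OF F]
  have "comm_group (val F X Mod N X)" if "X \<in> Ob C" for X
    using comm_group.abelian_FactGroup[OF Modules_comm_group[OF F that]]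
      submodule_subgroup[OF N that] .
  moreover have "act (quot_Mod F N) X Y f \<in> hom (val F X Mod N X) (val F Y Mod N Y)"
    if XY: "X \<in> Ob C" "Y \<in> Ob C" "f \<in> Mor C X Y" for X Y f
  proof (rule homI)
    fix S assume "S \<in> carrier (val F X Mod N X)"
    then show "act (quot_Mod F N) X Y f S \<in> carrier (val F Y Mod N Y)"
      using el act[OF XY] ac[OF XY] closed by metis
  next
    fix S R assume "S \<in> carrier (val F X Mod N X)" "R \<in> carrier (val F X Mod N X)"
    then obtain x y where xy: "x \<in> carrier (val F X)" "S = N X #>\<^bsub>val F X\<^esub> x"
      "y \<in> carrier (val F X)" "R = N X #>\<^bsub>val F X\<^esub> y" using el by meson
    moreover have "x \<otimes>\<^bsub>val F X\<^esub> y \<in> carrier (val F X)"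
      using xy Modules_group[OF F XY(1)] by (simp add: group.subgroup_self subgroup.m_closed)
    ultimately show "act (quot_Mod F N) X Y f (S \<otimes>\<^bsub>val F X Mod N X\<^esub> R)
      = act (quot_Mod F N) X Y f S \<otimes>\<^bsub>val F Y Mod N Y\<^esub> act (quot_Mod F N) X Y f R"
      using XY act[OF XY] ac[OF XY] by (simp add: mult Modules_act_mult[OF F])
  qed
  moreover have "act (quot_Mod F N) X X (Idm C X) S = S"
    if "X \<in> Ob C" "S \<in> carrier (val F X Mod N X)" for X S
    using that el[of S X] act[of X X "Idm C X"] Idm_closed Modules_act_Idm[OF F] by auto
  moreover have "act (quot_Mod F N) X Z (Cmp C X Y Z g f) S
      = act (quot_Mod F N) Y Z g (act (quot_Mod F N) X Y f S)"
    if "X \<in> Ob C" "Y \<in> Ob C" "Z \<in> Ob C" "f \<in> Mor C X Y" "g \<in> Mor C Y Z"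
      "S \<in> carrier (val F X Mod N X)" for X Y Z f g S
    using that el[of S X] act ac Cmp_closed Modules_act_Cmp[OF F] by auto
  moreover have "act (quot_Mod F N) X Y (f \<oplus>\<^bsub>Hom C X Y\<^esub> g) S
      = act (quot_Mod F N) X Y f S \<otimes>\<^bsub>val F Y Mod N Y\<^esub> act (quot_Mod F N) X Y g S"
    if "X \<in> Ob C" "Y \<in> Ob C" "f \<in> Mor C X Y" "g \<in> Mor C X Y"
      "S \<in> carrier (val F X Mod N X)" for X Y f g S
    using that el[of S X] act ac Hom_add_closed Modules_act_add[OF F] by (auto simp: mult)
  ultimately show ?thesis unfolding Modules_def by simp
qed

section \<open>Linear categories\<close>

lemma direct_sum_Nil_iff:
  assumes "k_category K C"
  shows "direct_sum C [] Z \<longleftrightarrow> Z \<in> Ob C \<and> Idm C Z = \<zero>\<^bsub>Hom C Z Z\<^esub>"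
proof -
  interpret k_category K C by fact
  have "(\<Oplus>\<^bsub>Hom C Z Z\<^esub>k\<in>{}. f k) = \<zero>\<^bsub>Hom C Z Z\<^esub>" if "Z \<in> Ob C" for f :: "nat \<Rightarrow> 'd"
    using abelian_monoid.finsum_empty[OF abelian_group.axioms(1)[OF Hom_abelian_group]] that by fast
  then show ?thesis by (auto simp: direct_sum_def)
qed

text \<open>All that is needed of \<^const>\<open>additive_subcat\<close> for the morphisms factoring through \<open>B\<close> to form an ideal.\<close>

definition sum_closed :: "('o, 'm, 'k) kcat \<Rightarrow> 'o set \<Rightarrow> bool"
  where "sum_closed C B \<longleftrightarrow> B \<subseteq> Ob C \<and> (\<exists>Z\<in>B. zero_object C Z) \<and>
    (\<forall>X\<in>B. \<forall>Y\<in>B. \<exists>Z\<in>B. direct_sum C [X, Y] Z)"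

lemma ideal_throughI:
  "\<lbrakk>E \<in> B; f \<in> Mor C X E; g \<in> Mor C E Y; h = Cmp C X E Y g f\<rbrakk> \<Longrightarrow> h \<in> ideal_through C B X Y"
  unfolding ideal_through_def by blast

lemma ideal_throughE:
  assumes "h \<in> ideal_through C B X Y"
  obtains E f g where "E \<in> B" "f \<in> Mor C X E" "g \<in> Mor C E Y" "h = Cmp C X E Y g f"
  using assms unfolding ideal_through_def by blast

text \<open>A binary \<open>direct_sum\<close> with its structure maps named, instead of two
  families indexed by list positions.\<close>

definition biproduct :: "('o, 'm, 'k) kcat \<Rightarrow> 'o \<Rightarrow> 'o \<Rightarrow> 'o \<Rightarrow> 'm \<Rightarrow> 'm \<Rightarrow> 'm \<Rightarrow> 'm \<Rightarrow> bool"
  where "biproduct C X Y Z i p j q \<longleftrightarrow> X \<in> Ob C \<and> Y \<in> Ob C \<and> Z \<in> Ob C \<and>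
    i \<in> Mor C X Z \<and>
    p \<in> Mor C Z X \<and>
    j \<in> Mor C Y Z \<and>
    q \<in> Mor C Z Y \<and>
    Cmp C X Z X p i = Idm C X \<and>
    Cmp C Y Z Y q j = Idm C Y \<and>
    Cmp C Y Z X p j = \<zero>\<^bsub>Hom C Y X\<^esub> \<and>
    Cmp C X Z Y q i = \<zero>\<^bsub>Hom C X Y\<^esub> \<and>
    Cmp C Z X Z i p \<oplus>\<^bsub>Hom C Z Z\<^esub> Cmp C Z Y Z j q = Idm C Z"

lemma biproductD:
  assumes "biproduct C X Y Z i p j q"
  shows "X \<in> Ob C"
    and "Y \<in> Ob C"
    and "Z \<in> Ob C"
    and "i \<in> Mor C X Z"
    and "p \<in> Mor C Z X"
    and "j \<in> Mor C Y Z"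
    and "q \<in> Mor C Z Y"
    and "Cmp C X Z X p i = Idm C X"
    and "Cmp C Y Z Y q j = Idm C Y"
    and "Cmp C Y Z X p j = \<zero>\<^bsub>Hom C Y X\<^esub>"
    and "Cmp C X Z Y q i = \<zero>\<^bsub>Hom C X Y\<^esub>"
    and "Cmp C Z X Z i p \<oplus>\<^bsub>Hom C Z Z\<^esub> Cmp C Z Y Z j q = Idm C Z"
  using assms unfolding biproduct_def by simp_all

context k_category
begin

lemma Hom_abelian_monoid: "X \<in> Ob C \<Longrightarrow> Y \<in> Ob C \<Longrightarrow> abelian_monoid (Hom C X Y)"
  by (rule abelian_group.axioms(1)[OF Hom_abelian_group])

lemma Hom_zero_closed: "X \<in> Ob C \<Longrightarrow> Y \<in> Ob C \<Longrightarrow> \<zero>\<^bsub>Hom C X Y\<^esub> \<in> Mor C X Y"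
  by (simp add: abelian_monoid.zero_closed[OF Hom_abelian_monoid])

lemma Hom_l_zero: "\<lbrakk>X \<in> Ob C; Y \<in> Ob C; f \<in> Mor C X Y\<rbrakk> \<Longrightarrow> \<zero>\<^bsub>Hom C X Y\<^esub> \<oplus>\<^bsub>Hom C X Y\<^esub> f = f"
  by (simp add: abelian_monoid.l_zero[OF Hom_abelian_monoid])

lemma Hom_r_zero: "\<lbrakk>X \<in> Ob C; Y \<in> Ob C; f \<in> Mor C X Y\<rbrakk> \<Longrightarrow> f \<oplus>\<^bsub>Hom C X Y\<^esub> \<zero>\<^bsub>Hom C X Y\<^esub> = f"
  by (simp add: abelian_monoid.r_zero[OF Hom_abelian_monoid])

text \<open>Cancellation in the hom group. An additive map sends zero to an element equal to its own
  double; preservation of zero by composition and by \<open>ar\<close> is derived this way.\<close>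

lemma Hom_idempotent_zero:
  "\<lbrakk>X \<in> Ob C; Y \<in> Ob C; f \<in> Mor C X Y; f \<oplus>\<^bsub>Hom C X Y\<^esub> f = f\<rbrakk> \<Longrightarrow> f = \<zero>\<^bsub>Hom C X Y\<^esub>"
proof -
  assume X: "X \<in> Ob C" "Y \<in> Ob C" and f: "f \<in> Mor C X Y" "f \<oplus>\<^bsub>Hom C X Y\<^esub> f = f"
  interpret abelian_group "Hom C X Y" by (rule Hom_abelian_group[OF X])
  show ?thesis using f add.l_cancel_one[of f f] by simp
qed

lemma Cmp_zero_left:
  assumes "X \<in> Ob C" "Y \<in> Ob C" "Z \<in> Ob C" "f \<in> Mor C X Y"
  shows "Cmp C X Y Z \<zero>\<^bsub>Hom C Y Z\<^esub> f = \<zero>\<^bsub>Hom C X Z\<^esub>"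
proof (rule Hom_idempotent_zero)
  show "Cmp C X Y Z \<zero>\<^bsub>Hom C Y Z\<^esub> f \<oplus>\<^bsub>Hom C X Z\<^esub> Cmp C X Y Z \<zero>\<^bsub>Hom C Y Z\<^esub> f = Cmp C X Y Z \<zero>\<^bsub>Hom C Y Z\<^esub> f"
    using Cmp_add_left[OF assms Hom_zero_closed Hom_zero_closed] assms
    by (simp add: Hom_l_zero Hom_zero_closed)
qed (simp_all add: assms Cmp_closed[of X Y] Hom_zero_closed)

lemma Cmp_zero_right:
  assumes "X \<in> Ob C" "Y \<in> Ob C" "Z \<in> Ob C" "g \<in> Mor C Y Z"
  shows "Cmp C X Y Z g \<zero>\<^bsub>Hom C X Y\<^esub> = \<zero>\<^bsub>Hom C X Z\<^esub>"
proof (rule Hom_idempotent_zero)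
  show "Cmp C X Y Z g \<zero>\<^bsub>Hom C X Y\<^esub> \<oplus>\<^bsub>Hom C X Z\<^esub> Cmp C X Y Z g \<zero>\<^bsub>Hom C X Y\<^esub> = Cmp C X Y Z g \<zero>\<^bsub>Hom C X Y\<^esub>"
    using Cmp_add_right[OF assms(1-3) Hom_zero_closed Hom_zero_closed assms(4)] assms
    by (simp add: Hom_l_zero Hom_zero_closed)
qed (simp_all add: assms Cmp_closed[of X Y] Hom_zero_closed)

text \<open>Every morphism into or out of \<open>Z\<close> is its own composite with
  \<open>Idm C Z\<close>, so the vanishing of this one morphism suffices.\<close>

lemma zero_object_iff: "zero_object C Z \<longleftrightarrow> Z \<in> Ob C \<and> Idm C Z = \<zero>\<^bsub>Hom C Z Z\<^esub>"
proof
  assume "zero_object C Z" then show "Z \<in> Ob C \<and> Idm C Z = \<zero>\<^bsub>Hom C Z Z\<^esub>"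
    using Idm_closed unfolding zero_object_def by blast
next
  assume Z: "Z \<in> Ob C \<and> Idm C Z = \<zero>\<^bsub>Hom C Z Z\<^esub>"
  have "f = \<zero>\<^bsub>Hom C X Z\<^esub>" if "X \<in> Ob C" "f \<in> Mor C X Z" for X f
    using Cmp_Idm_left[of X Z f] Cmp_zero_left[of X Z Z f] that Z by simp
  moreover have "f = \<zero>\<^bsub>Hom C Z X\<^esub>" if "X \<in> Ob C" "f \<in> Mor C Z X" for X f
    using Cmp_Idm_right[of Z X f] Cmp_zero_right[of Z Z X f] that Z by simp
  ultimately show "zero_object C Z"
    using Z Hom_zero_closed by (auto simp: zero_object_def)
qed

lemma zero_object_Mor:
  assumes "zero_object C Z" "X \<in> Ob C"
  shows "f \<in> Mor C X Z \<longleftrightarrow> f = \<zero>\<^bsub>Hom C X Z\<^esub>" and "f \<in> Mor C Z X \<longleftrightarrow> f = \<zero>\<^bsub>Hom C Z X\<^esub>"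
  using assms by (auto simp: zero_object_def)

lemma zero_object_isomorphic:
  assumes "zero_object C Z" "zero_object C Z'"
  shows "isomorphic C Z Z'"
proof -
  have "Z \<in> Ob C" "Z' \<in> Ob C" using assms by (auto simp: zero_object_def)
  then have "is_iso C Z Z' \<zero>\<^bsub>Hom C Z Z'\<^esub>"
    using assms by (auto simp: is_iso_def zero_object_iff Hom_zero_closed Cmp_zero_left
        intro!: bexI[of _ "\<zero>\<^bsub>Hom C Z' Z\<^esub>"])
  then show ?thesis by (auto simp: isomorphic_def)
qed

lemma direct_sum_Nil: "direct_sum C [] Z \<longleftrightarrow> zero_object C Z"
  using direct_sum_Nil_iff[OF k_category_axioms] by (simp add: zero_object_iff)

lemma additive_subcat_zero_object:
  "additive_subcat C B \<Longrightarrow> \<exists>Z\<in>B. zero_object C Z"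
proof -
  assume "additive_subcat C B"
  then have "\<forall>Xs. set Xs \<subseteq> B \<longrightarrow> (\<exists>Z\<in>B. direct_sum C Xs Z)"
    unfolding additive_subcat_def by (rule conjunct2)
  from spec[OF this, of "[]"] show ?thesis by (simp add: direct_sum_Nil)
qed

lemma additively_closed_subcat: "additively_closed C B \<Longrightarrow> additive_subcat C B"
  unfolding additively_closed_def by (rule conjunct1)

lemma additively_closed_isomorphic:
  "\<lbrakk>additively_closed C B; X \<in> B; Y \<in> Ob C; isomorphic C X Y\<rbrakk> \<Longrightarrow> Y \<in> B"
  unfolding additively_closed_def by (elim conjE) (drule bspec, assumption, drule bspec, assumption, drule mp)

text \<open>Some zero object lies in \<open>B\<close> as the sum of the empty list, and all zero
  objects are isomorphic. Thus the fixed zero objects of \<open>U\<close> and \<open>T\<close> lie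
  in every term of the filtrations.\<close>

lemma additively_closed_zero_object:
  assumes "additively_closed C B" "zero_object C Z"
  shows "Z \<in> B"
proof -
  obtain Z' where Z': "Z' \<in> B" "zero_object C Z'"
    using additive_subcat_zero_object[OF additively_closed_subcat[OF assms(1)]] by (elim bexE)
  then show ?thesis
    using additively_closed_isomorphic[OF assms(1) Z'(1) _ zero_object_isomorphic[OF Z'(2) assms(2)]] assms(2)
    by (simp add: zero_object_iff)
qed

lemma additive_subcat_sum_closed:
  assumes "additive_subcat C B" shows "sum_closed C B"
proof -
  have "\<exists>Z\<in>B. direct_sum C [X, Y] Z" if "X \<in> B" "Y \<in> B" for X Y
  proof -
    have "\<forall>Xs. set Xs \<subseteq> B \<longrightarrow> (\<exists>Z\<in>B. direct_sum C Xs Z)"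
      using assms unfolding additive_subcat_def by (rule conjunct2)
    from spec[OF this, of "[X, Y]"] show ?thesis using that by simp
  qed
  moreover have "B \<subseteq> Ob C"
    using assms unfolding additive_subcat_def by (rule conjunct1)
  ultimately show ?thesis
    using additive_subcat_zero_object[OF assms] unfolding sum_closed_def by (intro conjI ballI)
qed

lemma sum_closedD:
  assumes "sum_closed C B"
  shows sum_closed_subset: "X \<in> B \<Longrightarrow> X \<in> Ob C"
    and sum_closed_zero_object: "\<exists>Z\<in>B. zero_object C Z"
    and sum_closed_direct_sum: "\<lbrakk>X \<in> B; Y \<in> B\<rbrakk> \<Longrightarrow> \<exists>Z\<in>B. direct_sum C [X, Y] Z"
  using assms unfolding sum_closed_def by (elim conjE; simp add: subset_iff)+

lemma finsum_pair:
  assumes "X \<in> Ob C" "Y \<in> Ob C" "f 0 \<in> Mor C X Y" "f (Suc 0) \<in> Mor C X Y"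
  shows "(\<Oplus>\<^bsub>Hom C X Y\<^esub>k\<in>{..<length [A, B]}. f k) = f 0 \<oplus>\<^bsub>Hom C X Y\<^esub> f (Suc 0)"
proof -
  interpret abelian_group "Hom C X Y" using Hom_abelian_group assms by blast
  have "{..<length [A, B]} = {0, Suc 0}" by auto
  then show ?thesis using assms by (simp add: finsum_insert a_ac)
qed

lemma direct_sum_pairI:
  assumes ob: "X \<in> Ob C" "Y \<in> Ob C" "Z \<in> Ob C"
    and mor: "i \<in> Mor C X Z" "p \<in> Mor C Z X" "j \<in> Mor C Y Z" "q \<in> Mor C Z Y"
    and eq: "Cmp C X Z X p i = Idm C X" "Cmp C Y Z Y q j = Idm C Y"
      "Cmp C Y Z X p j = \<zero>\<^bsub>Hom C Y X\<^esub>" "Cmp C X Z Y q i = \<zero>\<^bsub>Hom C X Y\<^esub>"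
      "Cmp C Z X Z i p \<oplus>\<^bsub>Hom C Z Z\<^esub> Cmp C Z Y Z j q = Idm C Z"
  shows "direct_sum C [X, Y] Z"
proof -
  let ?i = "\<lambda>k :: nat. if k = 0 then i else j" and ?p = "\<lambda>k :: nat. if k = 0 then p else q"
  have 1: "(\<Oplus>\<^bsub>Hom C Z Z\<^esub>k\<in>{..<length [X, Y]}. Cmp C Z ([X, Y] ! k) Z (?i k) (?p k)) = Idm C Z"
    using ob mor by (subst finsum_pair) (auto simp: eq Cmp_closed[of Z X] Cmp_closed[of Z Y])
  have 2: "\<forall>k<length [X, Y]. ?i k \<in> Mor C ([X, Y] ! k) Z \<and> ?p k \<in> Mor C Z ([X, Y] ! k)"
    using mor by (simp add: All_less_Suc2)
  have 3: "\<forall>k<length [X, Y]. \<forall>l<length [X, Y].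
      Cmp C ([X, Y] ! l) Z ([X, Y] ! k) (?p k) (?i l) =
          (if k = l then Idm C ([X, Y] ! k) else \<zero>\<^bsub>Hom C ([X, Y] ! l) ([X, Y] ! k)\<^esub>)"
    using eq by (simp add: All_less_Suc2)
  have 4: "set [X, Y] \<subseteq> Ob C" using ob by simp
  show ?thesis
    unfolding direct_sum_def
    by (rule conjI[OF 4], rule conjI[OF ob(3)], rule exI[of _ ?i], rule exI[of _ ?p],
        rule conjI[OF 2], rule conjI[OF 3], rule 1)
qed

lemma direct_sum_pairE:
  assumes "direct_sum C [X, Y] Z"
  obtains i p j q where "biproduct C X Y Z i p j q"
proof -
  have ob: "X \<in> Ob C" "Y \<in> Ob C" "Z \<in> Ob C" using assms by (auto simp: direct_sum_def)
  obtain inj prj where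
    mor: "\<forall>k<length [X, Y]. inj k \<in> Mor C ([X, Y] ! k) Z \<and> prj k \<in> Mor C Z ([X, Y] ! k)"
    and eq: "\<forall>k<length [X, Y]. \<forall>l<length [X, Y].
      Cmp C ([X, Y] ! l) Z ([X, Y] ! k) (prj k) (inj l) =
          (if k = l then Idm C ([X, Y] ! k) else \<zero>\<^bsub>Hom C ([X, Y] ! l) ([X, Y] ! k)\<^esub>)"
    and sum: "(\<Oplus>\<^bsub>Hom C Z Z\<^esub>k\<in>{..<length [X, Y]}. Cmp C Z ([X, Y] ! k) Z (inj k) (prj k)) = Idm C Z"
    using assms unfolding direct_sum_def by (elim conjE exE) (rule that)
  have m: "inj 0 \<in> Mor C X Z" "inj 1 \<in> Mor C Y Z" "prj 0 \<in> Mor C Z X" "prj 1 \<in> Mor C Z Y"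
    using mor by (simp_all add: All_less_Suc2)
  have "Cmp C Z X Z (inj 0) (prj 0) \<oplus>\<^bsub>Hom C Z Z\<^esub> Cmp C Z Y Z (inj 1) (prj 1) = Idm C Z"
    using sum m ob by (subst (asm) finsum_pair) (auto simp: Cmp_closed[of Z X] Cmp_closed[of Z Y])
  then show thesis
    using m eq ob by (intro that[of "inj 0" "prj 0" "inj 1" "prj 1"]) (simp add: biproduct_def All_less_Suc2)
qed

section \<open>Full subcategories and relative indecomposability\<close>

lemma full_sub_simps:
  "Ob (full_sub C B) = B" "Hom (full_sub C B) = Hom C"
  "Cmp (full_sub C B) = Cmp C" "Idm (full_sub C B) = Idm C"
  by (simp_all add: full_sub_def)

lemma full_sub_k_category:
  assumes "B \<subseteq> Ob C"
  shows "k_category K (full_sub C B)"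
proof -
  note sub = subsetD[OF assms]
  show ?thesis
    by (rule k_category.intro[OF k_category.axioms(1)[OF k_category_axioms] k_category_axioms.intro];
        unfold full_sub_simps)
      ((rule Hom_module Idm_closed Cmp_closed Cmp_Idm_left
        Cmp_Idm_right Cmp_assoc Cmp_add_left Cmp_add_right Cmp_smult_left Cmp_smult_right;
        (assumption | erule sub))+)
qed

lemma direct_sum_full_sub:
  "B \<subseteq> Ob C \<Longrightarrow> direct_sum (full_sub C B) Xs Z \<longleftrightarrow> set Xs \<subseteq> B \<and> Z \<in> B \<and> direct_sum C Xs Z"
  unfolding direct_sum_def full_sub_simps
  by (intro iffI; elim conjE; intro conjI;
      (assumption | (erule order_trans, assumption) | (erule subsetD, assumption)))

lemma zero_object_full_sub:
  assumes "B \<subseteq> Ob C"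
  shows "zero_object (full_sub C B) Z \<longleftrightarrow> Z \<in> B \<and> zero_object C Z"
  unfolding zero_object_iff k_category.zero_object_iff[OF full_sub_k_category[OF assms]]
    full_sub_simps
  using subsetD[OF assms] by fast

text \<open>Relative to \<open>B\<close> only decompositions with both summands in \<open>B\<close>
  count, so a decomposition that is to contradict indecomposability has to be produced inside the
  filtration term.\<close>

lemma Ind_iff:
  assumes "B \<subseteq> Ob C"
  shows "X \<in> Ind C B \<longleftrightarrow> X \<in> B \<and> \<not> zero_object C X \<and>
    (\<forall>Y\<in>B. \<forall>Z\<in>B. direct_sum C [Y, Z] X \<longrightarrow> zero_object C Y \<or> zero_object C Z)"
  unfolding Ind_def indecomposable_def direct_sum_full_sub[OF assms] zero_object_full_sub[OF assms]
    full_sub_simps mem_Collect_eq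
  by (simp only: list.set insert_subset empty_subsetI simp_thms) blast

text \<open>A smaller subcategory offers fewer decompositions. Consequently an element of
  \<open>Ind C B - Ind C B'\<close> lies outside \<open>B'\<close> itself, which is how the index
  set of the standard modules is used.\<close>

lemma Ind_mono: "\<lbrakk>X \<in> Ind C B; B' \<subseteq> B; B \<subseteq> Ob C; X \<in> B'\<rbrakk> \<Longrightarrow> X \<in> Ind C B'"
  by (simp add: Ind_iff subset_iff)

section \<open>Representable modules and the ideals of morphisms factoring through a
  subcategory\<close>

lemma m_inv_add_group: "m_inv (add_group V) x = a_inv V x"
  by (simp add: m_inv_def add_group_def a_inv_def)

lemma add_group_comm_group:
  assumes "abelian_group V" shows "comm_group (add_group V)"
proof -
  interpret abelian_group V by fact
  show ?thesis
    by (rule comm_groupI) (auto simp: add_group_def a_ac intro: bexI[of _ "\<ominus>\<^bsub>V\<^esub> x" for x] l_neg)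
qed

lemma rep_simps [simp]:
  "carrier (val (rep C E) X) = Mor C E X"
  "\<one>\<^bsub>val (rep C E) X\<^esub> = \<zero>\<^bsub>Hom C E X\<^esub>"
  "x \<otimes>\<^bsub>val (rep C E) X\<^esub> y = x \<oplus>\<^bsub>Hom C E X\<^esub> y"
  "act (rep C E) X Y f x = Cmp C E X Y f x"
  by (simp_all add: rep_def add_group_def)

lemma rep_Modules:
  assumes E: "E \<in> Ob C"
  shows "rep C E \<in> Modules C"
proof -
  have "comm_group (val (rep C E) X)" if "X \<in> Ob C" for X
    using add_group_comm_group[OF Hom_abelian_group[OF E that]] by (simp add: rep_def)
  then show ?thesis
    unfolding Modules_def using E
    by (auto simp: hom_def Cmp_closed[of E] Cmp_add_right Cmp_Idm_left Cmp_assoc Cmp_add_left)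
qed

text \<open>Two factorizations, through \<open>Y\<close> and through \<open>Y'\<close>, are merged
  over a direct sum \<open>Z\<close> of both objects; for inverses the second factor is
  negated.\<close>

lemma ideal_through_submodule:
  assumes B: "sum_closed C B" and E: "E \<in> Ob C"
  shows "submodule C (ideal_through C B E) (rep C E)"
  unfolding submodule_def
proof (intro conjI ballI)
  note BOb = sum_closed_subset[OF B]
  fix X assume X: "X \<in> Ob C"
  interpret group "val (rep C E) X"
    using Modules_group[OF rep_Modules[OF E] X] .
  interpret H: abelian_group "Hom C E X" using Hom_abelian_group[OF E X] .
  show "subgroup (ideal_through C B E X) (val (rep C E) X)"
  proof (rule subgroupI)
    show "ideal_through C B E X \<subseteq> carrier (val (rep C E) X)"
      using BOb E X by (auto elim!: ideal_throughE simp: Cmp_closed)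
    obtain Z where "Z \<in> B" "zero_object C Z" using sum_closed_zero_object[OF B] by (elim bexE)
    then have "Cmp C E Z X \<zero>\<^bsub>Hom C Z X\<^esub> \<zero>\<^bsub>Hom C E Z\<^esub> \<in> ideal_through C B E X"
      using BOb[of Z] E X by (intro ideal_throughI[OF _ _ _ refl]) (simp_all add: Hom_zero_closed)
    then show "ideal_through C B E X \<noteq> {}" by blast
  next
    fix a assume "a \<in> ideal_through C B E X"
    then obtain Y f g where *: "Y \<in> B" "f \<in> Mor C E Y" "g \<in> Mor C Y X" "a = Cmp C E Y X g f"
      by (rule ideal_throughE)
    note Y = BOb[OF *(1)]
    interpret H': abelian_group "Hom C Y X" using Hom_abelian_group[OF Y X] .
    have "Cmp C E Y X (\<ominus>\<^bsub>Hom C Y X\<^esub> g) f \<oplus>\<^bsub>Hom C E X\<^esub> a = \<zero>\<^bsub>Hom C E X\<^esub>"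
      using Cmp_add_left[OF E Y X *(2), of "\<ominus>\<^bsub>Hom C Y X\<^esub> g" g] * E X Y
      by (simp add: H'.l_neg Cmp_zero_left)
    then have "\<ominus>\<^bsub>Hom C E X\<^esub> a = Cmp C E Y X (\<ominus>\<^bsub>Hom C Y X\<^esub> g) f"
      using H.minus_equality[of "Cmp C E Y X (\<ominus>\<^bsub>Hom C Y X\<^esub> g) f" a] * E X Y by (simp add: Cmp_closed[of E Y])
    moreover have "inv\<^bsub>val (rep C E) X\<^esub> a = \<ominus>\<^bsub>Hom C E X\<^esub> a"
      by (simp add: rep_def m_inv_add_group)
    ultimately show "inv\<^bsub>val (rep C E) X\<^esub> a \<in> ideal_through C B E X"
      using ideal_throughI[OF *(1,2) H'.a_inv_closed[OF *(3)]] by simp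
  next
    fix a b assume "a \<in> ideal_through C B E X" "b \<in> ideal_through C B E X"
    then obtain Y f g Y' f' g' where
      *: "Y \<in> B" "f \<in> Mor C E Y" "g \<in> Mor C Y X" "a = Cmp C E Y X g f"
         "Y' \<in> B" "f' \<in> Mor C E Y'" "g' \<in> Mor C Y' X" "b = Cmp C E Y' X g' f'"
      by (elim ideal_throughE)
    obtain Z where Z: "Z \<in> B" "direct_sum C [Y, Y'] Z"
      using sum_closed_direct_sum[OF B *(1,5)] by (elim bexE)
    from Z(2) obtain i p j q where "biproduct C Y Y' Z i p j q"
      by (rule direct_sum_pairE)
    note ds = biproductD[OF this]
    \<comment> \<open>\<open>?k\<close> maps into both summands and \<open>?h\<close> out of both.
      In their composite the mixed terms vanish by orthogonality of the structure maps, which leaves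
      \<open>a\<close> and \<open>b\<close>.\<close>
    let ?h = "Cmp C Z Y X g p \<oplus>\<^bsub>Hom C Z X\<^esub> Cmp C Z Y' X g' q"
    let ?k = "Cmp C E Y Z i f \<oplus>\<^bsub>Hom C E Z\<^esub> Cmp C E Y' Z j f'"
    have cl: "?h \<in> Mor C Z X" "?k \<in> Mor C E Z" "Cmp C Z Y X g p \<in> Mor C Z X"
      "Cmp C Z Y' X g' q \<in> Mor C Z X" "Cmp C E Y Z i f \<in> Mor C E Z" "Cmp C E Y' Z j f' \<in> Mor C E Z"
      using * ds E X by (auto intro!: Cmp_closed Hom_add_closed)
    have "Cmp C E Z X (Cmp C Z Y X g p) (Cmp C E Y Z i f) = a"
      using * ds E X cl
      by (simp add: Cmp_assoc[of E Y Z X, symmetric] Cmp_assoc[of Y Z Y X] Cmp_assoc[of E Z Y X, symmetric]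
           Cmp_assoc[of E Y Z Y] Cmp_Idm_left Cmp_closed)
    moreover have "Cmp C E Z X (Cmp C Z Y' X g' q) (Cmp C E Y' Z j f') = b"
      using * ds E X cl
      by (simp add: Cmp_assoc[of E Z Y' X, symmetric] Cmp_assoc[of E Y' Z Y'] Cmp_Idm_left Cmp_closed)
    moreover have "Cmp C E Z X (Cmp C Z Y X g p) (Cmp C E Y' Z j f') = \<zero>\<^bsub>Hom C E X\<^esub>"
      using * ds E X cl
      by (simp add: Cmp_assoc[of E Z Y X, symmetric] Cmp_assoc[of E Y' Z Y] Cmp_zero_left Cmp_zero_right Cmp_closed)
    moreover have "Cmp C E Z X (Cmp C Z Y' X g' q) (Cmp C E Y Z i f) = \<zero>\<^bsub>Hom C E X\<^esub>"
      using * ds E X cl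
      by (simp add: Cmp_assoc[of E Z Y' X, symmetric] Cmp_assoc[of E Y Z Y'] Cmp_zero_left Cmp_zero_right Cmp_closed)
    moreover have "a \<in> Mor C E X" "b \<in> Mor C E X" using * ds E X by (auto simp: Cmp_closed)
    ultimately have "Cmp C E Z X ?h ?k = a \<oplus>\<^bsub>Hom C E X\<^esub> b"
      using cl E X ds(3) by (simp add: Cmp_add_left Cmp_add_right Hom_r_zero Hom_l_zero Hom_zero_closed)
    then show "a \<otimes>\<^bsub>val (rep C E) X\<^esub> b \<in> ideal_through C B E X"
      using ideal_throughI[OF Z(1) cl(2,1)] by simp
  qed
next
  note BOb = sum_closed_subset[OF B]
  fix X Y h assume X: "X \<in> Ob C" "Y \<in> Ob C" "h \<in> Mor C X Y"
  show "act (rep C E) X Y h ` ideal_through C B E X \<subseteq> ideal_through C B E Y"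
  proof clarify
    fix a assume "a \<in> ideal_through C B E X"
    then obtain Z f g where *: "Z \<in> B" "f \<in> Mor C E Z" "g \<in> Mor C Z X" "a = Cmp C E Z X g f"
      by (rule ideal_throughE)
    then show "act (rep C E) X Y h a \<in> ideal_through C B E Y"
      using X E BOb[of Z]
      by (intro ideal_throughI[of Z _ f _ _ "Cmp C Z X Y h g"]) (simp_all add: Cmp_assoc Cmp_closed[of Z X])
  qed
qed

lemma standard_Modules:
  "\<lbrakk>D \<in> standard C B j; sum_closed C (B (j - 1)); B j \<subseteq> Ob C\<rbrakk> \<Longrightarrow> D \<in> Modules C"
  unfolding standard_def
  by (auto simp: Ind_iff intro!: quot_Mod_Modules rep_Modules ideal_through_submodule)

end

section \<open>Isomorphisms of quotients and direct sums of modules; traces\<close>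

lemma hom_image_set_mult:
  "\<lbrakk>h \<in> hom G H; A \<subseteq> carrier G; A' \<subseteq> carrier G\<rbrakk> \<Longrightarrow> h ` (A <#>\<^bsub>G\<^esub> A') = h ` A <#>\<^bsub>H\<^esub> h ` A'"
  by (force simp: set_mult_def hom_def subset_iff image_iff)

lemma hom_image_r_coset:
  "\<lbrakk>h \<in> hom G H; A \<subseteq> carrier G; x \<in> carrier G\<rbrakk> \<Longrightarrow> h ` (A #>\<^bsub>G\<^esub> x) = h ` A #>\<^bsub>H\<^esub> h x"
  by (force simp: r_coset_def hom_def subset_iff image_iff)

text \<open>The isomorphism acts on cosets by taking images, which is injective on subsets of the
  carrier because \<eta> is injective there.\<close>

lemma Mod_iso_quot_Mod:
  assumes F: "F \<in> Modules C"
    and \<eta>: "natural_iso C F G \<eta>"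
    and N: "\<And>X. X \<in> Ob C \<Longrightarrow> N X \<subseteq> carrier (val F X)"
    and N': "\<And>X. X \<in> Ob C \<Longrightarrow> \<eta> X ` N X = N' X"
  shows "Mod_iso C (quot_Mod F N) (quot_Mod G N')"
proof (rule Mod_isoI[where \<eta> = "\<lambda>X S. \<eta> X ` S"])
  note iso = natural_isoD(1)[OF \<eta>] and natural = natural_isoD(2)[OF \<eta>]
  have coset: "N X #>\<^bsub>val F X\<^esub> x \<subseteq> carrier (val F X)" if "X \<in> Ob C" "x \<in> carrier (val F X)" for X x
    by (rule monoid.r_coset_subset_G[OF group.is_monoid[OF Modules_group[OF F that(1)]] N[OF that(1)] that(2)])
  have hom: "\<eta> X \<in> hom (val F X) (val G X)" and bij: "bij_betw (\<eta> X) (carrier (val F X)) (carrier (val G X))"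
    if "X \<in> Ob C" for X
    using iso[OF that] by (simp_all add: iso_def)
  have im: "\<eta> X ` (N X #>\<^bsub>val F X\<^esub> x) = N' X #>\<^bsub>val G X\<^esub> \<eta> X x" if "X \<in> Ob C" "x \<in> carrier (val F X)" for X x
    using hom_image_r_coset[OF hom N that(2)] N' that(1) by simp
  show "(`) (\<eta> X) \<in> iso (val (quot_Mod F N) X) (val (quot_Mod G N') X)" if X: "X \<in> Ob C" for X
  proof -
    have sub: "S \<subseteq> carrier (val F X)" if "S \<in> carrier (val (quot_Mod F N) X)" for S
      using that coset[OF X] unfolding carrier_quot_Mod by blast
    have "(`) (\<eta> X) \<in> hom (val (quot_Mod F N) X) (val (quot_Mod G N') X)"
    proof (rule homI)
      fix S assume "S \<in> carrier (val (quot_Mod F N) X)"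
      then obtain x where "x \<in> carrier (val F X)" "S = N X #>\<^bsub>val F X\<^esub> x" unfolding carrier_quot_Mod by blast
      moreover have "\<eta> X x \<in> carrier (val G X)" using hom_in_carrier[OF hom[OF X]] calculation(1) .
      ultimately show "\<eta> X ` S \<in> carrier (val (quot_Mod G N') X)"
        using im[OF X] unfolding carrier_quot_Mod by blast
    next
      fix S R assume "S \<in> carrier (val (quot_Mod F N) X)" "R \<in> carrier (val (quot_Mod F N) X)"
      then show "\<eta> X ` (S \<otimes>\<^bsub>val (quot_Mod F N) X\<^esub> R) = \<eta> X ` S \<otimes>\<^bsub>val (quot_Mod G N') X\<^esub> \<eta> X ` R"
        using hom_image_set_mult[OF hom[OF X] sub sub] by simp
    qed
    moreover have "inj_on ((`) (\<eta> X)) (carrier (val (quot_Mod F N) X))"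
      using sub bij[OF X] by (auto intro!: inj_onI simp: bij_betw_def inj_on_image_eq_iff)
    moreover have "carrier (val (quot_Mod G N') X) \<subseteq> (`) (\<eta> X) ` carrier (val (quot_Mod F N) X)"
    proof
      fix R assume "R \<in> carrier (val (quot_Mod G N') X)"
      then obtain y where y: "y \<in> carrier (val G X)" "R = N' X #>\<^bsub>val G X\<^esub> y"
        unfolding carrier_quot_Mod by blast
      then obtain x where x: "x \<in> carrier (val F X)" "y = \<eta> X x" using bij[OF X] by (auto simp: bij_betw_def)
      then have "R = \<eta> X ` (N X #>\<^bsub>val F X\<^esub> x)" using im[OF X] y by simp
      then show "R \<in> (`) (\<eta> X) ` carrier (val (quot_Mod F N) X)"
        using x(1) unfolding carrier_quot_Mod by blast
    qed
    ultimately show ?thesis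
      by (auto simp: iso_def bij_betw_def hom_def)
  qed
  fix X Y f S assume X: "X \<in> Ob C" "Y \<in> Ob C" "f \<in> Mor C X Y" and S: "S \<in> carrier (val (quot_Mod F N) X)"
  then obtain x where x: "x \<in> carrier (val F X)" "S = N X #>\<^bsub>val F X\<^esub> x" unfolding carrier_quot_Mod by blast
  then have S: "S \<subseteq> carrier (val F X)" using coset[OF X(1)] by simp
  have "\<eta> Y ` (act F X Y f ` S) = act G X Y f ` (\<eta> X ` S)"
    unfolding image_image using natural[OF X] S by (intro image_cong[OF refl]) blast
  moreover have "act F X Y f ` S \<subseteq> carrier (val F Y)"
    using S Modules_act_closed[OF F X] by blast
  ultimately show "\<eta> Y ` act (quot_Mod F N) X Y f S = act (quot_Mod G N') X Y f (\<eta> X ` S)"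
    using hom_image_set_mult[OF hom[OF X(2)] N[OF X(2)]] N'[OF X(2)] by (simp add: quot_Mod_def)
qed

section \<open>Finite direct sums of modules\<close>

lemma dsum_Mod_simps [simp]:
  "carrier (val (dsum_Mod Ds) X) = (\<Pi>\<^sub>E i\<in>{..<length Ds}. carrier (val (Ds ! i) X))"
  "x \<otimes>\<^bsub>val (dsum_Mod Ds) X\<^esub> y = (\<lambda>i\<in>{..<length Ds}. x i \<otimes>\<^bsub>val (Ds ! i) X\<^esub> y i)"
  "\<one>\<^bsub>val (dsum_Mod Ds) X\<^esub> = (\<lambda>i\<in>{..<length Ds}. \<one>\<^bsub>val (Ds ! i) X\<^esub>)"
  "act (dsum_Mod Ds) X Y f x = (\<lambda>i\<in>{..<length Ds}. act (Ds ! i) X Y f (x i))"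
  by (simp_all add: dsum_Mod_def)

lemma (in k_category) dsum_Mod_Modules:
  assumes "\<And>D. D \<in> set Ds \<Longrightarrow> D \<in> Modules C"
  shows "dsum_Mod Ds \<in> Modules C"
proof -
  have D: "Ds ! i \<in> Modules C" if "i < length Ds" for i using assms that by simp
  note [simp] = Modules_act_closed[OF D] Modules_act_mult[OF D] Modules_act_Idm[OF D]
    Modules_act_Cmp[OF D] Modules_act_add[OF D]
  have "comm_group (val (dsum_Mod Ds) X)" if X: "X \<in> Ob C" for X
  proof (rule group.group_comm_groupI)
    show "group (val (dsum_Mod Ds) X)"
      using Modules_group[OF D X] by (auto simp: dsum_Mod_def intro!: product_group)
    fix x y assume "x \<in> carrier (val (dsum_Mod Ds) X)" "y \<in> carrier (val (dsum_Mod Ds) X)"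
    then have "x i \<otimes>\<^bsub>val (Ds ! i) X\<^esub> y i = y i \<otimes>\<^bsub>val (Ds ! i) X\<^esub> x i" if "i < length Ds" for i
      using comm_monoid.m_comm[OF comm_group.axioms(1)[OF Modules_comm_group[OF D[OF that] X]]] that
      by (auto simp: PiE_iff)
    then show "x \<otimes>\<^bsub>val (dsum_Mod Ds) X\<^esub> y = y \<otimes>\<^bsub>val (dsum_Mod Ds) X\<^esub> x"
      by (auto intro!: restrict_ext)
  qed
  moreover have "act (dsum_Mod Ds) X Y f \<in> hom (val (dsum_Mod Ds) X) (val (dsum_Mod Ds) Y)"
    if "X \<in> Ob C" "Y \<in> Ob C" "f \<in> Mor C X Y" for X Y f
    using that by (intro homI) (auto intro!: restrict_ext simp: PiE_iff)
  ultimately show ?thesis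
    unfolding Modules_def
    by (auto intro!: restrict_ext simp: PiE_iff extensional_def)
qed

text \<open>Tuples are functions on an initial segment of the natural numbers. Shifting by one
  separates the tail of a tuple over \<open>D # Ds\<close> from its head, as an induction on the
  list requires.\<close>

definition dtail :: "nat \<Rightarrow> (nat \<Rightarrow> 'a) \<Rightarrow> nat \<Rightarrow> 'a"
  where "dtail n x = (\<lambda>k\<in>{..<n}. x (Suc k))"

lemma dsum_Mod_ConsD:
  assumes "x \<in> carrier (val (dsum_Mod (D # Ds)) X)"
  shows "x 0 \<in> carrier (val D X)" and "dtail (length Ds) x \<in> carrier (val (dsum_Mod Ds) X)"
    and "x \<in> extensional {..<Suc (length Ds)}"
proof -
  have *: "x i \<in> carrier (val ((D # Ds) ! i) X)" if "i < Suc (length Ds)" for i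
    using assms that by (auto simp: PiE_iff)
  show "x 0 \<in> carrier (val D X)" using *[of 0] by simp
  show "dtail (length Ds) x \<in> carrier (val (dsum_Mod Ds) X)"
    using *[of "Suc i" for i] by (auto simp: dtail_def)
  show "x \<in> extensional {..<Suc (length Ds)}" using assms by (auto simp: PiE_iff)
qed

lemma dsum_Mod_ConsI:
  assumes "a \<in> carrier (val D X)" and "y \<in> carrier (val (dsum_Mod Ds) X)"
  shows "(\<lambda>i\<in>{..<Suc (length Ds)}. case i of 0 \<Rightarrow> a | Suc k \<Rightarrow> y k) \<in> carrier (val (dsum_Mod (D # Ds)) X)"
  using assms by (auto simp: PiE_iff split: nat.split)

lemma dtail_eqD:
  assumes "x 0 = y 0" "dtail n x = dtail n y"
    and "x \<in> extensional {..<Suc n}" "y \<in> extensional {..<Suc n}"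
  shows "x = y"
proof (rule extensionalityI[OF assms(3,4)])
  fix i assume "i \<in> {..<Suc n}"
  then show "x i = y i"
    using assms(1) fun_cong[OF assms(2), of "i - 1"] by (cases i) (auto simp: dtail_def)
qed

lemma dtail_mult:
  "dtail (length Ds) (x \<otimes>\<^bsub>val (dsum_Mod (D # Ds)) X\<^esub> y)
    = dtail (length Ds) x \<otimes>\<^bsub>val (dsum_Mod Ds) X\<^esub> dtail (length Ds) y"
  by (auto simp: dtail_def intro!: restrict_ext)

lemma dtail_act:
  "dtail (length Ds) (act (dsum_Mod (D # Ds)) X Y f x) = act (dsum_Mod Ds) X Y f (dtail (length Ds) x)"
  by (auto simp: dtail_def intro!: restrict_ext)

lemma Mod_iso_dsum_Nil: "Mod_iso C (dsum_Mod []) (dsum_Mod [])"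
  by (rule Mod_isoI[where \<eta> = "\<lambda>X x. \<lambda>i\<in>{}. undefined"])
    (auto simp: iso_def hom_def bij_betw_def inj_on_def)

lemma Mod_iso_dsum_Cons:
  assumes "Mod_iso C D E" and "Mod_iso C (dsum_Mod Ds) (dsum_Mod Es)"
    and DDs: "dsum_Mod (D # Ds) \<in> Modules C"
  shows "Mod_iso C (dsum_Mod (D # Ds)) (dsum_Mod (E # Es))"
proof -
  from assms(1) obtain \<alpha> where "natural_iso C D E \<alpha>"
    by (rule Mod_isoE)
  note \<alpha> = natural_isoD[OF this]
  from assms(2) obtain \<beta> where "natural_iso C (dsum_Mod Ds) (dsum_Mod Es) \<beta>"
    by (rule Mod_isoE)
  note \<beta> = natural_isoD[OF this]
  let ?n = "length Ds" and ?m = "length Es" and ?DDs = "dsum_Mod (D # Ds)" and ?EEs = "dsum_Mod (E # Es)"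
  define \<gamma> where "\<gamma> X x = (\<lambda>i\<in>{..<Suc ?m}. case i of 0 \<Rightarrow> \<alpha> X (x 0) | Suc k \<Rightarrow> \<beta> X (dtail ?n x) k)" for X x
  note D = dsum_Mod_ConsD
  note clo = iso_closed[OF \<alpha>(1)] iso_closed[OF \<beta>(1)]
  have hom: "\<alpha> X \<in> hom (val D X) (val E X)" "\<beta> X \<in> hom (val (dsum_Mod Ds) X) (val (dsum_Mod Es) X)"
    and bij: "bij_betw (\<alpha> X) (carrier (val D X)) (carrier (val E X))"
      "bij_betw (\<beta> X) (carrier (val (dsum_Mod Ds) X)) (carrier (val (dsum_Mod Es) X))" if "X \<in> Ob C" for X
    using \<alpha>(1)[OF that] \<beta>(1)[OF that] unfolding iso_def by simp_all
  have \<gamma>_0: "\<gamma> X x 0 = \<alpha> X (x 0)" for X x by (simp add: \<gamma>_def)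
  have ext: "\<beta> X y \<in> extensional {..<?m}" if "X \<in> Ob C" "y \<in> carrier (val (dsum_Mod Ds) X)" for X y
    using clo(2)[OF that] by (auto simp: PiE_iff)
  have \<gamma>_tl: "dtail ?m (\<gamma> X x) = \<beta> X (dtail ?n x)"
    if "X \<in> Ob C" "x \<in> carrier (val ?DDs X)" for X x
    by (rule extensionalityI[OF _ ext[OF that(1) D(2)[OF that(2)]]]) (simp_all add: \<gamma>_def dtail_def)
  have \<gamma>_closed: "\<gamma> X x \<in> carrier (val ?EEs X)"
    if "X \<in> Ob C" "x \<in> carrier (val ?DDs X)" for X x
    unfolding \<gamma>_def using clo[OF that(1)] D(1,2)[OF that(2)] by (intro dsum_Mod_ConsI)
  \<comment> \<open>Equality with a value of \<gamma> is tested on head and tail separately.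
    Multiplicativity, surjectivity and naturality of \<gamma> then come from those of \<alpha> and
    \<beta>.\<close>
  have \<gamma>_eqI: "\<gamma> X x = y" if "X \<in> Ob C" "x \<in> carrier (val ?DDs X)"
    "\<alpha> X (x 0) = y 0" "\<beta> X (dtail ?n x) = dtail ?m y" "y \<in> extensional {..<Suc ?m}" for X x y
  proof (rule dtail_eqD[of _ _ ?m])
    show "\<gamma> X x 0 = y 0" unfolding \<gamma>_0 by (rule that(3))
    show "dtail ?m (\<gamma> X x) = dtail ?m y" unfolding \<gamma>_tl[OF that(1,2)] by (rule that(4))
    show "\<gamma> X x \<in> extensional {..<Suc ?m}" by (rule D(3)[OF \<gamma>_closed[OF that(1,2)]])
  qed (rule that(5))
  have iso: "\<gamma> X \<in> iso (val ?DDs X) (val ?EEs X)" if X: "X \<in> Ob C" for X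
  proof -
    have "\<gamma> X \<in> hom (val ?DDs X) (val ?EEs X)"
    proof (rule homI)
      fix x y assume xy: "x \<in> carrier (val ?DDs X)" "y \<in> carrier (val ?DDs X)"
      have "\<alpha> X (x 0 \<otimes>\<^bsub>val D X\<^esub> y 0) = \<alpha> X (x 0) \<otimes>\<^bsub>val E X\<^esub> \<alpha> X (y 0)"
        using hom_mult[OF hom(1)[OF X] D(1)[OF xy(1)] D(1)[OF xy(2)]] .
      moreover have "\<beta> X (dtail ?n x \<otimes>\<^bsub>val (dsum_Mod Ds) X\<^esub> dtail ?n y)
        = dtail ?m (\<gamma> X x) \<otimes>\<^bsub>val (dsum_Mod Es) X\<^esub> dtail ?m (\<gamma> X y)"
        unfolding \<gamma>_tl[OF X xy(1)] \<gamma>_tl[OF X xy(2)]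
        using hom_mult[OF hom(2)[OF X] D(2)[OF xy(1)] D(2)[OF xy(2)]] .
      ultimately have "\<beta> X (dtail ?n (x \<otimes>\<^bsub>val ?DDs X\<^esub> y))
        = dtail ?m (\<gamma> X x \<otimes>\<^bsub>val ?EEs X\<^esub> \<gamma> X y)"
        and "\<alpha> X ((x \<otimes>\<^bsub>val ?DDs X\<^esub> y) 0) = (\<gamma> X x \<otimes>\<^bsub>val ?EEs X\<^esub> \<gamma> X y) 0"
        unfolding dtail_mult by (simp_all add: \<gamma>_0 del: dsum_Mod_simps(1))
      moreover have "x \<otimes>\<^bsub>val ?DDs X\<^esub> y \<in> carrier (val ?DDs X)"
        using xy by (rule monoid.m_closed[OF group.is_monoid[OF Modules_group[OF DDs X]]])
      ultimately show "\<gamma> X (x \<otimes>\<^bsub>val ?DDs X\<^esub> y) = \<gamma> X x \<otimes>\<^bsub>val ?EEs X\<^esub> \<gamma> X y"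
        by (intro \<gamma>_eqI[OF X]) (assumption | simp)+
    qed (rule \<gamma>_closed[OF X])
    moreover have "inj_on (\<gamma> X) (carrier (val ?DDs X))"
    proof (rule inj_onI)
      fix x y assume xy: "x \<in> carrier (val ?DDs X)" "y \<in> carrier (val ?DDs X)"
        and eq: "\<gamma> X x = \<gamma> X y"
      have "x 0 = y 0"
        using bij_betw_imp_inj_on[OF bij(1)[OF X]] fun_cong[OF eq, of 0] D(1)[OF xy(1)] D(1)[OF xy(2)]
        unfolding \<gamma>_0 by (rule inj_onD)
      moreover have "dtail ?n x = dtail ?n y"
        using bij_betw_imp_inj_on[OF bij(2)[OF X]] arg_cong[OF eq, of "dtail ?m"] D(2)[OF xy(1)] D(2)[OF xy(2)]
        unfolding \<gamma>_tl[OF X xy(1)] \<gamma>_tl[OF X xy(2)] by (rule inj_onD)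
      ultimately show "x = y" using D(3)[OF xy(1)] D(3)[OF xy(2)] by (rule dtail_eqD)
    qed
    moreover have "z \<in> \<gamma> X ` carrier (val ?DDs X)"
      if z: "z \<in> carrier (val ?EEs X)" for z
    proof -
      obtain a where a: "a \<in> carrier (val D X)" "z 0 = \<alpha> X a"
        using bij(1)[OF X] D(1)[OF z] unfolding bij_betw_def by blast
      obtain y where y: "y \<in> carrier (val (dsum_Mod Ds) X)" "dtail ?m z = \<beta> X y"
        using bij(2)[OF X] D(2)[OF z] unfolding bij_betw_def by (metis imageE)
      let ?x = "\<lambda>i\<in>{..<Suc ?n}. case i of 0 \<Rightarrow> a | Suc k \<Rightarrow> y k"
      have "dtail ?n ?x = y"
        using y(1) by (intro extensionalityI[of _ "{..<?n}"]) (auto simp: dtail_def PiE_iff)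
      then have "\<gamma> X ?x = z"
        using a y D(3)[OF z] by (intro \<gamma>_eqI[OF X dsum_Mod_ConsI[OF a(1) y(1)]]) simp_all
      then show ?thesis using dsum_Mod_ConsI[OF a(1) y(1)] by blast
    qed
    ultimately show ?thesis
      unfolding iso_def bij_betw_def by (blast dest: hom_carrier)
  qed
  have natural: "\<gamma> Y (act ?DDs X Y f x) = act ?EEs X Y f (\<gamma> X x)"
    if X: "X \<in> Ob C" "Y \<in> Ob C" "f \<in> Mor C X Y" and x: "x \<in> carrier (val ?DDs X)"
    for X Y f x
  proof (rule \<gamma>_eqI[OF X(2)])
    show "act ?DDs X Y f x \<in> carrier (val ?DDs Y)"
      by (rule Modules_act_closed[OF DDs X x])
    show "\<alpha> Y (act ?DDs X Y f x 0) = act ?EEs X Y f (\<gamma> X x) 0"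
      using \<alpha>(2)[OF X D(1)[OF x]] by (simp add: \<gamma>_0)
    show "\<beta> Y (dtail ?n (act ?DDs X Y f x)) = dtail ?m (act ?EEs X Y f (\<gamma> X x))"
      unfolding dtail_act \<gamma>_tl[OF X(1) x] using \<beta>(2)[OF X D(2)[OF x]] .
  qed simp
  show ?thesis by (rule Mod_isoI[where \<eta> = \<gamma>]; (rule iso natural); assumption)
qed

lemma Mod_iso_dsum_drop:
  assumes "Mod_iso C (dsum_Mod Ds) (dsum_Mod Es)"
    and triv: "\<And>X. X \<in> Ob C \<Longrightarrow> trivial (val D X)"
    and DDs: "dsum_Mod (D # Ds) \<in> Modules C"
  shows "Mod_iso C (dsum_Mod (D # Ds)) (dsum_Mod Es)"
proof (rule Mod_iso_trans[OF _ assms(1)])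
  let ?n = "length Ds" and ?DDs = "dsum_Mod (D # Ds)"
  note D = dsum_Mod_ConsD
  show "Mod_iso C ?DDs (dsum_Mod Ds)"
  proof (rule Mod_isoI[where \<eta> = "\<lambda>X. dtail ?n"])
    fix X assume X: "X \<in> Ob C"
    have "dtail ?n \<in> hom (val ?DDs X) (val (dsum_Mod Ds) X)"
      by (rule homI) (erule D(2), rule dtail_mult)
    moreover have "inj_on (dtail ?n) (carrier (val ?DDs X))"
    proof (rule inj_onI)
      fix x y assume x: "x \<in> carrier (val ?DDs X)" and y: "y \<in> carrier (val ?DDs X)"
        and eq: "dtail ?n x = dtail ?n y"
      have "x 0 = y 0" using D(1)[OF x] D(1)[OF y] unfolding triv[OF X] by simp
      then show "x = y" using eq D(3)[OF x] D(3)[OF y] by (rule dtail_eqD)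
    qed
    moreover have "y \<in> dtail ?n ` carrier (val ?DDs X)"
      if y: "y \<in> carrier (val (dsum_Mod Ds) X)" for y
    proof -
      let ?x = "\<lambda>i\<in>{..<Suc ?n}. case i of 0 \<Rightarrow> \<one>\<^bsub>val D X\<^esub> | Suc k \<Rightarrow> y k"
      have "dtail ?n ?x = y"
        using y by (intro extensionalityI[of _ "{..<?n}"]) (auto simp: dtail_def PiE_iff)
      moreover have "?x \<in> carrier (val ?DDs X)"
        using y by (intro dsum_Mod_ConsI) (simp_all only: triv[OF X] singletonI)
      ultimately show ?thesis by (rule image_eqI[OF sym])
    qed
    ultimately show "dtail ?n \<in> iso (val ?DDs X) (val (dsum_Mod Ds) X)"
      unfolding iso_def bij_betw_def by (blast dest: hom_carrier)
  qed (rule dtail_act)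
qed

text \<open>Restricting a direct sum of standard modules to a corner kills some summands and turns
  the others into standard modules. The former are dropped, so \<open>Es\<close> may be shorter than
  \<open>Ds\<close>.\<close>

lemma (in k_category) Mod_iso_dsum_Mod:
  assumes "\<And>D. D \<in> set Ds \<Longrightarrow> D \<in> Modules C"
    and "\<And>D. D \<in> set Ds \<Longrightarrow> (\<forall>X\<in>Ob C. trivial (val D X)) \<or> (\<exists>E\<in>S. Mod_iso C D E)"
  shows "\<exists>Es. set Es \<subseteq> S \<and> Mod_iso C (dsum_Mod Ds) (dsum_Mod Es)"
  using assms
proof (induction Ds)
  case Nil
  show ?case using Mod_iso_dsum_Nil by (intro exI[of _ "[]"]) simp
next
  case (Cons D Ds)
  obtain Es where Es: "set Es \<subseteq> S" "Mod_iso C (dsum_Mod Ds) (dsum_Mod Es)"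
    using Cons.IH[OF Cons.prems(1) Cons.prems(2)] by auto
  have DDs: "dsum_Mod (D # Ds) \<in> Modules C"
    by (rule dsum_Mod_Modules) (rule Cons.prems(1))
  from Cons.prems(2)[OF list.set_intros(1)] show ?case
  proof (elim disjE)
    assume "\<forall>X\<in>Ob C. trivial (val D X)"
    then show ?case using Mod_iso_dsum_drop[OF Es(2) _ DDs] Es(1) by auto
  next
    assume "\<exists>E\<in>S. Mod_iso C D E"
    then obtain E where "E \<in> S" "Mod_iso C D E" by (elim bexE)
    then have "Mod_iso C (dsum_Mod (D # Ds)) (dsum_Mod (E # Es))" "set (E # Es) \<subseteq> S"
      using Mod_iso_dsum_Cons[OF _ Es(2) DDs] Es(1) by simp_all
    then show ?case by (intro exI conjI)
  qed
qed

section \<open>Traces\<close>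

definition trace_gens :: "('o, 'm, 'k) kcat \<Rightarrow> 'o set \<Rightarrow> ('o, 'm, 'a) cmod \<Rightarrow> 'o \<Rightarrow> 'a set"
  where "trace_gens C B F X = {act F E X f x | E f x. E \<in> B \<and> f \<in> Mor C E X \<and> x \<in> carrier (val F E)}"

lemma trace_gensI:
  "\<lbrakk>E \<in> B; f \<in> Mor C E X; x \<in> carrier (val F E); y = act F E X f x\<rbrakk> \<Longrightarrow> y \<in> trace_gens C B F X"
  unfolding trace_gens_def by blast

lemma trace_gensE:
  assumes "y \<in> trace_gens C B F X"
  obtains E f x where "E \<in> B" "f \<in> Mor C E X" "x \<in> carrier (val F E)" "y = act F E X f x"
  using assms unfolding trace_gens_def by blast

text \<open>Yoneda: a morphism from \<open>rep C E\<close> to \<open>F\<close> is determined by the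
  image of the identity, and every element of \<open>F\<close> at \<open>E\<close> is such an image.
  Traces can then be handled with elements instead of natural transformations.\<close>

lemma (in k_category) trace_filt_eq:
  assumes F: "F \<in> Modules C" and B: "B j \<subseteq> Ob C" and X: "X \<in> Ob C"
  shows "trace_filt C B F j X = generate (val F X) (trace_gens C (B j) F X)"
  unfolding trace_filt_def
proof (rule arg_cong[where f = "generate (val F X)"], intro equalityI subsetI)
  fix y assume "y \<in> (\<Union>E\<in>B j. \<Union>\<eta>\<in>Mod_hom C (rep C E) F. \<eta> X ` Mor C E X)"
  then obtain E \<eta> f where E: "E \<in> B j" and \<eta>: "\<eta> \<in> Mod_hom C (rep C E) F" and f: "f \<in> Mor C E X"
    and y: "y = \<eta> X f" by blast
  have E': "E \<in> Ob C" using B E by blast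
  have "\<eta> X (act (rep C E) E X f (Idm C E)) = act F E X f (\<eta> E (Idm C E))"
    using Mod_hom_natural[OF \<eta> E' X f] Idm_closed[OF E'] by simp
  then have "y = act F E X f (\<eta> E (Idm C E))"
    using y Cmp_Idm_right[OF E' X f] by simp
  moreover have "\<eta> E (Idm C E) \<in> carrier (val F E)"
    using hom_in_carrier[OF Mod_hom_hom[OF \<eta> E']] Idm_closed[OF E'] by simp
  ultimately show "y \<in> trace_gens C (B j) F X"
    using E f by (intro trace_gensI)
next
  fix y assume "y \<in> trace_gens C (B j) F X"
  then obtain E f x where E: "E \<in> B j" and f: "f \<in> Mor C E X" and x: "x \<in> carrier (val F E)"
    and y: "y = act F E X f x" by (rule trace_gensE)
  have E': "E \<in> Ob C" using B E by blast
  have "(\<lambda>Y g. act F E Y g x) \<in> Mod_hom C (rep C E) F"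
    unfolding Mod_hom_def using E' x
    by (auto simp: hom_def Modules_act_closed[OF F] Modules_act_add[OF F] Modules_act_Cmp[OF F])
  then show "y \<in> (\<Union>E\<in>B j. \<Union>\<eta>\<in>Mod_hom C (rep C E) F. \<eta> X ` Mor C E X)"
    using E f y by blast
qed

section \<open>Corners of a category\<close>

text \<open>Restriction along the functor with object part \<open>ob\<close> and morphism part
  \<open>ar\<close>. It leaves the values untouched, so it commutes with submodules and quotients on
  the nose.\<close>

definition pull_Mod :: "('p \<Rightarrow> 'o) \<Rightarrow> ('p \<Rightarrow> 'p \<Rightarrow> 'l \<Rightarrow> 'm) \<Rightarrow> ('o, 'm, 'a) cmod \<Rightarrow> ('p, 'l, 'a) cmod"
  where "pull_Mod ob ar F = \<lparr>val = (\<lambda>X. val F (ob X)), act = (\<lambda>X Y f. act F (ob X) (ob Y) (ar X Y f))\<rparr>"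

lemma pull_Mod_simps [simp]:
  "val (pull_Mod ob ar F) X = val F (ob X)"
  "act (pull_Mod ob ar F) X Y f = act F (ob X) (ob Y) (ar X Y f)"
  by (simp_all add: pull_Mod_def)

lemma pull_Mod_restrict_Mod: "pull_Mod ob ar (restrict_Mod F N) = restrict_Mod (pull_Mod ob ar F) (\<lambda>X. N (ob X))"
  by (simp add: pull_Mod_def restrict_Mod_def)

lemma pull_Mod_quot_Mod: "pull_Mod ob ar (quot_Mod F N) = quot_Mod (pull_Mod ob ar F) (\<lambda>X. N (ob X))"
  by (simp add: pull_Mod_def quot_Mod_def)

lemma product_group_cong: "(\<And>i. i \<in> I \<Longrightarrow> G i = H i) \<Longrightarrow> product_group I G = product_group I H"
  by (auto simp: product_group_def cong: restrict_cong PiE_cong)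

lemma pull_Mod_dsum_Mod: "Mod_iso C (pull_Mod ob ar (dsum_Mod Ds)) (dsum_Mod (map (pull_Mod ob ar) Ds))"
proof (rule Mod_iso_cong)
  fix X Y f x
  show "val (pull_Mod ob ar (dsum_Mod Ds)) X = val (dsum_Mod (map (pull_Mod ob ar) Ds)) X"
    unfolding dsum_Mod_def pull_Mod_simps cmod.simps length_map
    by (rule product_group_cong) simp
  show "act (pull_Mod ob ar (dsum_Mod Ds)) X Y f x = act (dsum_Mod (map (pull_Mod ob ar) Ds)) X Y f x"
    unfolding dsum_Mod_simps pull_Mod_simps length_map
    by (rule restrict_ext) simp
qed

text \<open>
  \<open>ob\<close> and \<open>ar\<close> form a full embedding of \<open>C\<close> into \<open>L\<close>, and \<open>ra\<close> inverts it on morphisms; every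
  object \<open>A\<close> of \<open>L\<close> has a retract \<open>ob (pi A)\<close> in the image, with retraction \<open>prj A\<close> and section
  \<open>inc A\<close>.
\<close>

locale corner = L: k_category K L + C: k_category K C
  for K :: "('k, 'x) ring_scheme" (structure) and L :: "('o, 'm, 'k) kcat" and C :: "('p, 'l, 'k) kcat" +
  fixes ob :: "'p \<Rightarrow> 'o" and ar :: "'p \<Rightarrow> 'p \<Rightarrow> 'l \<Rightarrow> 'm" and ra :: "'m \<Rightarrow> 'l"
    and pi :: "'o \<Rightarrow> 'p" and inc prj :: "'o \<Rightarrow> 'm"
  assumes ob_closed: "X \<in> Ob C \<Longrightarrow> ob X \<in> Ob L"
    and pi_closed: "A \<in> Ob L \<Longrightarrow> pi A \<in> Ob C"
    and pi_ob: "X \<in> Ob C \<Longrightarrow> pi (ob X) = X"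
    and ar_closed: "\<lbrakk>X \<in> Ob C; Y \<in> Ob C; f \<in> Mor C X Y\<rbrakk> \<Longrightarrow> ar X Y f \<in> Mor L (ob X) (ob Y)"
    and ra_closed: "\<lbrakk>X \<in> Ob C; Y \<in> Ob C; h \<in> Mor L (ob X) (ob Y)\<rbrakk> \<Longrightarrow> ra h \<in> Mor C X Y"
    and ra_ar: "\<lbrakk>X \<in> Ob C; Y \<in> Ob C; f \<in> Mor C X Y\<rbrakk> \<Longrightarrow> ra (ar X Y f) = f"
    and ar_ra: "\<lbrakk>X \<in> Ob C; Y \<in> Ob C; h \<in> Mor L (ob X) (ob Y)\<rbrakk> \<Longrightarrow> ar X Y (ra h) = h"
    and ar_add: "\<lbrakk>X \<in> Ob C; Y \<in> Ob C; f \<in> Mor C X Y; g \<in> Mor C X Y\<rbrakk>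
      \<Longrightarrow> ar X Y (f \<oplus>\<^bsub>Hom C X Y\<^esub> g) = ar X Y f \<oplus>\<^bsub>Hom L (ob X) (ob Y)\<^esub> ar X Y g"
    and ar_Idm: "X \<in> Ob C \<Longrightarrow> ar X X (Idm C X) = Idm L (ob X)"
    and ar_Cmp: "\<lbrakk>X \<in> Ob C; Y \<in> Ob C; Z \<in> Ob C; f \<in> Mor C X Y; g \<in> Mor C Y Z\<rbrakk>
      \<Longrightarrow> ar X Z (Cmp C X Y Z g f) = Cmp L (ob X) (ob Y) (ob Z) (ar Y Z g) (ar X Y f)"
    and inc_closed: "A \<in> Ob L \<Longrightarrow> inc A \<in> Mor L (ob (pi A)) A"
    and prj_closed: "A \<in> Ob L \<Longrightarrow> prj A \<in> Mor L A (ob (pi A))"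
    and prj_inc: "A \<in> Ob L \<Longrightarrow> Cmp L (ob (pi A)) A (ob (pi A)) (prj A) (inc A) = Idm L (ob (pi A))"
begin

abbreviation "ret A \<equiv> ob (pi A)"

abbreviation "pull \<equiv> pull_Mod ob ar"

definition corner_idem :: "'o \<Rightarrow> 'm"
  where "corner_idem A = Cmp L A (ret A) A (inc A) (prj A)"

text \<open>
  An object is cosupported if all its morphisms into the corner factor through its retract; a module is
  supported if it is determined by its restriction to the corner.
\<close>

definition cosupported :: "'o \<Rightarrow> bool"
  where "cosupported A \<longleftrightarrow> (\<forall>Y\<in>Ob C. \<forall>f\<in>Mor L A (ob Y). Cmp L A A (ob Y) f (corner_idem A) = f)"

definition supported :: "('o, 'm, 'a) cmod \<Rightarrow> bool"
  where "supported F \<longleftrightarrow> (\<forall>A\<in>Ob L. \<forall>x\<in>carrier (val F A). act F A A (corner_idem A) x = x)"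

text \<open>What makes factorizations through \<open>B'\<close> and through \<open>B\<close>
  interchangeable: \<open>ob\<close> carries \<open>B\<close> into \<open>B'\<close>,
  \<open>pi\<close> carries \<open>B'\<close> back, and cosupport moves morphisms into the corner
  from an object of \<open>B'\<close> to its retract.\<close>

definition compatible :: "'o set \<Rightarrow> 'p set \<Rightarrow> bool"
  where "compatible B' B \<longleftrightarrow> B' \<subseteq> Ob L \<and> B \<subseteq> Ob C \<and> (\<forall>X\<in>B. ob X \<in> B') \<and> (\<forall>A\<in>B'. pi A \<in> B \<and> cosupported A)"

lemma compatibleD:
  assumes "compatible B' B"
  shows "A \<in> B' \<Longrightarrow> A \<in> Ob L" "X \<in> B \<Longrightarrow> X \<in> Ob C" "X \<in> B \<Longrightarrow> ob X \<in> B'"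
    "A \<in> B' \<Longrightarrow> pi A \<in> B" "A \<in> B' \<Longrightarrow> cosupported A"
  using assms unfolding compatible_def by fast+

lemma compatible_subset:
  assumes "compatible B' B"
  shows "B' \<subseteq> Ob L" and "B \<subseteq> Ob C"
  using assms unfolding compatible_def by fast+

declare ob_closed [simp] pi_closed [simp]

lemma corner_idem_closed: "A \<in> Ob L \<Longrightarrow> corner_idem A \<in> Mor L A A"
  by (simp add: corner_idem_def L.Cmp_closed[of A "ret A"] inc_closed prj_closed)

lemma cosupported_factor:
  assumes "cosupported A" "A \<in> Ob L" "Y \<in> Ob C" "f \<in> Mor L A (ob Y)"
  shows "Cmp L A (ret A) (ob Y) (Cmp L (ret A) A (ob Y) f (inc A)) (prj A) = f"
  using assms unfolding cosupported_def corner_idem_def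
  by (simp add: L.Cmp_assoc inc_closed prj_closed)

lemma ra_add:
  assumes "X \<in> Ob C" "Y \<in> Ob C" "f \<in> Mor L (ob X) (ob Y)" "g \<in> Mor L (ob X) (ob Y)"
  shows "ra (f \<oplus>\<^bsub>Hom L (ob X) (ob Y)\<^esub> g) = ra f \<oplus>\<^bsub>Hom C X Y\<^esub> ra g"
  using ra_ar[of X Y "ra f \<oplus>\<^bsub>Hom C X Y\<^esub> ra g"] ar_add[of X Y "ra f" "ra g"] assms
  by (simp add: ra_closed ar_ra C.Hom_add_closed)

lemma ra_Cmp:
  assumes "X \<in> Ob C" "Y \<in> Ob C" "Z \<in> Ob C" "f \<in> Mor L (ob X) (ob Y)" "g \<in> Mor L (ob Y) (ob Z)"
  shows "ra (Cmp L (ob X) (ob Y) (ob Z) g f) = Cmp C X Y Z (ra g) (ra f)"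
  using ra_ar[of X Z "Cmp C X Y Z (ra g) (ra f)"] ar_Cmp[of X Y Z "ra f" "ra g"] assms
  by (simp add: ra_closed ar_ra C.Cmp_closed[of X Y])

lemma ra_Idm: "X \<in> Ob C \<Longrightarrow> ra (Idm L (ob X)) = Idm C X"
  using ra_ar[of X X "Idm C X"] by (simp add: ar_Idm C.Idm_closed)

lemma ar_zero: "X \<in> Ob C \<Longrightarrow> Y \<in> Ob C \<Longrightarrow> ar X Y \<zero>\<^bsub>Hom C X Y\<^esub> = \<zero>\<^bsub>Hom L (ob X) (ob Y)\<^esub>"
  using ar_add[of X Y "\<zero>\<^bsub>Hom C X Y\<^esub>" "\<zero>\<^bsub>Hom C X Y\<^esub>"]
  by (intro L.Hom_idempotent_zero) (simp_all add: ar_closed C.Hom_zero_closed C.Hom_l_zero)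

lemma ra_zero: "X \<in> Ob C \<Longrightarrow> Y \<in> Ob C \<Longrightarrow> ra \<zero>\<^bsub>Hom L (ob X) (ob Y)\<^esub> = \<zero>\<^bsub>Hom C X Y\<^esub>"
  using ra_ar[of X Y "\<zero>\<^bsub>Hom C X Y\<^esub>"] by (simp add: ar_zero C.Hom_zero_closed)

lemma zero_object_ob: "X \<in> Ob C \<Longrightarrow> zero_object L (ob X) \<longleftrightarrow> zero_object C X"
  using ra_zero[of X X] ra_Idm[of X] ar_zero[of X X] ar_Idm[of X]
  unfolding L.zero_object_iff C.zero_object_iff by (auto simp: ob_closed)

section \<open>Restriction of modules to a corner\<close>

lemma pull_Modules:
  assumes F: "F \<in> Modules L"
  shows "pull F \<in> Modules C"
  unfolding Modules_def
  by (auto simp: Modules_comm_group[OF F] Modules_act_hom[OF F] ar_closed ar_Idm Modules_act_Idm[OF F]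
      ar_Cmp Modules_act_Cmp[OF F] ar_add Modules_act_add[OF F])

lemma Mod_iso_pull:
  assumes "Mod_iso L F G"
  shows "Mod_iso C (pull F) (pull G)"
proof -
  from assms obtain \<alpha> where "natural_iso L F G \<alpha>"
    by (rule Mod_isoE)
  note \<alpha> = natural_isoD[OF this]
  show ?thesis
    by (rule Mod_isoI[where \<eta> = "\<lambda>X. \<alpha> (ob X)"]) (simp_all add: \<alpha> ar_closed)
qed

lemma submodule_pull:
  "submodule L N F \<Longrightarrow> submodule C (\<lambda>X. N (ob X)) (pull F)"
  by (auto simp: submodule_def ar_closed)

lemma supported_act:
  assumes F: "F \<in> Modules L" and s: "supported F" and A: "A \<in> Ob L" and x: "x \<in> carrier (val F A)"
  shows "act F (ret A) A (inc A) (act F A (ret A) (prj A) x) = x"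
proof -
  have "act F A A (corner_idem A) x = x" using s A x unfolding supported_def by blast
  then show ?thesis
    unfolding corner_idem_def using A x by (simp add: Modules_act_Cmp[OF F] inc_closed prj_closed)
qed

lemma prj_inc_act:
  assumes F: "F \<in> Modules L" and A: "A \<in> Ob L" and x: "x \<in> carrier (val F (ret A))"
  shows "act F A (ret A) (prj A) (act F (ret A) A (inc A) x) = x"
  using Modules_act_Cmp[OF F _ _ _ inc_closed[OF A] prj_closed[OF A] x] A x
  by (simp add: prj_inc Modules_act_Idm[OF F])

text \<open>The actions of \<open>prj A\<close> and \<open>inc A\<close> are mutually inverse: one
  composite is the action of the idempotent, trivial by support, and the other is that of an
  identity.\<close>

lemma supported_isos:
  assumes F: "F \<in> Modules L" and s: "supported F" and A: "A \<in> Ob L"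
  shows "act F A (ret A) (prj A) \<in> iso (val F A) (val F (ret A))"
    and "act F (ret A) A (inc A) \<in> iso (val F (ret A)) (val F A)"
proof -
  have P: "ret A \<in> Ob L" using A by simp
  note cl = Modules_act_closed[OF F A P prj_closed[OF A]] Modules_act_closed[OF F P A inc_closed[OF A]]
  note act = supported_act[OF F s A] prj_inc_act[OF F A]
  have "bij_betw (act F A (ret A) (prj A)) (carrier (val F A)) (carrier (val F (ret A)))"
    by (rule bij_betw_byWitness[where f' = "act F (ret A) A (inc A)"]) (use cl act in auto)
  then show "act F A (ret A) (prj A) \<in> iso (val F A) (val F (ret A))"
    using Modules_act_hom[OF F A P prj_closed[OF A]] by (simp add: iso_def)
  have "bij_betw (act F (ret A) A (inc A)) (carrier (val F (ret A))) (carrier (val F A))"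
    by (rule bij_betw_byWitness[where f' = "act F A (ret A) (prj A)"]) (use cl act in auto)
  then show "act F (ret A) A (inc A) \<in> iso (val F (ret A)) (val F A)"
    using Modules_act_hom[OF F P A inc_closed[OF A]] by (simp add: iso_def)
qed

text \<open>The counterpart of the element ehe of a corner ring eRe, read as a morphism of
  \<open>C\<close>.\<close>

definition compress :: "'o \<Rightarrow> 'o \<Rightarrow> 'm \<Rightarrow> 'l"
  where "compress A A' h = ra (Cmp L (ret A) A (ret A') (Cmp L A A' (ret A') (prj A') h) (inc A))"

text \<open>Naturality of the projection to the retract. Either alternative in \<open>sup\<close>
  allows the idempotent to be inserted between the morphism and \<open>x\<close>: cosupport absorbs
  it into the morphism, and otherwise it fixes \<open>x\<close>. Both alternatives occur when
  submodules are glued, the first over \<open>T\<close> and the second over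
  \<open>U\<close>.\<close>

lemma prj_act_supported:
  assumes F: "F \<in> Modules L" and A: "A \<in> Ob L" "A' \<in> Ob L" and h: "h \<in> Mor L A A'" and x: "x \<in> carrier (val F A)"
    and sup: "cosupported A \<or> act F A A (corner_idem A) x = x"
  shows "act F A' (ret A') (prj A') (act F A A' h x)
      = act (pull F) (pi A) (pi A') (compress A A' h) (act F A (ret A) (prj A) x)"
    and "compress A A' h \<in> Mor C (pi A) (pi A')"
proof -
  let ?P = "ret A" and ?P' = "ret A'"
  have P: "?P \<in> Ob L" "?P' \<in> Ob L" "pi A \<in> Ob C" "pi A' \<in> Ob C" using A by simp_all
  note inc = inc_closed[OF A(1)] and prj = prj_closed[OF A(1)] and e = corner_idem_closed[OF A(1)]
  let ?f = "Cmp L A A' ?P' (prj A') h"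
  have f: "?f \<in> Mor L A ?P'" by (rule L.Cmp_closed[OF A P(2) h prj_closed[OF A(2)]])
  let ?g = "Cmp L ?P A ?P' ?f (inc A)"
  have g: "?g \<in> Mor L ?P ?P'" by (rule L.Cmp_closed[OF P(1) A(1) P(2) inc f])
  have "act F A ?P' ?f x = act F A ?P' ?f (act F A A (corner_idem A) x)"
    using sup
  proof
    assume "cosupported A"
    then have "Cmp L A A ?P' ?f (corner_idem A) = ?f" using f P(4) unfolding cosupported_def by blast
    then show ?thesis using Modules_act_Cmp[OF F A(1,1) P(2) e f x] by simp
  qed simp
  also have "\<dots> = act F ?P ?P' ?g (act F A ?P (prj A) x)"
    unfolding corner_idem_def Modules_act_Cmp[OF F A(1) P(1) A(1) prj inc x]
      Modules_act_Cmp[OF F P(1) A(1) P(2) inc f Modules_act_closed[OF F A(1) P(1) prj x]] ..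
  finally show "act F A' ?P' (prj A') (act F A A' h x) = act (pull F) (pi A) (pi A') (compress A A' h) (act F A ?P (prj A) x)"
    unfolding Modules_act_Cmp[OF F A P(2) h prj_closed[OF A(2)] x] pull_Mod_simps compress_def ar_ra[OF P(3,4) g] .
  show "compress A A' h \<in> Mor C (pi A) (pi A')"
    unfolding compress_def by (rule ra_closed[OF P(3,4) g])
qed

text \<open>The value of a supported module at \<open>A\<close> is recovered from the retract by
  \<open>supported_isos\<close>, and an arbitrary morphism acts through its compression, where
  \<theta> is natural.\<close>

lemma Mod_iso_supported:
  assumes F: "F \<in> Modules L" "supported F" and G: "G \<in> Modules L" "supported G"
    and "Mod_iso C (pull F) (pull G)"
  shows "Mod_iso L F G"
proof -
  from assms(5) obtain \<theta> where "natural_iso C (pull F) (pull G) \<theta>"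
    by (rule Mod_isoE)
  note \<theta> = natural_isoD[OF this]
  \<comment> \<open>Project to the retract, apply \<theta> there, and include again.\<close>
  let ?\<eta> = "\<lambda>A. act G (ret A) A (inc A) \<circ> (\<theta> (pi A) \<circ> act F A (ret A) (prj A))"
  show ?thesis
  proof (rule Mod_isoI[where \<eta> = ?\<eta>])
    fix A assume A: "A \<in> Ob L"
    have "\<theta> (pi A) \<in> iso (val F (ret A)) (val G (ret A))" using \<theta>(1)[of "pi A"] A by simp
    then show "?\<eta> A \<in> iso (val F A) (val G A)"
      using iso_set_trans[OF iso_set_trans[OF supported_isos(1)[OF F A]] supported_isos(2)[OF G A]]
      by (simp add: o_assoc)
  next
    fix A A' h x assume A: "A \<in> Ob L" "A' \<in> Ob L" and h: "h \<in> Mor L A A'" and x: "x \<in> carrier (val F A)"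
    have P: "ret A \<in> Ob L" using A by simp
    let ?y = "act F A (ret A) (prj A) x"
    let ?z = "act G (ret A) A (inc A) (\<theta> (pi A) ?y)"
    have y: "?y \<in> carrier (val F (ret A))" using Modules_act_closed[OF F(1) A(1) P prj_closed[OF A(1)] x] .
    have \<theta>y: "\<theta> (pi A) ?y \<in> carrier (val G (ret A))"
      using iso_closed[OF \<theta>(1)[of "pi A"]] y A by simp
    have z: "?z \<in> carrier (val G A)" by (rule Modules_act_closed[OF G(1) P A(1) inc_closed[OF A(1)] \<theta>y])
    have sup: "act F A A (corner_idem A) x = x" "act G A A (corner_idem A) ?z = ?z"
      using F(2) G(2) A(1) x z unfolding supported_def by blast+
    have "\<theta> (pi A') (act F A' (ret A') (prj A') (act F A A' h x))
      = act (pull G) (pi A) (pi A') (compress A A' h) (\<theta> (pi A) ?y)"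
      using \<theta>(2)[of "pi A" "pi A'", OF _ _ prj_act_supported(2)[OF F(1) A h x disjI2[OF sup(1)]], of ?y] y A
      unfolding prj_act_supported(1)[OF F(1) A h x disjI2[OF sup(1)]] by simp
    also have "\<dots> = act G A' (ret A') (prj A') (act G A A' h ?z)"
      using prj_act_supported(1)[OF G(1) A h z disjI2[OF sup(2)]] prj_inc_act[OF G(1) A(1) \<theta>y] by simp
    finally show "?\<eta> A' (act F A A' h x) = act G A A' h (?\<eta> A x)"
      using supported_act[OF G A(2)] Modules_act_closed[OF G(1) A h z] by simp
  qed
qed

text \<open>Precomposition with \<open>inc A\<close> is inverted by precomposition with
  \<open>prj A\<close>: one round trip is the identity by cosupport, the other by
  \<open>prj_inc\<close>.\<close>

lemma cosupported_rep:
  assumes A: "A \<in> Ob L" and co: "cosupported A"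
  shows "natural_iso C (pull (rep L A)) (rep C (pi A)) (\<lambda>Y f. ra (Cmp L (ret A) A (ob Y) f (inc A)))"
proof (rule natural_isoI)
  let ?P = "ret A"
  have P: "?P \<in> Ob L" "pi A \<in> Ob C" using A by simp_all
  note inc = inc_closed[OF A] and prj = prj_closed[OF A]
  have cl: "Cmp L ?P A (ob Y) f (inc A) \<in> Mor L ?P (ob Y)" if "Y \<in> Ob C" "f \<in> Mor L A (ob Y)" for Y f
    using L.Cmp_closed[OF P(1) A ob_closed[OF that(1)] inc that(2)] .
  show "(\<lambda>f. ra (Cmp L ?P A (ob Y) f (inc A))) \<in> iso (val (pull (rep L A)) Y) (val (rep C (pi A)) Y)"
    if Y: "Y \<in> Ob C" for Y
  proof -
    let ?\<phi> = "\<lambda>f. ra (Cmp L ?P A (ob Y) f (inc A))" and ?\<psi> = "\<lambda>f. Cmp L A ?P (ob Y) (ar (pi A) Y f) (prj A)"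
    have "?\<phi> \<in> hom (val (pull (rep L A)) Y) (val (rep C (pi A)) Y)"
      using Y P A inc cl[OF Y] ra_closed[OF P(2) Y cl[OF Y]]
      by (intro homI) (simp_all add: L.Cmp_add_left ra_add)
    moreover have "bij_betw ?\<phi> (Mor L A (ob Y)) (Mor C (pi A) Y)"
    proof (rule bij_betw_byWitness[where f' = ?\<psi>])
      show "\<forall>f\<in>Mor L A (ob Y). ?\<psi> (?\<phi> f) = f"
        using ar_ra[OF P(2) Y cl[OF Y]] cosupported_factor[OF co A Y] by simp
      show "\<forall>f\<in>Mor C (pi A) Y. ?\<phi> (?\<psi> f) = f"
        using Y P A inc prj ar_closed[OF P(2) Y] ra_ar[OF P(2) Y]
        by (simp add: L.Cmp_assoc[symmetric] prj_inc L.Cmp_Idm_right)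
      show "?\<phi> ` Mor L A (ob Y) \<subseteq> Mor C (pi A) Y"
        using ra_closed[OF P(2) Y cl[OF Y]] by auto
      show "?\<psi> ` Mor C (pi A) Y \<subseteq> Mor L A (ob Y)"
        using L.Cmp_closed[OF A P(1) ob_closed[OF Y] prj ar_closed[OF P(2) Y]] by auto
    qed
    ultimately show ?thesis by (simp add: iso_def)
  qed
  show "ra (Cmp L ?P A (ob Y) (act (pull (rep L A)) X Y g f) (inc A))
      = act (rep C (pi A)) X Y g (ra (Cmp L ?P A (ob X) f (inc A)))"
    if XY: "X \<in> Ob C" "Y \<in> Ob C" and g: "g \<in> Mor C X Y" and f: "f \<in> carrier (val (pull (rep L A)) X)" for X Y g f
  proof -
    have f: "f \<in> Mor L A (ob X)" using f by simp
    have "Cmp L ?P A (ob Y) (Cmp L A (ob X) (ob Y) (ar X Y g) f) (inc A)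
        = Cmp L ?P (ob X) (ob Y) (ar X Y g) (Cmp L ?P A (ob X) f (inc A))"
      using L.Cmp_assoc[OF P(1) A ob_closed[OF XY(1)] ob_closed[OF XY(2)] inc f ar_closed[OF XY g]] by simp
    then show ?thesis
      using ra_Cmp[OF P(2) XY cl[OF XY(1) f] ar_closed[OF XY g]] ra_ar[OF XY g] by simp
  qed
qed

text \<open>A factorization through \<open>E\<close> of a morphism into the corner is rerouted
  through the retract of \<open>E\<close>, which is possible because \<open>E\<close> is
  cosupported. Conversely \<open>ob\<close> turns a factorization through \<open>B\<close> into one
  through \<open>B'\<close>, preceded by \<open>prj A\<close>.\<close>

lemma ideal_through_image:
  assumes A: "A \<in> Ob L" and comp: "compatible B' B" and Y: "Y \<in> Ob C"
  shows "(\<lambda>f. ra (Cmp L (ret A) A (ob Y) f (inc A))) ` ideal_through L B' A (ob Y)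
    = ideal_through C B (pi A) Y" (is "?\<phi> ` _ = _")
proof (intro equalityI subsetI)
  let ?P = "ret A"
  have P: "?P \<in> Ob L" "pi A \<in> Ob C" using A by simp_all
  note inc = inc_closed[OF A] and prj = prj_closed[OF A]
  fix h assume "h \<in> ?\<phi> ` ideal_through L B' A (ob Y)"
  then obtain h' where h': "h' \<in> ideal_through L B' A (ob Y)" "h = ?\<phi> h'" by (elim imageE)
  from h'(1) obtain E f g where E: "E \<in> B'" "f \<in> Mor L A E" "g \<in> Mor L E (ob Y)" "h' = Cmp L A E (ob Y) g f"
    by (rule ideal_throughE)
  let ?Q = "ret E"
  have Q: "E \<in> Ob L" "pi E \<in> Ob C" "?Q \<in> Ob L" "pi E \<in> B" "cosupported E"
    using compatibleD[OF comp] E(1) by simp_all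
  let ?g = "Cmp L ?Q E (ob Y) g (inc E)" and ?k = "Cmp L ?P A E f (inc A)"
  let ?f = "Cmp L ?P E ?Q (prj E) ?k"
  have g: "?g \<in> Mor L ?Q (ob Y)" by (rule L.Cmp_closed[OF Q(3,1) ob_closed[OF Y] inc_closed[OF Q(1)] E(3)])
  have k: "?k \<in> Mor L ?P E" by (rule L.Cmp_closed[OF P(1) A Q(1) inc E(2)])
  have f: "?f \<in> Mor L ?P ?Q" by (rule L.Cmp_closed[OF P(1) Q(1) Q(3) k prj_closed[OF Q(1)]])
  have "Cmp L ?P ?Q (ob Y) ?g ?f = Cmp L ?P E (ob Y) (Cmp L E ?Q (ob Y) ?g (prj E)) ?k"
    by (rule L.Cmp_assoc[OF P(1) Q(1,3) ob_closed[OF Y] k prj_closed[OF Q(1)] g])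
  also have "\<dots> = Cmp L ?P E (ob Y) g ?k"
    by (simp only: cosupported_factor[OF Q(5,1) Y E(3)])
  also have "\<dots> = Cmp L ?P A (ob Y) h' (inc A)"
    unfolding E(4) by (rule L.Cmp_assoc[OF P(1) A Q(1) ob_closed[OF Y] inc E(2,3)])
  finally have "h = Cmp C (pi A) (pi E) Y (ra ?g) (ra ?f)"
    unfolding h'(2) using ra_Cmp[OF P(2) Q(2) Y f g] by simp
  then show "h \<in> ideal_through C B (pi A) Y"
    using ideal_throughI[OF Q(4) ra_closed[OF P(2) Q(2) f] ra_closed[OF Q(2) Y g]] by simp
next
  let ?P = "ret A"
  have P: "?P \<in> Ob L" "pi A \<in> Ob C" using A by simp_all
  note inc = inc_closed[OF A] and prj = prj_closed[OF A]
  fix h assume "h \<in> ideal_through C B (pi A) Y"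
  then obtain X f g where E: "X \<in> B" "f \<in> Mor C (pi A) X" "g \<in> Mor C X Y" "h = Cmp C (pi A) X Y g f"
    by (rule ideal_throughE)
  have X: "X \<in> Ob C" "ob X \<in> Ob L" "ob X \<in> B'" using compatibleD[OF comp] E(1) by simp_all
  let ?f = "Cmp L A ?P (ob X) (ar (pi A) X f) (prj A)"
  have f: "?f \<in> Mor L A (ob X)" by (rule L.Cmp_closed[OF A P(1) X(2) prj ar_closed[OF P(2) X(1) E(2)]])
  have "Cmp L A (ob X) (ob Y) (ar X Y g) ?f \<in> ideal_through L B' A (ob Y)"
    by (rule ideal_throughI[OF X(3) f ar_closed[OF X(1) Y E(3)] refl])
  moreover have "Cmp L ?P A (ob Y) (Cmp L A (ob X) (ob Y) (ar X Y g) ?f) (inc A)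
      = Cmp L ?P (ob X) (ob Y) (ar X Y g) (ar (pi A) X f)"
    using L.Cmp_assoc[OF P(1) A X(2) ob_closed[OF Y] inc f ar_closed[OF X(1) Y E(3)]]
      L.Cmp_assoc[OF P(1) A P(1) X(2) inc prj ar_closed[OF P(2) X(1) E(2)]]
      L.Cmp_Idm_right[OF P(1) X(2) ar_closed[OF P(2) X(1) E(2)]]
    by (simp add: prj_inc[OF A])
  then have "h = ?\<phi> (Cmp L A (ob X) (ob Y) (ar X Y g) ?f)"
    using ra_Cmp[OF P(2) X(1) Y ar_closed[OF P(2) X(1) E(2)] ar_closed[OF X(1) Y E(3)]]
      ra_ar[OF P(2) X(1) E(2)] ra_ar[OF X(1) Y E(3)] E(4) by simp
  ultimately show "h \<in> ?\<phi> ` ideal_through L B' A (ob Y)" by (rule rev_image_eqI)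
qed

lemma pull_standard:
  assumes A: "A \<in> Ob L" and co: "cosupported A" and comp: "compatible B' B"
  shows "Mod_iso C (pull (quot_Mod (rep L A) (ideal_through L B' A)))
    (quot_Mod (rep C (pi A)) (ideal_through C B (pi A)))"
  unfolding pull_Mod_quot_Mod
proof (rule Mod_iso_quot_Mod[where \<eta> = "\<lambda>Y f. ra (Cmp L (ret A) A (ob Y) f (inc A))"])
  show "ideal_through L B' A (ob X) \<subseteq> carrier (val (pull (rep L A)) X)" if "X \<in> Ob C" for X
    using that A compatibleD(1)[OF comp] by (auto elim!: ideal_throughE simp: L.Cmp_closed)
qed (use pull_Modules[OF L.rep_Modules[OF A]] cosupported_rep[OF A co] ideal_through_image[OF A comp] in simp_all)

text \<open>The same rerouting, applied to generators: the action of \<open>f\<close> on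
  \<open>x\<close> becomes that of a morphism of \<open>C\<close> on the projection of
  \<open>x\<close> to the retract of \<open>E\<close>.\<close>

lemma trace_filt_pull:
  assumes F: "F \<in> Modules L" and comp: "compatible (B' i) (B j)" and X: "X \<in> Ob C"
  shows "trace_filt L B' F i (ob X) = trace_filt C B (pull F) j X"
proof -
  have B: "B' i \<subseteq> Ob L" "B j \<subseteq> Ob C" by (rule compatible_subset[OF comp])+
  note X' = ob_closed[OF X]
  show ?thesis
    unfolding L.trace_filt_eq[where B = B', OF F B(1) X'] C.trace_filt_eq[where B = B, OF pull_Modules[OF F] B(2) X]
      pull_Mod_simps(1)
  proof (rule arg_cong[where f = "generate (val F (ob X))"], intro equalityI subsetI)
    fix y assume "y \<in> trace_gens L (B' i) F (ob X)"
    then obtain E f x where E: "E \<in> B' i" and f: "f \<in> Mor L E (ob X)" and x: "x \<in> carrier (val F E)"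
      and y: "y = act F E (ob X) f x" by (rule trace_gensE)
    have Q: "E \<in> Ob L" "pi E \<in> Ob C" "ret E \<in> Ob L" "pi E \<in> B j" "cosupported E"
      using compatibleD[OF comp] E by simp_all
    let ?f = "Cmp L (ret E) E (ob X) f (inc E)" and ?x = "act F E (ret E) (prj E) x"
    have f': "?f \<in> Mor L (ret E) (ob X)" by (rule L.Cmp_closed[OF Q(3,1) X' inc_closed[OF Q(1)] f])
    have "y = act F (ret E) (ob X) ?f ?x"
      using Modules_act_Cmp[OF F Q(1,3) X' prj_closed[OF Q(1)] f' x] y
      by (simp add: cosupported_factor[OF Q(5,1) X f])
    then have "y = act (pull F) (pi E) X (ra ?f) ?x"
      using ar_ra[OF Q(2) X f'] by simp
    moreover have "ra ?f \<in> Mor C (pi E) X" by (rule ra_closed[OF Q(2) X f'])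
    moreover have "?x \<in> carrier (val (pull F) (pi E))"
      using Modules_act_closed[OF F Q(1,3) prj_closed[OF Q(1)] x] by simp
    ultimately show "y \<in> trace_gens C (B j) (pull F) X"
      by (intro trace_gensI[OF Q(4)])
  next
    fix y assume "y \<in> trace_gens C (B j) (pull F) X"
    then obtain E f x where E: "E \<in> B j" and f: "f \<in> Mor C E X" and x: "x \<in> carrier (val (pull F) E)"
      and y: "y = act (pull F) E X f x" by (rule trace_gensE)
    show "y \<in> trace_gens L (B' i) F (ob X)"
    proof (rule trace_gensI)
      show "y = act F (ob E) (ob X) (ar E X f) x" using y by simp
    qed (use compatibleD[OF comp] E f x X in \<open>simp_all add: ar_closed\<close>)
  qed
qed

section \<open>Decompositions and indecomposable objects in a corner\<close>

lemma direct_sum_ob: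
  assumes A: "A \<in> Ob L" and idem: "corner_idem A = Idm L A" and ds: "direct_sum C [Y, Z] (pi A)"
  shows "direct_sum L [ob Y, ob Z] A"
proof -
  let ?P = "ret A"
  have P: "?P \<in> Ob L" "pi A \<in> Ob C" using A by simp_all
  note inc = inc_closed[OF A] and prj = prj_closed[OF A]
  from ds obtain i p j q where "biproduct C Y Z (pi A) i p j q"
    by (rule C.direct_sum_pairE)
  note bi = biproductD[OF this]
  note YZ = bi(1,2) and mor = bi(4-7) and eq = bi(8-11) and sum = bi(12)
  \<comment> \<open>\<open>up\<close> and \<open>dn\<close> transport the structure maps along the
    isomorphism between \<open>A\<close> and its retract that \<open>idem\<close> provides.\<close>
  define up where "up Y f = Cmp L (ob Y) ?P A (inc A) (ar Y (pi A) f)" for Y f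
  define dn where "dn Y f = Cmp L A ?P (ob Y) (ar (pi A) Y f) (prj A)" for Y f
  have up: "up Y f \<in> Mor L (ob Y) A" if "Y \<in> Ob C" "f \<in> Mor C Y (pi A)" for Y f
    unfolding up_def using L.Cmp_closed[OF ob_closed[OF that(1)] P(1) A ar_closed[OF that(1) P(2) that(2)] inc] .
  have dn: "dn Y f \<in> Mor L A (ob Y)" if "Y \<in> Ob C" "f \<in> Mor C (pi A) Y" for Y f
    unfolding dn_def using L.Cmp_closed[OF A P(1) ob_closed[OF that(1)] prj ar_closed[OF P(2) that(1) that(2)]] .
  have dn_up: "Cmp L (ob Y) A (ob Z) (dn Z g) (up Y f) = ar Y Z (Cmp C Y (pi A) Z g f)"
    if "Y \<in> Ob C" "Z \<in> Ob C" "f \<in> Mor C Y (pi A)" "g \<in> Mor C (pi A) Z" for Y Z f g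
  proof -
    have f: "ar Y (pi A) f \<in> Mor L (ob Y) ?P" and g: "ar (pi A) Z g \<in> Mor L ?P (ob Z)"
      using that P ar_closed by simp_all
    have "Cmp L (ob Y) A (ob Z) (dn Z g) (up Y f)
      = Cmp L (ob Y) ?P (ob Z) (ar (pi A) Z g) (Cmp L (ob Y) A ?P (prj A) (up Y f))"
      unfolding dn_def
      by (rule L.Cmp_assoc[symmetric]) (use that A P up g prj in simp_all)
    also have "Cmp L (ob Y) A ?P (prj A) (up Y f) = Cmp L (ob Y) ?P ?P (Cmp L ?P A ?P (prj A) (inc A)) (ar Y (pi A) f)"
      unfolding up_def by (rule L.Cmp_assoc) (use that A P f prj inc in simp_all)
    also have "\<dots> = ar Y (pi A) f"
      unfolding prj_inc[OF A] by (rule L.Cmp_Idm_left) (use that P f in simp_all)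
    finally show ?thesis using ar_Cmp[OF that(1) P(2) that(2,3,4)] by simp
  qed
  have up_dn: "Cmp L A (ob Y) A (up Y f) (dn Y g)
      = Cmp L A ?P A (inc A) (Cmp L A ?P ?P (ar (pi A) (pi A) (Cmp C (pi A) Y (pi A) f g)) (prj A))"
    if "Y \<in> Ob C" "f \<in> Mor C Y (pi A)" "g \<in> Mor C (pi A) Y" for Y f g
  proof -
    have f: "ar Y (pi A) f \<in> Mor L (ob Y) ?P" and g: "ar (pi A) Y g \<in> Mor L ?P (ob Y)"
      using that P ar_closed by simp_all
    have "Cmp L A (ob Y) A (up Y f) (dn Y g)
      = Cmp L A ?P A (inc A) (Cmp L A (ob Y) ?P (ar Y (pi A) f) (dn Y g))"
      unfolding up_def by (rule L.Cmp_assoc[symmetric]) (use that A P dn f inc in simp_all)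
    also have "Cmp L A (ob Y) ?P (ar Y (pi A) f) (dn Y g)
      = Cmp L A ?P ?P (Cmp L ?P (ob Y) ?P (ar Y (pi A) f) (ar (pi A) Y g)) (prj A)"
      unfolding dn_def by (rule L.Cmp_assoc) (use that A P f g prj in simp_all)
    finally show ?thesis using ar_Cmp[OF P(2) that(1) P(2) that(3,2)] by simp
  qed
  have ip: "Cmp C (pi A) Y (pi A) i p \<in> Mor C (pi A) (pi A)" "Cmp C (pi A) Z (pi A) j q \<in> Mor C (pi A) (pi A)"
    using C.Cmp_closed[OF P(2) YZ(1) P(2) mor(2,1)] C.Cmp_closed[OF P(2) YZ(2) P(2) mor(4,3)] by simp_all
  have c: "Cmp L A ?P ?P (ar (pi A) (pi A) h) (prj A) \<in> Mor L A ?P" if "h \<in> Mor C (pi A) (pi A)" for h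
    by (rule L.Cmp_closed[OF A P(1,1) prj ar_closed[OF P(2,2) that]])
  have "Cmp L A (ob Y) A (up Y i) (dn Y p) \<oplus>\<^bsub>Hom L A A\<^esub> Cmp L A (ob Z) A (up Z j) (dn Z q)
     = Cmp L A ?P A (inc A) (Cmp L A ?P ?P (ar (pi A) (pi A)
        (Cmp C (pi A) Y (pi A) i p \<oplus>\<^bsub>Hom C (pi A) (pi A)\<^esub> Cmp C (pi A) Z (pi A) j q)) (prj A))"
    unfolding up_dn[OF YZ(1) mor(1,2)] up_dn[OF YZ(2) mor(3,4)] ar_add[OF P(2,2) ip]
      L.Cmp_add_left[OF A P(1,1) prj ar_closed[OF P(2,2) ip(1)] ar_closed[OF P(2,2) ip(2)]]
      L.Cmp_add_right[OF A P(1) A c[OF ip(1)] c[OF ip(2)] inc] ..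
  also have "\<dots> = Idm L A"
    unfolding sum ar_Idm[OF P(2)] L.Cmp_Idm_left[OF A P(1) prj] idem[symmetric] corner_idem_def ..
  finally have sum': "Cmp L A (ob Y) A (up Y i) (dn Y p) \<oplus>\<^bsub>Hom L A A\<^esub> Cmp L A (ob Z) A (up Z j) (dn Z q) = Idm L A" .
  show ?thesis
    by (rule L.direct_sum_pairI[OF ob_closed[OF YZ(1)] ob_closed[OF YZ(2)] A
        up[OF YZ(1) mor(1)] dn[OF YZ(1) mor(2)] up[OF YZ(2) mor(3)] dn[OF YZ(2) mor(4)]])
      (simp_all add: dn_up YZ mor eq ar_Idm ar_zero sum')
qed

text \<open>A cosupported summand of an object in the corner is isomorphic to its own retract: the
  injection into \<open>ob X\<close> absorbs the idempotent, and composing with the projection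
  cancels the injection. The structure maps can then be moved to the retracts without loss.\<close>

lemma direct_sum_pi:
  assumes X: "X \<in> Ob C" and co: "cosupported A" "cosupported B" and ds: "direct_sum L [A, B] (ob X)"
  shows "direct_sum C [pi A, pi B] X" and "corner_idem A = Idm L A" and "corner_idem B = Idm L B"
proof -
  from ds obtain i p j q where "biproduct L A B (ob X) i p j q"
    by (rule L.direct_sum_pairE)
  note bi = biproductD[OF this]
  note AB = bi(1,2) and mor = bi(4-7) and eq = bi(8-11) and sum = bi(12)
  note oX = ob_closed[OF X]
  have idem: "corner_idem A = Idm L A" if A: "A \<in> Ob L" "cosupported A" and i: "i \<in> Mor L A (ob X)"
    and p: "p \<in> Mor L (ob X) A" and eq: "Cmp L A (ob X) A p i = Idm L A" for A i p
  proof -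
    have "Idm L A = Cmp L A (ob X) A p (Cmp L A A (ob X) i (corner_idem A))"
      using A(2) i X unfolding eq[symmetric] cosupported_def by simp
    also have "\<dots> = Cmp L A A A (Cmp L A (ob X) A p i) (corner_idem A)"
      by (rule L.Cmp_assoc[OF A(1,1) oX A(1) corner_idem_closed[OF A(1)] i p])
    also have "\<dots> = corner_idem A"
      unfolding eq by (rule L.Cmp_Idm_left[OF A(1,1) corner_idem_closed[OF A(1)]])
    finally show ?thesis by (rule sym)
  qed
  show "corner_idem A = Idm L A" by (rule idem[OF AB(1) co(1) mor(1,2) eq(1)])
  show "corner_idem B = Idm L B" by (rule idem[OF AB(2) co(2) mor(3,4) eq(2)])
  define up where "up A i = Cmp L (ret A) A (ob X) i (inc A)" for A i
  define dn where "dn A p = Cmp L (ob X) A (ret A) (prj A) p" for A p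
  have up: "up A i \<in> Mor L (ret A) (ob X)" if "A \<in> Ob L" "i \<in> Mor L A (ob X)" for A i
    unfolding up_def by (rule L.Cmp_closed[OF _ that(1) oX inc_closed[OF that(1)] that(2)]) (use that in simp)
  have dn: "dn A p \<in> Mor L (ob X) (ret A)" if "A \<in> Ob L" "p \<in> Mor L (ob X) A" for A p
    unfolding dn_def by (rule L.Cmp_closed[OF oX that(1) _ that(2) prj_closed[OF that(1)]]) (use that in simp)
  have up_dn: "Cmp L (ob X) (ret A) (ob X) (up A i) (dn A p) = Cmp L (ob X) A (ob X) i p"
    if A: "A \<in> Ob L" "cosupported A" "i \<in> Mor L A (ob X)" "p \<in> Mor L (ob X) A" for A i p
  proof -
    have "Cmp L (ob X) (ret A) (ob X) (up A i) (dn A p)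
      = Cmp L (ob X) A (ob X) (Cmp L A (ret A) (ob X) (up A i) (prj A)) p"
      unfolding dn_def by (rule L.Cmp_assoc) (use A oX prj_closed up in simp_all)
    then show ?thesis
      unfolding up_def cosupported_factor[OF A(2,1) X A(3)] .
  qed
  have dn_up: "Cmp L (ret A) (ob X) (ret B) (dn B q) (up A i)
      = Cmp L (ret A) B (ret B) (prj B) (Cmp L (ret A) A B (Cmp L A (ob X) B q i) (inc A))"
    if A: "A \<in> Ob L" "i \<in> Mor L A (ob X)" and B: "B \<in> Ob L" "q \<in> Mor L (ob X) B" for A B i q
  proof -
    have "Cmp L (ret A) (ob X) (ret B) (dn B q) (up A i)
      = Cmp L (ret A) B (ret B) (prj B) (Cmp L (ret A) (ob X) B q (up A i))"
      unfolding dn_def by (rule L.Cmp_assoc[symmetric]) (use A B oX prj_closed up in simp_all)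
    also have "Cmp L (ret A) (ob X) B q (up A i) = Cmp L (ret A) A B (Cmp L A (ob X) B q i) (inc A)"
      unfolding up_def by (rule L.Cmp_assoc) (use A B oX inc_closed in simp_all)
    finally show ?thesis .
  qed
  have dn_up_id: "Cmp L (ret A) (ob X) (ret A) (dn A p) (up A i) = Idm L (ret A)"
    if A: "A \<in> Ob L" "i \<in> Mor L A (ob X)" "p \<in> Mor L (ob X) A" "Cmp L A (ob X) A p i = Idm L A" for A i p
    unfolding dn_up[OF A(1,2) A(1,3)] A(4) using A(1) by (simp add: L.Cmp_Idm_left inc_closed prj_inc)
  have dn_up_zero: "Cmp L (ret A) (ob X) (ret B) (dn B q) (up A i) = \<zero>\<^bsub>Hom L (ret A) (ret B)\<^esub>"
    if A: "A \<in> Ob L" "i \<in> Mor L A (ob X)" and B: "B \<in> Ob L" "q \<in> Mor L (ob X) B"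
      and "Cmp L A (ob X) B q i = \<zero>\<^bsub>Hom L A B\<^esub>" for A B i q
    unfolding dn_up[OF A B] that(5) using A(1) B(1)
    by (simp add: L.Cmp_zero_left L.Cmp_zero_right inc_closed prj_closed)
  have pA: "pi A \<in> Ob C" "pi B \<in> Ob C" using AB by simp_all
  note upA = up[OF AB(1) mor(1)] and dnA = dn[OF AB(1) mor(2)]
    and upB = up[OF AB(2) mor(3)] and dnB = dn[OF AB(2) mor(4)]
  show "direct_sum C [pi A, pi B] X"
  proof (rule C.direct_sum_pairI[OF pA X ra_closed[OF pA(1) X upA] ra_closed[OF X pA(1) dnA]
        ra_closed[OF pA(2) X upB] ra_closed[OF X pA(2) dnB]])
    show "Cmp C (pi A) X (pi A) (ra (dn A p)) (ra (up A i)) = Idm C (pi A)"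
      unfolding ra_Cmp[OF pA(1) X pA(1) upA dnA, symmetric] dn_up_id[OF AB(1) mor(1,2) eq(1)]
      by (rule ra_Idm[OF pA(1)])
    show "Cmp C (pi B) X (pi B) (ra (dn B q)) (ra (up B j)) = Idm C (pi B)"
      unfolding ra_Cmp[OF pA(2) X pA(2) upB dnB, symmetric] dn_up_id[OF AB(2) mor(3,4) eq(2)]
      by (rule ra_Idm[OF pA(2)])
    show "Cmp C (pi B) X (pi A) (ra (dn A p)) (ra (up B j)) = \<zero>\<^bsub>Hom C (pi B) (pi A)\<^esub>"
      unfolding ra_Cmp[OF pA(2) X pA(1) upB dnA, symmetric] dn_up_zero[OF AB(2) mor(3) AB(1) mor(2) eq(3)]
      by (rule ra_zero[OF pA(2,1)])
    show "Cmp C (pi A) X (pi B) (ra (dn B q)) (ra (up A i)) = \<zero>\<^bsub>Hom C (pi A) (pi B)\<^esub>"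
      unfolding ra_Cmp[OF pA(1) X pA(2) upA dnB, symmetric] dn_up_zero[OF AB(1) mor(1) AB(2) mor(4) eq(4)]
      by (rule ra_zero[OF pA])
    have cl: "Cmp L (ob X) A (ob X) i p \<in> Mor L (ob X) (ob X)" "Cmp L (ob X) B (ob X) j q \<in> Mor L (ob X) (ob X)"
      using L.Cmp_closed[OF oX AB(1) oX mor(2,1)] L.Cmp_closed[OF oX AB(2) oX mor(4,3)] by simp_all
    show "Cmp C X (pi A) X (ra (up A i)) (ra (dn A p)) \<oplus>\<^bsub>Hom C X X\<^esub> Cmp C X (pi B) X (ra (up B j)) (ra (dn B q)) = Idm C X"
      unfolding ra_Cmp[OF X pA(1) X dnA upA, symmetric] ra_Cmp[OF X pA(2) X dnB upB, symmetric]
        up_dn[OF AB(1) co(1) mor(1,2)] up_dn[OF AB(2) co(2) mor(3,4)]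
        ra_add[OF X X cl, symmetric] sum
      by (rule ra_Idm[OF X])
  qed
qed

lemma zero_object_pi:
  assumes A: "A \<in> Ob L" and idem: "corner_idem A = Idm L A"
  shows "zero_object L A \<longleftrightarrow> zero_object C (pi A)"
proof
  assume "zero_object L A"
  then have "inc A = \<zero>\<^bsub>Hom L (ret A) A\<^esub>"
    using L.zero_object_Mor(1)[of A "ret A" "inc A"] inc_closed[OF A] A by simp
  then have "Idm L (ret A) = \<zero>\<^bsub>Hom L (ret A) (ret A)\<^esub>"
    using prj_inc[OF A] L.Cmp_zero_right[of "ret A" A "ret A" "prj A"] A by (simp add: prj_closed)
  then show "zero_object C (pi A)"
    using zero_object_ob[of "pi A"] A by (simp add: L.zero_object_iff)
next
  assume "zero_object C (pi A)"
  then have "zero_object L (ret A)" using zero_object_ob[of "pi A"] A by simp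
  then have "prj A = \<zero>\<^bsub>Hom L A (ret A)\<^esub>"
    using L.zero_object_Mor(1)[of "ret A" A "prj A"] prj_closed[OF A] A by simp
  then have "Idm L A = \<zero>\<^bsub>Hom L A A\<^esub>"
    unfolding idem[symmetric] corner_idem_def using A by (simp add: L.Cmp_zero_right inc_closed)
  then show "zero_object L A" using A by (simp add: L.zero_object_iff)
qed

lemma ob_Ind:
  assumes comp: "compatible B' B" and X: "X \<in> Ind C B"
  shows "ob X \<in> Ind L B'"
  unfolding L.Ind_iff[OF compatible_subset(1)[OF comp]]
proof (intro conjI ballI impI)
  have X': "X \<in> B" "\<not> zero_object C X"
    "\<And>Y Z. Y \<in> B \<Longrightarrow> Z \<in> B \<Longrightarrow> direct_sum C [Y, Z] X \<Longrightarrow> zero_object C Y \<or> zero_object C Z"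
    using X unfolding C.Ind_iff[OF compatible_subset(2)[OF comp]] by simp_all
  note XO = compatibleD(2)[OF comp X'(1)]
  show "ob X \<in> B'" by (rule compatibleD(3)[OF comp X'(1)])
  show "\<not> zero_object L (ob X)" using zero_object_ob[OF XO] X'(2) by simp
  fix A A' assume A: "A \<in> B'" "A' \<in> B'" and ds: "direct_sum L [A, A'] (ob X)"
  note co = compatibleD(5)[OF comp A(1)] compatibleD(5)[OF comp A(2)]
  note ds' = direct_sum_pi[OF XO co ds]
  have "zero_object C (pi A) \<or> zero_object C (pi A')"
    by (rule X'(3)[OF compatibleD(4)[OF comp A(1)] compatibleD(4)[OF comp A(2)] ds'(1)])
  then show "zero_object L A \<or> zero_object L A'"
    unfolding zero_object_pi[OF compatibleD(1)[OF comp A(1)] ds'(2)]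
      zero_object_pi[OF compatibleD(1)[OF comp A(2)] ds'(3)] .
qed

lemma pi_Ind:
  assumes comp: "compatible B' B" and A: "A \<in> Ind L B'" and idem: "corner_idem A = Idm L A"
  shows "pi A \<in> Ind C B"
  unfolding C.Ind_iff[OF compatible_subset(2)[OF comp]]
proof (intro conjI ballI impI)
  have A': "A \<in> B'" "\<not> zero_object L A"
    "\<And>Y Z. Y \<in> B' \<Longrightarrow> Z \<in> B' \<Longrightarrow> direct_sum L [Y, Z] A \<Longrightarrow> zero_object L Y \<or> zero_object L Z"
    using A unfolding L.Ind_iff[OF compatible_subset(1)[OF comp]] by simp_all
  note AO = compatibleD(1)[OF comp A'(1)]
  show "pi A \<in> B" by (rule compatibleD(4)[OF comp A'(1)])
  show "\<not> zero_object C (pi A)" using A'(2) zero_object_pi[OF AO idem] by simp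
  fix Y Z assume YZ: "Y \<in> B" "Z \<in> B" "direct_sum C [Y, Z] (pi A)"
  have "zero_object L (ob Y) \<or> zero_object L (ob Z)"
    by (rule A'(3)[OF compatibleD(3)[OF comp YZ(1)] compatibleD(3)[OF comp YZ(2)] direct_sum_ob[OF AO idem YZ(3)]])
  then show "zero_object C Y \<or> zero_object C Z"
    unfolding zero_object_ob[OF compatibleD(2)[OF comp YZ(1)]] zero_object_ob[OF compatibleD(2)[OF comp YZ(2)]] .
qed

text \<open>By \<open>Ind_mono\<close>, removing \<open>Ind\<close> of the smaller term amounts to
  removing the term itself, and \<open>pi\<close> takes membership in \<open>B0'\<close> to
  membership in \<open>B0\<close>.\<close>

lemma ob_Ind_diff:
  assumes "compatible B' B" "compatible B0' B0" "B0 \<subseteq> B" "X \<in> Ind C B - Ind C B0"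
  shows "ob X \<in> Ind L B' - Ind L B0'"
proof -
  have X: "X \<in> Ind C B" "X \<notin> Ind C B0" using assms(4) by simp_all
  note B = compatible_subset[OF assms(1)] and B0 = compatible_subset[OF assms(2)]
  have XO: "X \<in> Ob C" using X(1) B(2) unfolding C.Ind_iff[OF B(2)] by (elim conjE) (rule subsetD)
  have "ob X \<notin> Ind L B0'"
  proof
    assume "ob X \<in> Ind L B0'"
    then have "ob X \<in> B0'" unfolding L.Ind_iff[OF B0(1)] by (rule conjunct1)
    then have "X \<in> B0" using compatibleD(4)[OF assms(2)] pi_ob[OF XO] by force
    then have "X \<in> Ind C B0" by (rule C.Ind_mono[OF X(1) assms(3) B(2)])
    then show False using X(2) by contradiction
  qed
  then show ?thesis using ob_Ind[OF assms(1) X(1)] by simp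
qed

lemma pi_Ind_diff:
  assumes comp: "compatible B' B" and "B0' \<subseteq> B'" and B0: "B0 \<subseteq> Ob C" and A: "A \<in> Ind L B' - Ind L B0'"
    and idem: "corner_idem A = Idm L A"
    and B0_imp: "pi A \<in> B0 \<Longrightarrow> zero_object C (pi A) \<or> A \<in> B0'"
  shows "pi A \<in> Ind C B - Ind C B0"
proof -
  have A': "A \<in> Ind L B'" "A \<notin> Ind L B0'" using A by simp_all
  have "pi A \<notin> Ind C B0"
  proof
    assume "pi A \<in> Ind C B0"
    then have "pi A \<in> B0" "\<not> zero_object C (pi A)" unfolding C.Ind_iff[OF B0] by simp_all
    then have "A \<in> B0'" using B0_imp by simp
    then have "A \<in> Ind L B0'" by (rule L.Ind_mono[OF A'(1) assms(2) compatible_subset(1)[OF comp]])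
    then show False using A'(2) by contradiction
  qed
  then show ?thesis using pi_Ind[OF comp A'(1) idem] by simp
qed

end

section \<open>Layers of filtrations and their restriction to a corner\<close>

lemma (in k_category) Mod_iso_dsum_list_all2:
  assumes "list_all2 (Mod_iso C) Ds Es" "set Ds \<subseteq> Modules C"
  shows "Mod_iso C (dsum_Mod Ds) (dsum_Mod Es)"
  using assms
proof (induction rule: list_all2_induct)
  case Nil
  show ?case by (rule Mod_iso_dsum_Nil)
next
  case (Cons D Ds E Es)
  have "dsum_Mod (D # Ds) \<in> Modules C"
    using Cons.prems by (intro dsum_Mod_Modules) (erule subsetD)
  then show ?case using Cons by (intro Mod_iso_dsum_Cons) simp_all
qed

text \<open>The families agree on the objects of \<open>C\<close> only; the records may differ
  elsewhere and are therefore compared up to isomorphism.\<close>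

lemma quot_restrict_Mod_cong:
  assumes "\<And>X. X \<in> Ob C \<Longrightarrow> N X = N' X" and "\<And>X. X \<in> Ob C \<Longrightarrow> P X = P' X"
  shows "Mod_iso C (quot_Mod (restrict_Mod F N) P) (quot_Mod (restrict_Mod F N') P')"
  by (rule Mod_iso_cong) (simp_all add: quot_Mod_def assms)

lemma quot_Mod_trivial:
  assumes F: "F \<in> Modules C" and N: "submodule C N F" and X: "X \<in> Ob C"
    and "N X = carrier (val F X)"
  shows "trivial (val (quot_Mod F N) X)"
proof -
  interpret group "val F X" by (rule Modules_group[OF F X])
  interpret N: subgroup "N X" "val F X" by (rule submodule_subgroup[OF N X])
  have "N X #>\<^bsub>val F X\<^esub> x = N X" if "x \<in> carrier (val F X)" for x
    using coset_join2[OF that N.subgroup_axioms] that assms(4) by simp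
  then show ?thesis
    unfolding carrier_quot_Mod by (auto simp: FactGroup_def)
qed

text \<open>The identity is zero and hence equal to its own double, so each \<open>x\<close> equals
  its own square in the group.\<close>

lemma (in k_category) Modules_zero_object:
  assumes F: "F \<in> Modules C" and X: "zero_object C X"
  shows "trivial (val F X)"
proof -
  have X': "X \<in> Ob C" "Idm C X = \<zero>\<^bsub>Hom C X X\<^esub>" using X by (simp_all add: zero_object_iff)
  interpret group "val F X" by (rule Modules_group[OF F X'(1)])
  have "x = \<one>\<^bsub>val F X\<^esub>" if x: "x \<in> carrier (val F X)" for x
  proof -
    have "act F X X (Idm C X \<oplus>\<^bsub>Hom C X X\<^esub> Idm C X) x = x \<otimes>\<^bsub>val F X\<^esub> x"
      using Modules_act_add[OF F X'(1,1) Idm_closed[OF X'(1)] Idm_closed[OF X'(1)] x] Modules_act_Idm[OF F X'(1) x]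
      by simp
    moreover have "Idm C X \<oplus>\<^bsub>Hom C X X\<^esub> Idm C X = Idm C X"
      unfolding X'(2) using X'(1) by (simp add: Hom_l_zero Hom_zero_closed)
    ultimately have "x = x \<otimes>\<^bsub>val F X\<^esub> x" using Modules_act_Idm[OF F X'(1) x] by simp
    then show ?thesis using l_cancel_one'[OF x x] by simp
  qed
  then show ?thesis by auto
qed

lemma (in k_category) trace_filt_zero_objects:
  assumes F: "F \<in> Modules C" and B: "\<And>E. E \<in> B j \<Longrightarrow> zero_object C E" and X: "X \<in> Ob C"
  shows "trace_filt C B F j X = {\<one>\<^bsub>val F X\<^esub>}"
proof -
  have Bj: "B j \<subseteq> Ob C" using B by (auto simp: zero_object_iff)
  interpret group "val F X" by (rule Modules_group[OF F X])
  have "trace_gens C (B j) F X \<subseteq> {\<one>\<^bsub>val F X\<^esub>}"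
  proof
    fix y assume "y \<in> trace_gens C (B j) F X"
    then obtain E f x where *: "E \<in> B j" "f \<in> Mor C E X" "x \<in> carrier (val F E)" and y: "y = act F E X f x"
      by (rule trace_gensE)
    then have "x = \<one>\<^bsub>val F E\<^esub>" using Modules_zero_object[OF F B] by blast
    then show "y \<in> {\<one>\<^bsub>val F X\<^esub>}"
      unfolding y using Modules_act_one[OF F subsetD[OF Bj *(1)] X *(2)] by simp
  qed
  then have "trace_filt C B F j X \<subseteq> {\<one>\<^bsub>val F X\<^esub>}"
    unfolding trace_filt_eq[where B = B, OF F Bj X] by (rule generate_subgroup_incl) (rule triv_subgroup)
  moreover have "\<one>\<^bsub>val F X\<^esub> \<in> trace_filt C B F j X"
    unfolding trace_filt_def by (rule generate.one)
  ultimately show ?thesis by auto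
qed

text \<open>An element at \<open>X\<close> is its own image under the identity of \<open>X\<close>,
  which belongs to the subcategory.\<close>

lemma (in k_category) trace_filt_full:
  assumes F: "F \<in> Modules C" and B: "B j \<subseteq> Ob C" and X: "X \<in> B j"
  shows "trace_filt C B F j X = carrier (val F X)"
proof -
  have X': "X \<in> Ob C" using B X by (rule subsetD)
  interpret group "val F X" by (rule Modules_group[OF F X'])
  let ?G = "trace_gens C (B j) F X"
  have "?G \<subseteq> carrier (val F X)"
    using Modules_act_closed[OF F _ X'] B by (auto simp: subset_iff elim!: trace_gensE)
  then have "generate (val F X) ?G \<subseteq> carrier (val F X)" by (rule generate_incl)
  moreover have "x \<in> generate (val F X) ?G" if "x \<in> carrier (val F X)" for x
  proof (rule generate.incl)
    have "x = act F X X (Idm C X) x" using Modules_act_Idm[OF F X' that] by simp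
    then show "x \<in> ?G" by (rule trace_gensI[OF X Idm_closed[OF X'] that])
  qed
  ultimately show ?thesis
    unfolding trace_filt_eq[where B = B, OF F B X'] by (intro equalityI subsetI) auto
qed

abbreviation "trace_layer C B F i i0 \<equiv> quot_Mod (trace_Mod C B F i) (trace_filt C B F i0)"

definition delta_filtration :: "('o, 'm, 'k) kcat \<Rightarrow> nat set \<Rightarrow> (nat \<Rightarrow> 'o set) \<Rightarrow> ('o, 'm, 'a) cmod \<Rightarrow>
    nat \<Rightarrow> (nat \<Rightarrow> 'o \<Rightarrow> 'a set) \<Rightarrow> bool"
  where "delta_filtration C I B F r N \<longleftrightarrow> (\<forall>i\<le>r. submodule C (N i) F) \<and>
    (\<forall>X\<in>Ob C. N 0 X = {\<one>\<^bsub>val F X\<^esub>} \<and> N r X = carrier (val F X) \<and> (\<forall>i<r. N i X \<subseteq> N (Suc i) X)) \<and>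
    (\<forall>i<r. \<exists>Ds. set Ds \<subseteq> (\<Union>j\<in>I - {0}. standard C B j) \<and>
       Mod_iso C (quot_Mod (restrict_Mod F (N (Suc i))) (N i)) (dsum_Mod Ds))"

lemma filt_fin_iff: "F \<in> filt_fin C I B \<longleftrightarrow> F \<in> Modules C \<and> (\<exists>r N. delta_filtration C I B F r N)"
  unfolding filt_fin_def delta_filtration_def mem_Collect_eq ..

lemma delta_filtrationD:
  assumes "delta_filtration C I B F r N"
  shows "i \<le> r \<Longrightarrow> submodule C (N i) F"
    and "X \<in> Ob C \<Longrightarrow> N 0 X = {\<one>\<^bsub>val F X\<^esub>}"
    and "X \<in> Ob C \<Longrightarrow> N r X = carrier (val F X)"
    and "i < r \<Longrightarrow> X \<in> Ob C \<Longrightarrow> N i X \<subseteq> N (Suc i) X"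
    and "i < r \<Longrightarrow> \<exists>Ds. set Ds \<subseteq> (\<Union>j\<in>I - {0}. standard C B j) \<and>
       Mod_iso C (quot_Mod (restrict_Mod F (N (Suc i))) (N i)) (dsum_Mod Ds)"
  using assms unfolding delta_filtration_def by simp_all

context corner
begin

lemma Mod_iso_pull_dsum:
  assumes "Mod_iso L Q (dsum_Mod Ds)" and "\<And>D. D \<in> set Ds \<Longrightarrow> D \<in> Modules L"
    and "\<And>D. D \<in> set Ds \<Longrightarrow>
      (\<forall>X\<in>Ob C. trivial (val D (ob X))) \<or> (\<exists>E\<in>S. Mod_iso C (pull D) E)"
  shows "\<exists>Es. set Es \<subseteq> S \<and> Mod_iso C (pull Q) (dsum_Mod Es)"
proof -
  have "\<exists>Es. set Es \<subseteq> S \<and> Mod_iso C (dsum_Mod (map pull Ds)) (dsum_Mod Es)"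
  proof (rule C.Mod_iso_dsum_Mod)
    fix D' assume "D' \<in> set (map pull Ds)"
    then obtain D where D: "D \<in> set Ds" "D' = pull D" by auto
    show "D' \<in> Modules C" unfolding D(2) by (rule pull_Modules[OF assms(2)[OF D(1)]])
    show "(\<forall>X\<in>Ob C. trivial (val D' X)) \<or> (\<exists>E\<in>S. Mod_iso C D' E)"
      using assms(3)[OF D(1)] unfolding D(2) pull_Mod_simps .
  qed
  then obtain Es where Es: "set Es \<subseteq> S" "Mod_iso C (dsum_Mod (map pull Ds)) (dsum_Mod Es)" by (elim exE conjE)
  show ?thesis
    using Es(1) Mod_iso_trans[OF Mod_iso_trans[OF Mod_iso_pull[OF assms(1)] pull_Mod_dsum_Mod] Es(2)]
    by (intro exI conjI)
qed

lemma supported_dsum: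
  assumes "\<And>D. D \<in> set Ds \<Longrightarrow> supported D"
  shows "supported (dsum_Mod Ds)"
proof -
  have *: "act (Ds ! i) A A (corner_idem A) x = x"
    if "i < length Ds" "A \<in> Ob L" "x \<in> carrier (val (Ds ! i) A)" for i A x
    using assms[of "Ds ! i"] that unfolding supported_def by simp
  have "act (dsum_Mod Ds) A A (corner_idem A) x = x"
    if A: "A \<in> Ob L" and x: "x \<in> carrier (val (dsum_Mod Ds) A)" for A x
  proof (rule extensionalityI)
    show "x \<in> extensional {..<length Ds}" using x by (auto simp: PiE_iff)
    fix i assume "i \<in> {..<length Ds}"
    then show "act (dsum_Mod Ds) A A (corner_idem A) x i = x i"
      using x A by (simp add: * PiE_iff)
  qed simp
  then show ?thesis unfolding supported_def by blast
qed

text \<open>The summands are lifted one by one. Their direct sum is again supported and has the same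
  restriction as \<open>Q\<close> up to isomorphism, so it is isomorphic to
  \<open>Q\<close>.\<close>

lemma Mod_iso_lift_dsum:
  assumes Q: "Q \<in> Modules L" "supported Q" and iso: "Mod_iso C (pull Q) (dsum_Mod Es)"
    and S: "\<And>D. D \<in> S \<Longrightarrow> D \<in> Modules L \<and> supported D"
    and lift: "\<And>E. E \<in> set Es \<Longrightarrow> \<exists>D\<in>S. Mod_iso C (pull D) E"
  shows "\<exists>Ds. set Ds \<subseteq> S \<and> Mod_iso L Q (dsum_Mod Ds)"
proof -
  have "\<forall>E\<in>set Es. \<exists>D. D \<in> S \<and> Mod_iso C (pull D) E" using lift by blast
  then obtain d where d: "\<forall>E\<in>set Es. d E \<in> S \<and> Mod_iso C (pull (d E)) E" by (rule bchoice[THEN exE])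
  let ?Ds = "map d Es"
  have Ds: "D \<in> Modules L" "supported D" "D \<in> S" if "D \<in> set ?Ds" for D
    using that d S by auto
  have dM: "dsum_Mod ?Ds \<in> Modules L" using Ds(1) by (rule L.dsum_Mod_Modules)
  have "Mod_iso C (dsum_Mod (map pull ?Ds)) (dsum_Mod Es)"
  proof (rule C.Mod_iso_dsum_list_all2)
    show "list_all2 (Mod_iso C) (map pull ?Ds) Es"
      using d by (simp add: list_all2_conv_all_nth)
    show "set (map pull ?Ds) \<subseteq> Modules C"
      using Ds(1) pull_Modules by auto
  qed
  then have "Mod_iso C (pull (dsum_Mod ?Ds)) (dsum_Mod Es)"
    by (rule Mod_iso_trans[OF pull_Mod_dsum_Mod])
  then have iso2: "Mod_iso C (dsum_Mod Es) (pull (dsum_Mod ?Ds))"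
    by (rule Mod_iso_sym) (rule pull_Modules[OF dM])
  have "Mod_iso L Q (dsum_Mod ?Ds)"
    by (rule Mod_iso_supported[OF Q dM supported_dsum[OF Ds(2)] Mod_iso_trans[OF iso iso2]])
  moreover have "set ?Ds \<subseteq> S" using Ds(3) by (rule subsetI)
  ultimately show ?thesis by (intro exI conjI)
qed

lemma trace_quot_pull:
  assumes F: "F \<in> Modules L" and comp: "compatible (B' i) (B j)" "compatible (B' i0) (B j0)"
  shows "Mod_iso C (trace_layer C B (pull F) j j0)
    (pull (trace_layer L B' F i i0))"
  unfolding trace_Mod_def pull_Mod_quot_Mod pull_Mod_restrict_Mod
  by (rule quot_restrict_Mod_cong) (simp_all add: trace_filt_pull[where B' = B' and B = B, OF F comp(1)]
      trace_filt_pull[where B' = B' and B = B, OF F comp(2)])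

text \<open>The restricted chain keeps its length; a layer whose summands all vanish on the corner
  becomes zero. The disjunction in \<open>std\<close> reflects that a finite filtration may mix
  standard modules living on either corner.\<close>

lemma filt_fin_pull:
  assumes F: "F \<in> filt_fin L I B'"
    and std: "\<And>i D. i \<in> I \<Longrightarrow> i \<noteq> 0 \<Longrightarrow> D \<in> standard L B' i \<Longrightarrow> D \<in> Modules L \<and>
      ((\<forall>X\<in>Ob C. trivial (val D (ob X))) \<or> (\<exists>j\<in>J - {0}. \<exists>E\<in>standard C B j. Mod_iso C (pull D) E))"
  shows "pull F \<in> filt_fin C J B"
proof -
  have FM: "F \<in> Modules L" using F unfolding filt_fin_iff by (rule conjunct1)
  obtain r N where "delta_filtration L I B' F r N" using F unfolding filt_fin_iff by (elim conjE exE)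
  note N = delta_filtrationD[OF this]
  have 1: "\<forall>i\<le>r. submodule C (\<lambda>X. N i (ob X)) (pull F)"
    by (intro allI impI) (rule submodule_pull[OF N(1)])
  have 2: "\<forall>X\<in>Ob C. N 0 (ob X) = {\<one>\<^bsub>val (pull F) X\<^esub>} \<and> N r (ob X) = carrier (val (pull F) X)
      \<and> (\<forall>i<r. N i (ob X) \<subseteq> N (Suc i) (ob X))"
    using N by simp
  have 3: "\<forall>i<r. \<exists>Es. set Es \<subseteq> (\<Union>j\<in>J - {0}. standard C B j) \<and>
       Mod_iso C (quot_Mod (restrict_Mod (pull F) (\<lambda>X. N (Suc i) (ob X))) (\<lambda>X. N i (ob X))) (dsum_Mod Es)"
  proof (intro allI impI)
    fix i assume "i < r"
    from N(5)[OF this] obtain Ds where Ds: "set Ds \<subseteq> (\<Union>j\<in>I - {0}. standard L B' j)"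
      "Mod_iso L (quot_Mod (restrict_Mod F (N (Suc i))) (N i)) (dsum_Mod Ds)" by (elim exE conjE)
    have std': "D \<in> Modules L \<and>
      ((\<forall>X\<in>Ob C. trivial (val D (ob X))) \<or>
       (\<exists>E\<in>(\<Union>j\<in>J - {0}. standard C B j). Mod_iso C (pull D) E))"
      if D: "D \<in> set Ds" for D
    proof -
      obtain i where "i \<in> I" "i \<noteq> 0" "D \<in> standard L B' i"
        using subsetD[OF Ds(1) D] by (elim UN_E DiffE) simp
      from std[OF this] show ?thesis unfolding bex_UN .
    qed
    show "\<exists>Es. set Es \<subseteq> (\<Union>j\<in>J - {0}. standard C B j) \<and>
       Mod_iso C (quot_Mod (restrict_Mod (pull F) (\<lambda>X. N (Suc i) (ob X))) (\<lambda>X. N i (ob X))) (dsum_Mod Es)"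
      unfolding pull_Mod_restrict_Mod[symmetric] pull_Mod_quot_Mod[symmetric]
      by (rule Mod_iso_pull_dsum[OF Ds(2)]) (use std' in simp_all)
  qed
  show ?thesis
    unfolding filt_fin_iff delta_filtration_def
    by (rule conjI[OF pull_Modules[OF FM]], rule exI[of _ r], rule exI[of _ "\<lambda>i X. N i (ob X)"],
        rule conjI[OF 1], rule conjI[OF 2], rule 3)
qed

end

section \<open>The triangular matrix category\<close>

lemma tens_class_eqI: "tens_eq K V W x y \<Longrightarrow> tens_class K V W x = tens_class K V W y"
  unfolding tens_class_def by (auto intro: tens_sym tens_trans)

text \<open>Sums, multiples and composites of tensors are defined as unions over representatives.
  That such a union is a single class comes from the category axioms of the tensor product category,
  which accompany the functor \<open>M\<close>; one member then identifies it.\<close>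

lemma tensor_carrier_eqI:
  assumes "S \<in> carrier (tensor K V W)" and "z \<in> S"
  shows "S = tens_class K V W z"
proof -
  obtain x where "S = tens_class K V W x" using assms(1) by (auto simp: tensor_def)
  then show ?thesis using assms(2) tens_class_eqI[of K V W x z] by (simp add: tens_class_def)
qed

lemma pure_tens_self:
  "v \<in> carrier V \<Longrightarrow> w \<in> carrier W \<Longrightarrow> {#(v, w)#} \<in> pure_tens K V W v w"
  by (simp add: tens_class_def tens_refl)

lemma pure_tens_closed:
  "v \<in> carrier V \<Longrightarrow> w \<in> carrier W \<Longrightarrow> pure_tens K V W v w \<in> carrier (tensor K V W)"
  by (auto simp: tensor_def)

lemma tensor_add_pure:
  assumes "pure_tens K V W v w \<oplus>\<^bsub>tensor K V W\<^esub> pure_tens K V W v' w' \<in> carrier (tensor K V W)"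
    and "v \<in> carrier V" "w \<in> carrier W" "v' \<in> carrier V" "w' \<in> carrier W"
    and "tens_eq K V W {#(v, w), (v', w')#} {#(v'', w'')#}"
  shows "pure_tens K V W v w \<oplus>\<^bsub>tensor K V W\<^esub> pure_tens K V W v' w' = pure_tens K V W v'' w''"
proof (rule tensor_carrier_eqI[OF assms(1)])
  have "{#(v'', w'')#} \<in> tens_class K V W ({#(v, w)#} + {#(v', w')#})"
    using assms(6) by (simp add: tens_class_def add_mset_commute)
  then show "{#(v'', w'')#} \<in> pure_tens K V W v w \<oplus>\<^bsub>tensor K V W\<^esub> pure_tens K V W v' w'"
    using pure_tens_self[OF assms(2,3)] pure_tens_self[OF assms(4,5)] unfolding tensor_def by force
qed

lemma tensor_smult_pure:
  assumes "a \<odot>\<^bsub>tensor K V W\<^esub> pure_tens K V W v w \<in> carrier (tensor K V W)"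
    and "v \<in> carrier V" "w \<in> carrier W" "a \<odot>\<^bsub>V\<^esub> v \<in> carrier V"
  shows "a \<odot>\<^bsub>tensor K V W\<^esub> pure_tens K V W v w = pure_tens K V W (a \<odot>\<^bsub>V\<^esub> v) w"
proof (rule tensor_carrier_eqI[OF assms(1)])
  have "{#(a \<odot>\<^bsub>V\<^esub> v, w)#} \<in> tens_class K V W {#(a \<odot>\<^bsub>V\<^esub> v, w). (v, w) \<in># {#(v, w)#}#}"
    using pure_tens_self[OF assms(4,3)] by simp
  then show "{#(a \<odot>\<^bsub>V\<^esub> v, w)#} \<in> a \<odot>\<^bsub>tensor K V W\<^esub> pure_tens K V W v w"
    using pure_tens_self[OF assms(2,3)] unfolding tensor_def by force
qed

lemma triple_module:
  assumes "module K V1" "module K V2" "module K V3"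
  shows "module K \<lparr>carrier = carrier V1 \<times> carrier V2 \<times> carrier V3, monoid.mult = u1, one = u2,
        zero = (\<zero>\<^bsub>V1\<^esub>, \<zero>\<^bsub>V2\<^esub>, \<zero>\<^bsub>V3\<^esub>),
        add = (\<lambda>(t, m, u) (t', m', u'). (t \<oplus>\<^bsub>V1\<^esub> t', m \<oplus>\<^bsub>V2\<^esub> m', u \<oplus>\<^bsub>V3\<^esub> u')),
        smult = (\<lambda>a (t, m, u). (a \<odot>\<^bsub>V1\<^esub> t, a \<odot>\<^bsub>V2\<^esub> m, a \<odot>\<^bsub>V3\<^esub> u))\<rparr>"
proof -
  interpret V1: module K V1 by fact
  interpret V2: module K V2 by fact
  interpret V3: module K V3 by fact
  show ?thesis
  proof (rule moduleI)
    show "abelian_group \<lparr>carrier = carrier V1 \<times> carrier V2 \<times> carrier V3, monoid.mult = u1, one = u2,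
        zero = (\<zero>\<^bsub>V1\<^esub>, \<zero>\<^bsub>V2\<^esub>, \<zero>\<^bsub>V3\<^esub>),
        add = (\<lambda>(t, m, u) (t', m', u'). (t \<oplus>\<^bsub>V1\<^esub> t', m \<oplus>\<^bsub>V2\<^esub> m', u \<oplus>\<^bsub>V3\<^esub> u')),
        smult = (\<lambda>a (t, m, u). (a \<odot>\<^bsub>V1\<^esub> t, a \<odot>\<^bsub>V2\<^esub> m, a \<odot>\<^bsub>V3\<^esub> u))\<rparr>"
    proof (rule abelian_groupI, goal_cases)
      case (6 x)
      then obtain t m u where "x = (t, m, u)" "t \<in> carrier V1" "m \<in> carrier V2" "u \<in> carrier V3" by auto
      then show ?case
        by (intro bexI[of _ "(\<ominus>\<^bsub>V1\<^esub> t, \<ominus>\<^bsub>V2\<^esub> m, \<ominus>\<^bsub>V3\<^esub> u)"]) (simp_all add: V1.M.l_neg V2.M.l_neg V3.M.l_neg)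
    qed (auto simp: V1.M.a_ac V2.M.a_ac V3.M.a_ac)
  qed (auto simp: V1.R.is_cring V1.smult_l_distr V2.smult_l_distr V3.smult_l_distr V1.smult_r_distr
      V2.smult_r_distr V3.smult_r_distr V1.smult_assoc1 V2.smult_assoc1 V3.smult_assoc1)
qed

locale triangular = U: k_category K U + T: k_category K T + M: modK_functor K "tensor_cat K U (op_cat T)" M
  for K :: "('k, 'x) ring_scheme" (structure) and U :: "('u, 'p, 'k) kcat" and T :: "('t, 'q, 'k) kcat"
    and M :: "('u, 'p, 't, 'q, 'k, 'v) bifun"
begin

abbreviation "UT \<equiv> tensor_cat K U (op_cat T)"
abbreviation "pt X X' S S' u t \<equiv> pure_tens K (Hom U X X') (Hom (op_cat T) S S') u t"
abbreviation "lact \<equiv> act_left K U T M"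
abbreviation "ract \<equiv> act_right K U T M"
abbreviation "Lam \<equiv> tri_cat K U T M"

lemma op_simps: "Hom (op_cat T) S S' = Hom T S' S" "Cmp (op_cat T) S R Q g f = Cmp T Q R S f g"
  "Idm (op_cat T) = Idm T" "Ob (op_cat T) = Ob T"
  by (simp_all add: op_cat_def)

lemma UT_simps: "Ob UT = Ob U \<times> Ob T" "Hom UT (X, S) (X', S') = tensor K (Hom U X X') (Hom (op_cat T) S S')"
  "Idm UT (X, S) = pt X X S S (Idm U X) (Idm T S)"
  by (simp_all add: tensor_cat_def op_simps)

lemma pt_closed:
  "\<lbrakk>u \<in> Mor U X X'; t \<in> Mor T S' S\<rbrakk> \<Longrightarrow> pt X X' S S' u t \<in> Mor UT (X, S) (X', S')"
  unfolding UT_simps by (rule pure_tens_closed) (simp_all add: op_simps)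

text \<open>Closedness of composition makes the composite a class, so the member built from the
  representatives \<open>(u', t')\<close> and \<open>(u, t)\<close> determines it. The
  \<open>T\<close>-entries compose in the opposite order.\<close>

lemma pt_Cmp:
  assumes ob: "X \<in> Ob U" "Y \<in> Ob U" "Z \<in> Ob U" "S \<in> Ob T" "R \<in> Ob T" "Q \<in> Ob T"
    and u: "u \<in> Mor U X Y" "u' \<in> Mor U Y Z" and t: "t \<in> Mor T R S" "t' \<in> Mor T Q R"
  shows "Cmp UT (X, S) (Y, R) (Z, Q) (pt Y Z R Q u' t') (pt X Y S R u t)
    = pt X Z S Q (Cmp U X Y Z u' u) (Cmp T Q R S t t')"
proof (rule tensor_carrier_eqI)
  have "Cmp UT (X, S) (Y, R) (Z, Q) (pt Y Z R Q u' t') (pt X Y S R u t) \<in> Mor UT (X, S) (Z, Q)"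
    using ob u t by (intro M.Cmp_closed) (simp_all add: UT_simps(1) pt_closed)
  then show "Cmp UT (X, S) (Y, R) (Z, Q) (pt Y Z R Q u' t') (pt X Y S R u t)
      \<in> carrier (tensor K (Hom U X Z) (Hom (op_cat T) S Q))"
    by (simp only: UT_simps)
  have 1: "{#(u', t')#} \<in> pt Y Z R Q u' t'" "{#(u, t)#} \<in> pt X Y S R u t"
    using u t by (intro pure_tens_self; simp add: op_simps)+
  have 2: "{#(Cmp U X Y Z u' u, Cmp T Q R S t t')#} \<in> tens_class K (Hom U X Z) (Hom (op_cat T) S Q)
         (\<Sum>(g, g')\<in>#{#(u', t')#}. {#(Cmp U X Y Z g f, Cmp (op_cat T) S R Q g' f'). (f, f') \<in># {#(u, t)#}#})"
    using pure_tens_self[of "Cmp U X Y Z u' u" "Hom U X Z" "Cmp T Q R S t t'" "Hom (op_cat T) S Q" K]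
      U.Cmp_closed[OF ob(1-3) u] T.Cmp_closed[OF ob(6,5,4) t(2,1)] by (simp add: op_simps)
  show "{#(Cmp U X Y Z u' u, Cmp T Q R S t t')#}
      \<in> Cmp UT (X, S) (Y, R) (Z, Q) (pt Y Z R Q u' t') (pt X Y S R u t)"
    unfolding tensor_cat_def kcat.simps prod.case by (rule UN_I[OF 1(1)], rule UN_I[OF 1(2)], rule 2)
qed

lemma pt_add_left:
  assumes ob: "X \<in> Ob U" "Y \<in> Ob U" "S \<in> Ob T" "R \<in> Ob T"
    and u: "u \<in> Mor U X Y" "u' \<in> Mor U X Y" and t: "t \<in> Mor T R S"
  shows "pt X Y S R u t \<oplus>\<^bsub>Hom UT (X, S) (Y, R)\<^esub> pt X Y S R u' t = pt X Y S R (u \<oplus>\<^bsub>Hom U X Y\<^esub> u') t"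
proof -
  have "pt X Y S R u t \<oplus>\<^bsub>Hom UT (X, S) (Y, R)\<^esub> pt X Y S R u' t \<in> Mor UT (X, S) (Y, R)"
    using ob u t by (intro M.Hom_add_closed) (simp_all add: UT_simps(1) pt_closed)
  then show ?thesis
    unfolding UT_simps(2)
    by (rule tensor_add_pure) (use u t in \<open>auto simp: op_simps intro!: tens_sym[OF tens_add_left]\<close>)
qed

lemma pt_add_right:
  assumes ob: "X \<in> Ob U" "Y \<in> Ob U" "S \<in> Ob T" "R \<in> Ob T"
    and u: "u \<in> Mor U X Y" and t: "t \<in> Mor T R S" "t' \<in> Mor T R S"
  shows "pt X Y S R u t \<oplus>\<^bsub>Hom UT (X, S) (Y, R)\<^esub> pt X Y S R u t' = pt X Y S R u (t \<oplus>\<^bsub>Hom T R S\<^esub> t')"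
proof -
  have "pt X Y S R u t \<oplus>\<^bsub>Hom UT (X, S) (Y, R)\<^esub> pt X Y S R u t' \<in> Mor UT (X, S) (Y, R)"
    using ob u t by (intro M.Hom_add_closed) (simp_all add: UT_simps(1) pt_closed)
  then show ?thesis
    unfolding UT_simps(2)
    by (rule tensor_add_pure) (use u t in \<open>auto simp: op_simps intro!: tens_sym[OF tens_add_right]\<close>)
qed

lemma pt_smult_left:
  assumes ob: "X \<in> Ob U" "Y \<in> Ob U" "S \<in> Ob T" "R \<in> Ob T" and a: "a \<in> carrier K"
    and u: "u \<in> Mor U X Y" and t: "t \<in> Mor T R S"
  shows "a \<odot>\<^bsub>Hom UT (X, S) (Y, R)\<^esub> pt X Y S R u t = pt X Y S R (a \<odot>\<^bsub>Hom U X Y\<^esub> u) t"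
proof -
  have "a \<odot>\<^bsub>Hom UT (X, S) (Y, R)\<^esub> pt X Y S R u t \<in> Mor UT (X, S) (Y, R)"
    using ob u t a by (intro module.smult_closed[OF M.Hom_module]) (simp_all add: UT_simps(1) pt_closed)
  then show ?thesis
    unfolding UT_simps(2)
    by (rule tensor_smult_pure) (use ob u t a in \<open>simp_all add: op_simps module.smult_closed[OF U.Hom_module]\<close>)
qed

lemma pt_smult_right:
  assumes ob: "X \<in> Ob U" "Y \<in> Ob U" "S \<in> Ob T" "R \<in> Ob T" and a: "a \<in> carrier K"
    and u: "u \<in> Mor U X Y" and t: "t \<in> Mor T R S"
  shows "a \<odot>\<^bsub>Hom UT (X, S) (Y, R)\<^esub> pt X Y S R u t = pt X Y S R u (a \<odot>\<^bsub>Hom T R S\<^esub> t)"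
  unfolding pt_smult_left[OF assms]
  by (rule tens_class_eqI) (use tens_smult[of a K u "Hom U X Y" t "Hom (op_cat T) S R"] a u t in \<open>simp add: op_simps\<close>)

section \<open>The left and the right action on the values of \<open>M\<close>\<close>

lemmas UT_Ob = UT_simps(1)

lemma M_module: "X \<in> Ob U \<Longrightarrow> S \<in> Ob T \<Longrightarrow> module K (fobj M (X, S))"
  by (rule M.fobj_module) (simp add: UT_Ob)

lemma
  assumes "X \<in> Ob U" "Y \<in> Ob U" "S \<in> Ob T"
  shows lact_closed: "\<lbrakk>u \<in> Mor U X Y; m \<in> carrier (fobj M (X, S))\<rbrakk>
    \<Longrightarrow> lact X Y S u m \<in> carrier (fobj M (Y, S))"
    and lact_add_right: "\<lbrakk>u \<in> Mor U X Y; m \<in> carrier (fobj M (X, S)); m' \<in> carrier (fobj M (X, S))\<rbrakk>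
    \<Longrightarrow> lact X Y S u (m \<oplus>\<^bsub>fobj M (X, S)\<^esub> m') = lact X Y S u m \<oplus>\<^bsub>fobj M (Y, S)\<^esub> lact X Y S u m'"
    and lact_smult_right: "\<lbrakk>u \<in> Mor U X Y; a \<in> carrier K; m \<in> carrier (fobj M (X, S))\<rbrakk>
    \<Longrightarrow> lact X Y S u (a \<odot>\<^bsub>fobj M (X, S)\<^esub> m) = a \<odot>\<^bsub>fobj M (Y, S)\<^esub> lact X Y S u m"
  unfolding act_left_def using assms
  by (simp_all add: M.farr_closed M.farr_add M.farr_smult UT_Ob pt_closed T.Idm_closed)

lemma
  assumes "X \<in> Ob U" "S \<in> Ob T" "R \<in> Ob T"
  shows ract_closed: "\<lbrakk>t \<in> Mor T S R; m \<in> carrier (fobj M (X, R))\<rbrakk>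
    \<Longrightarrow> ract X S R t m \<in> carrier (fobj M (X, S))"
    and ract_add_right: "\<lbrakk>t \<in> Mor T S R; m \<in> carrier (fobj M (X, R)); m' \<in> carrier (fobj M (X, R))\<rbrakk>
    \<Longrightarrow> ract X S R t (m \<oplus>\<^bsub>fobj M (X, R)\<^esub> m') = ract X S R t m \<oplus>\<^bsub>fobj M (X, S)\<^esub> ract X S R t m'"
    and ract_smult_right: "\<lbrakk>t \<in> Mor T S R; a \<in> carrier K; m \<in> carrier (fobj M (X, R))\<rbrakk>
    \<Longrightarrow> ract X S R t (a \<odot>\<^bsub>fobj M (X, R)\<^esub> m) = a \<odot>\<^bsub>fobj M (X, S)\<^esub> ract X S R t m"
  unfolding act_right_def using assms
  by (simp_all add: M.farr_closed M.farr_add M.farr_smult UT_Ob pt_closed U.Idm_closed)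

lemma lact_Idm: "\<lbrakk>X \<in> Ob U; S \<in> Ob T; m \<in> carrier (fobj M (X, S))\<rbrakk> \<Longrightarrow> lact X X S (Idm U X) m = m"
  unfolding act_left_def UT_simps(3)[symmetric] by (rule M.farr_Idm) (simp_all add: UT_Ob)

lemma ract_Idm: "\<lbrakk>X \<in> Ob U; S \<in> Ob T; m \<in> carrier (fobj M (X, S))\<rbrakk> \<Longrightarrow> ract X S S (Idm T S) m = m"
  unfolding act_right_def UT_simps(3)[symmetric] by (rule M.farr_Idm) (simp_all add: UT_Ob)

lemma lact_Cmp:
  assumes "X \<in> Ob U" "Y \<in> Ob U" "Z \<in> Ob U" "S \<in> Ob T" "u \<in> Mor U X Y" "u' \<in> Mor U Y Z" "m \<in> carrier (fobj M (X, S))"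
  shows "lact X Z S (Cmp U X Y Z u' u) m = lact Y Z S u' (lact X Y S u m)"
proof -
  have "lact X Z S (Cmp U X Y Z u' u) m = farr M (X, S) (Z, S)
      (Cmp UT (X, S) (Y, S) (Z, S) (pt Y Z S S u' (Idm T S)) (pt X Y S S u (Idm T S))) m"
    using assms by (simp add: act_left_def pt_Cmp T.Idm_closed T.Cmp_Idm_left)
  also have "\<dots> = lact Y Z S u' (lact X Y S u m)"
    unfolding act_left_def by (rule M.farr_Cmp) (use assms in \<open>simp_all add: UT_Ob pt_closed T.Idm_closed\<close>)
  finally show ?thesis .
qed

lemma ract_Cmp:
  assumes "X \<in> Ob U" "S \<in> Ob T" "R \<in> Ob T" "Q \<in> Ob T" "t \<in> Mor T S R" "t' \<in> Mor T R Q" "m \<in> carrier (fobj M (X, Q))"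
  shows "ract X S Q (Cmp T S R Q t' t) m = ract X S R t (ract X R Q t' m)"
proof -
  have "ract X S Q (Cmp T S R Q t' t) m = farr M (X, Q) (X, S)
      (Cmp UT (X, Q) (X, R) (X, S) (pt X X R S (Idm U X) t) (pt X X Q R (Idm U X) t')) m"
    using assms by (simp add: act_right_def pt_Cmp U.Idm_closed U.Cmp_Idm_left)
  also have "\<dots> = ract X S R t (ract X R Q t' m)"
    unfolding act_right_def by (rule M.farr_Cmp) (use assms in \<open>simp_all add: UT_Ob pt_closed U.Idm_closed\<close>)
  finally show ?thesis .
qed

text \<open>Both sides are the action of the pure tensor of \<open>u\<close> and \<open>t\<close>,
  factored in two ways.\<close>

lemma lact_ract:
  assumes "X \<in> Ob U" "Y \<in> Ob U" "S \<in> Ob T" "R \<in> Ob T" "u \<in> Mor U X Y" "t \<in> Mor T S R" "m \<in> carrier (fobj M (X, R))"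
  shows "lact X Y S u (ract X S R t m) = ract Y S R t (lact X Y R u m)"
proof -
  have "lact X Y S u (ract X S R t m) = farr M (X, R) (Y, S)
      (Cmp UT (X, R) (X, S) (Y, S) (pt X Y S S u (Idm T S)) (pt X X R S (Idm U X) t)) m"
    unfolding act_left_def act_right_def
    by (rule M.farr_Cmp[symmetric]) (use assms in \<open>simp_all add: UT_Ob pt_closed T.Idm_closed U.Idm_closed\<close>)
  also have "\<dots> = farr M (X, R) (Y, S)
      (Cmp UT (X, R) (Y, R) (Y, S) (pt Y Y R S (Idm U Y) t) (pt X Y R R u (Idm T R))) m"
    using assms by (simp add: pt_Cmp U.Idm_closed T.Idm_closed U.Cmp_Idm_left U.Cmp_Idm_right T.Cmp_Idm_left T.Cmp_Idm_right)
  also have "\<dots> = ract Y S R t (lact X Y R u m)"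
    unfolding act_left_def act_right_def
    by (rule M.farr_Cmp) (use assms in \<open>simp_all add: UT_Ob pt_closed T.Idm_closed U.Idm_closed\<close>)
  finally show ?thesis .
qed

lemma
  assumes "X \<in> Ob U" "Y \<in> Ob U" "S \<in> Ob T"
  shows lact_add_left: "\<lbrakk>u \<in> Mor U X Y; u' \<in> Mor U X Y; m \<in> carrier (fobj M (X, S))\<rbrakk>
    \<Longrightarrow> lact X Y S (u \<oplus>\<^bsub>Hom U X Y\<^esub> u') m = lact X Y S u m \<oplus>\<^bsub>fobj M (Y, S)\<^esub> lact X Y S u' m"
    and lact_smult_left: "\<lbrakk>u \<in> Mor U X Y; a \<in> carrier K; m \<in> carrier (fobj M (X, S))\<rbrakk>
    \<Longrightarrow> lact X Y S (a \<odot>\<^bsub>Hom U X Y\<^esub> u) m = a \<odot>\<^bsub>fobj M (Y, S)\<^esub> lact X Y S u m"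
  unfolding act_left_def using assms
  by (simp_all add: pt_add_left[symmetric] pt_smult_left[symmetric] M.farr_add_arrow M.farr_smult_arrow
      UT_Ob pt_closed T.Idm_closed)

lemma
  assumes "X \<in> Ob U" "S \<in> Ob T" "R \<in> Ob T"
  shows ract_add_left: "\<lbrakk>t \<in> Mor T S R; t' \<in> Mor T S R; m \<in> carrier (fobj M (X, R))\<rbrakk>
    \<Longrightarrow> ract X S R (t \<oplus>\<^bsub>Hom T S R\<^esub> t') m = ract X S R t m \<oplus>\<^bsub>fobj M (X, S)\<^esub> ract X S R t' m"
    and ract_smult_left: "\<lbrakk>t \<in> Mor T S R; a \<in> carrier K; m \<in> carrier (fobj M (X, R))\<rbrakk>
    \<Longrightarrow> ract X S R (a \<odot>\<^bsub>Hom T S R\<^esub> t) m = a \<odot>\<^bsub>fobj M (X, S)\<^esub> ract X S R t m"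
  unfolding act_right_def using assms
  by (simp_all add: pt_add_right[symmetric] pt_smult_right[symmetric] M.farr_add_arrow M.farr_smult_arrow
      UT_Ob pt_closed U.Idm_closed)

lemma M_idempotent_zero:
  assumes "X \<in> Ob U" "S \<in> Ob T" "m \<in> carrier (fobj M (X, S))" "m \<oplus>\<^bsub>fobj M (X, S)\<^esub> m = m"
  shows "m = \<zero>\<^bsub>fobj M (X, S)\<^esub>"
proof -
  interpret abelian_group "fobj M (X, S)" by (rule module.axioms(2)[OF M_module[OF assms(1,2)]])
  show ?thesis using assms(3,4) add.l_cancel_one[of m m] by simp
qed

lemma
  assumes "X \<in> Ob U" "S \<in> Ob T"
  shows M_zero_closed: "\<zero>\<^bsub>fobj M (X, S)\<^esub> \<in> carrier (fobj M (X, S))"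
    and M_l_zero: "m \<in> carrier (fobj M (X, S)) \<Longrightarrow> \<zero>\<^bsub>fobj M (X, S)\<^esub> \<oplus>\<^bsub>fobj M (X, S)\<^esub> m = m"
    and M_r_zero: "m \<in> carrier (fobj M (X, S)) \<Longrightarrow> m \<oplus>\<^bsub>fobj M (X, S)\<^esub> \<zero>\<^bsub>fobj M (X, S)\<^esub> = m"
    and M_add_closed: "\<lbrakk>m \<in> carrier (fobj M (X, S)); m' \<in> carrier (fobj M (X, S))\<rbrakk>
      \<Longrightarrow> m \<oplus>\<^bsub>fobj M (X, S)\<^esub> m' \<in> carrier (fobj M (X, S))"
proof -
  interpret abelian_group "fobj M (X, S)" by (rule module.axioms(2)[OF M_module[OF assms]])
  show "\<zero>\<^bsub>fobj M (X, S)\<^esub> \<in> carrier (fobj M (X, S))" by simp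
qed (simp_all add: abelian_monoid.l_zero abelian_monoid.r_zero abelian_monoid.a_closed
    abelian_group.axioms(1)[OF module.axioms(2)[OF M_module[OF assms]]])

lemma lact_zero_right: "\<lbrakk>X \<in> Ob U; Y \<in> Ob U; S \<in> Ob T; u \<in> Mor U X Y\<rbrakk> \<Longrightarrow> lact X Y S u \<zero>\<^bsub>fobj M (X, S)\<^esub> = \<zero>\<^bsub>fobj M (Y, S)\<^esub>"
  using lact_add_right[of X Y S u "\<zero>\<^bsub>fobj M (X, S)\<^esub>" "\<zero>\<^bsub>fobj M (X, S)\<^esub>"]
  by (intro M_idempotent_zero) (simp_all add: M_zero_closed lact_closed M_l_zero)

lemma ract_zero_right: "\<lbrakk>X \<in> Ob U; S \<in> Ob T; R \<in> Ob T; t \<in> Mor T S R\<rbrakk> \<Longrightarrow> ract X S R t \<zero>\<^bsub>fobj M (X, R)\<^esub> = \<zero>\<^bsub>fobj M (X, S)\<^esub>"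
  using ract_add_right[of X S R t "\<zero>\<^bsub>fobj M (X, R)\<^esub>" "\<zero>\<^bsub>fobj M (X, R)\<^esub>"]
  by (intro M_idempotent_zero) (simp_all add: M_zero_closed ract_closed M_l_zero)

lemma lact_zero_left: "\<lbrakk>X \<in> Ob U; Y \<in> Ob U; S \<in> Ob T; m \<in> carrier (fobj M (X, S))\<rbrakk> \<Longrightarrow> lact X Y S \<zero>\<^bsub>Hom U X Y\<^esub> m = \<zero>\<^bsub>fobj M (Y, S)\<^esub>"
  using lact_add_left[of X Y S "\<zero>\<^bsub>Hom U X Y\<^esub>" "\<zero>\<^bsub>Hom U X Y\<^esub>" m]
  by (intro M_idempotent_zero) (simp_all add: U.Hom_zero_closed lact_closed U.Hom_l_zero)

lemma ract_zero_left: "\<lbrakk>X \<in> Ob U; S \<in> Ob T; R \<in> Ob T; m \<in> carrier (fobj M (X, R))\<rbrakk> \<Longrightarrow> ract X S R \<zero>\<^bsub>Hom T S R\<^esub> m = \<zero>\<^bsub>fobj M (X, S)\<^esub>"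
  using ract_add_left[of X S R "\<zero>\<^bsub>Hom T S R\<^esub>" "\<zero>\<^bsub>Hom T S R\<^esub>" m]
  by (intro M_idempotent_zero) (simp_all add: T.Hom_zero_closed ract_closed T.Hom_l_zero)

text \<open>At a zero object the identity acts both as the identity and as zero.\<close>

lemma M_zero_left: "\<lbrakk>zero_object U X; S \<in> Ob T\<rbrakk> \<Longrightarrow> m \<in> carrier (fobj M (X, S)) \<longleftrightarrow> m = \<zero>\<^bsub>fobj M (X, S)\<^esub>"
  using lact_Idm[of X S m] lact_zero_left[of X X S m] by (auto simp: U.zero_object_iff M_zero_closed)

lemma M_zero_right: "\<lbrakk>X \<in> Ob U; zero_object T S\<rbrakk> \<Longrightarrow> m \<in> carrier (fobj M (X, S)) \<longleftrightarrow> m = \<zero>\<^bsub>fobj M (X, S)\<^esub>"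
  using ract_Idm[of X S m] ract_zero_left[of X S S m] by (auto simp: T.zero_object_iff M_zero_closed)

section \<open>The category axioms for triangular matrices\<close>

lemma Lam_simps:
  "Ob Lam = Ob T \<times> Ob U"
  "Mor Lam (S, X) (S', X') = Mor T S S' \<times> carrier (fobj M (X', S)) \<times> Mor U X X'"
  "\<zero>\<^bsub>Hom Lam (S, X) (S', X')\<^esub> = (\<zero>\<^bsub>Hom T S S'\<^esub>, \<zero>\<^bsub>fobj M (X', S)\<^esub>, \<zero>\<^bsub>Hom U X X'\<^esub>)"
  "(t, m, u) \<oplus>\<^bsub>Hom Lam (S, X) (S', X')\<^esub> (t', m', u')
    = (t \<oplus>\<^bsub>Hom T S S'\<^esub> t', m \<oplus>\<^bsub>fobj M (X', S)\<^esub> m', u \<oplus>\<^bsub>Hom U X X'\<^esub> u')"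
  "a \<odot>\<^bsub>Hom Lam (S, X) (S', X')\<^esub> (t, m, u) = (a \<odot>\<^bsub>Hom T S S'\<^esub> t, a \<odot>\<^bsub>fobj M (X', S)\<^esub> m, a \<odot>\<^bsub>Hom U X X'\<^esub> u)"
  "Cmp Lam (S, X) (S', X') (S'', X'') (t2, m2, u2) (t, m, u) =
    (Cmp T S S' S'' t2 t, ract X'' S S' t m2 \<oplus>\<^bsub>fobj M (X'', S)\<^esub> lact X' X'' S u2 m, Cmp U X X' X'' u2 u)"
  "Idm Lam (S, X) = (Idm T S, \<zero>\<^bsub>fobj M (X, S)\<^esub>, Idm U X)"
  by (simp_all add: tri_cat_def)

lemma Lam_k_category: "k_category K Lam"
proof (rule k_category.intro[OF k_category.axioms(1)[OF U.k_category_axioms] k_category_axioms.intro])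
  note c = M_add_closed lact_closed ract_closed M_zero_closed
  note s = Lam_simps
  {
    fix A B assume "A \<in> Ob Lam" "B \<in> Ob Lam"
    then obtain S X R Y where "A = (S, X)" "B = (R, Y)" "S \<in> Ob T" "X \<in> Ob U" "R \<in> Ob T" "Y \<in> Ob U"
      by (auto simp: s)
    then show "module K (Hom Lam A B)"
      unfolding tri_cat_def kcat.simps
      by (simp add: triple_module T.Hom_module U.Hom_module M_module)
  next
    fix A assume "A \<in> Ob Lam"
    then show "Idm Lam A \<in> Mor Lam A A"
      by (cases A) (simp add: s T.Idm_closed U.Idm_closed M_zero_closed)
  next
    fix A B E f g assume "A \<in> Ob Lam" "B \<in> Ob Lam" "E \<in> Ob Lam" "f \<in> Mor Lam A B" "g \<in> Mor Lam B E"
    then show "Cmp Lam A B E g f \<in> Mor Lam A E"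
      by (cases A; cases B; cases E; cases f; cases g) (simp add: s c T.Cmp_closed U.Cmp_closed)
  next
    fix A B f assume "A \<in> Ob Lam" "B \<in> Ob Lam" "f \<in> Mor Lam A B"
    then show "Cmp Lam A B B (Idm Lam B) f = f" "Cmp Lam A A B f (Idm Lam A) = f"
      by (cases A; cases B; cases f; simp add: s c T.Cmp_Idm_left U.Cmp_Idm_left T.Cmp_Idm_right U.Cmp_Idm_right
          ract_zero_right lact_zero_right lact_Idm ract_Idm M_l_zero M_r_zero)+
  next
    fix A B E G f g h assume *: "A \<in> Ob Lam" "B \<in> Ob Lam" "E \<in> Ob Lam" "G \<in> Ob Lam"
      "f \<in> Mor Lam A B" "g \<in> Mor Lam B E" "h \<in> Mor Lam E G"
    obtain S1 X1 S2 X2 S3 X3 S4 X4 t1 m1 u1 t2 m2 u2 t3 m3 u3 where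
      e: "A = (S1, X1)" "B = (S2, X2)" "E = (S3, X3)" "G = (S4, X4)" "f = (t1, m1, u1)" "g = (t2, m2, u2)" "h = (t3, m3, u3)"
      by (metis prod_cases3 surj_pair)
    have o: "S1 \<in> Ob T" "S2 \<in> Ob T" "S3 \<in> Ob T" "S4 \<in> Ob T" "X1 \<in> Ob U" "X2 \<in> Ob U" "X3 \<in> Ob U" "X4 \<in> Ob U"
      and m: "t1 \<in> Mor T S1 S2" "t2 \<in> Mor T S2 S3" "t3 \<in> Mor T S3 S4" "u1 \<in> Mor U X1 X2" "u2 \<in> Mor U X2 X3" "u3 \<in> Mor U X3 X4"
      "m1 \<in> carrier (fobj M (X2, S1))" "m2 \<in> carrier (fobj M (X3, S2))" "m3 \<in> carrier (fobj M (X4, S3))"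
      using * by (simp_all add: e s)
    interpret V: abelian_group "fobj M (X4, S1)" by (rule module.axioms(2)[OF M_module[OF o(8,1)]])
    \<comment> \<open>The lower left entry of the associativity law. The outer terms in
      \<open>m3\<close> and \<open>m1\<close> use functoriality of the two actions, the middle term
      in \<open>m2\<close> uses that they commute.\<close>
    have "ract X4 S1 S3 (Cmp T S1 S2 S3 t2 t1) m3 \<oplus>\<^bsub>fobj M (X4, S1)\<^esub>
        lact X3 X4 S1 u3 (ract X3 S1 S2 t1 m2 \<oplus>\<^bsub>fobj M (X3, S1)\<^esub> lact X2 X3 S1 u2 m1)
      = ract X4 S1 S2 t1 (ract X4 S2 S3 t2 m3 \<oplus>\<^bsub>fobj M (X4, S2)\<^esub> lact X3 X4 S2 u3 m2)
        \<oplus>\<^bsub>fobj M (X4, S1)\<^esub> lact X2 X4 S1 (Cmp U X2 X3 X4 u3 u2) m1"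
      using o m by (simp add: ract_Cmp lact_Cmp lact_add_right ract_add_right lact_ract lact_closed ract_closed V.a_assoc)
    then show "Cmp Lam A E G h (Cmp Lam A B E g f) = Cmp Lam A B G (Cmp Lam B E G h g) f"
      using o m by (simp add: e s T.Cmp_assoc U.Cmp_assoc)
  next
    fix A B E and f f' g g' :: "'q \<times> 'v \<times> 'p" and a
    assume *: "A \<in> Ob Lam" "B \<in> Ob Lam" "E \<in> Ob Lam"
    obtain S1 X1 S2 X2 S3 X3 t m u t' m' u' r n v r' n' v' where
      e: "A = (S1, X1)" "B = (S2, X2)" "E = (S3, X3)" "f = (t, m, u)" "f' = (t', m', u')" "g = (r, n, v)" "g' = (r', n', v')"
      by (metis prod_cases3 surj_pair)
    have o: "S1 \<in> Ob T" "S2 \<in> Ob T" "S3 \<in> Ob T" "X1 \<in> Ob U" "X2 \<in> Ob U" "X3 \<in> Ob U"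
      using * by (simp_all add: e s)
    interpret V: abelian_group "fobj M (X3, S1)" by (rule module.axioms(2)[OF M_module[OF o(6,1)]])
    interpret W: module K "fobj M (X3, S1)" by (rule M_module[OF o(6,1)])
    {
      assume "f \<in> Mor Lam A B" "g \<in> Mor Lam B E" "g' \<in> Mor Lam B E"
      then show "Cmp Lam A B E (g \<oplus>\<^bsub>Hom Lam B E\<^esub> g') f = Cmp Lam A B E g f \<oplus>\<^bsub>Hom Lam A E\<^esub> Cmp Lam A B E g' f"
        using o by (simp add: e s T.Cmp_add_left U.Cmp_add_left ract_add_right lact_add_left lact_closed ract_closed V.a_ac)
    next
      assume "f \<in> Mor Lam A B" "f' \<in> Mor Lam A B" "g \<in> Mor Lam B E"
      then show "Cmp Lam A B E g (f \<oplus>\<^bsub>Hom Lam A B\<^esub> f') = Cmp Lam A B E g f \<oplus>\<^bsub>Hom Lam A E\<^esub> Cmp Lam A B E g f'"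
        using o by (simp add: e s T.Cmp_add_right U.Cmp_add_right ract_add_left lact_add_right lact_closed ract_closed V.a_ac)
    next
      assume "a \<in> carrier K" "f \<in> Mor Lam A B" "g \<in> Mor Lam B E"
      then show "Cmp Lam A B E (a \<odot>\<^bsub>Hom Lam B E\<^esub> g) f = a \<odot>\<^bsub>Hom Lam A E\<^esub> Cmp Lam A B E g f"
        "Cmp Lam A B E g (a \<odot>\<^bsub>Hom Lam A B\<^esub> f) = a \<odot>\<^bsub>Hom Lam A E\<^esub> Cmp Lam A B E g f"
        using o by (simp_all add: e s T.Cmp_smult_left U.Cmp_smult_left ract_smult_right lact_smult_left
            T.Cmp_smult_right U.Cmp_smult_right ract_smult_left lact_smult_right lact_closed ract_closed W.smult_r_distr)
    }
  }
qed

end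

sublocale triangular \<subseteq> Lam: k_category K "tri_cat K U T M"
  by (rule Lam_k_category)

section \<open>The two corners of the triangular matrix category\<close>

locale triangular_zero = triangular K U T M
  for K :: "('k, 'x) ring_scheme" (structure) and U :: "('u, 'p, 'k) kcat" and T :: "('t, 'q, 'k) kcat"
    and M :: "('u, 'p, 't, 'q, 'k, 'v) bifun" +
  fixes Z :: 'u and W :: 't
  assumes Z: "zero_object U Z" and W: "zero_object T W"
begin

lemma ZOb: "Z \<in> Ob U" "W \<in> Ob T"
  using Z W by (simp_all add: U.zero_object_iff T.zero_object_iff)

lemma Idm_ZW: "Idm U Z = \<zero>\<^bsub>Hom U Z Z\<^esub>" "Idm T W = \<zero>\<^bsub>Hom T W W\<^esub>"
  using Z W by (simp_all add: U.zero_object_iff T.zero_object_iff)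

text \<open>With membership in a vanishing hom space rewritten as an equation, the axioms of both
  corners reduce to matrix computations done by simplification.\<close>

lemma zero_iffs:
  "X \<in> Ob U \<Longrightarrow> u \<in> Mor U X Z \<longleftrightarrow> u = \<zero>\<^bsub>Hom U X Z\<^esub>"
  "X \<in> Ob U \<Longrightarrow> u \<in> Mor U Z X \<longleftrightarrow> u = \<zero>\<^bsub>Hom U Z X\<^esub>"
  "S \<in> Ob T \<Longrightarrow> t \<in> Mor T S W \<longleftrightarrow> t = \<zero>\<^bsub>Hom T S W\<^esub>"
  "S \<in> Ob T \<Longrightarrow> t \<in> Mor T W S \<longleftrightarrow> t = \<zero>\<^bsub>Hom T W S\<^esub>"
  "S \<in> Ob T \<Longrightarrow> m \<in> carrier (fobj M (Z, S)) \<longleftrightarrow> m = \<zero>\<^bsub>fobj M (Z, S)\<^esub>"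
  "X \<in> Ob U \<Longrightarrow> m \<in> carrier (fobj M (X, W)) \<longleftrightarrow> m = \<zero>\<^bsub>fobj M (X, W)\<^esub>"
  using U.zero_object_Mor[OF Z] T.zero_object_Mor[OF W] M_zero_left[OF Z] M_zero_right[OF _ W] by simp_all

lemmas zero_simps = ZOb Idm_ZW zero_iffs Lam_simps
  U.Hom_zero_closed T.Hom_zero_closed M_zero_closed U.Hom_l_zero T.Hom_l_zero M_l_zero
  U.Hom_r_zero T.Hom_r_zero M_r_zero
  U.Cmp_zero_left U.Cmp_zero_right T.Cmp_zero_left T.Cmp_zero_right
  U.Cmp_Idm_left U.Cmp_Idm_right T.Cmp_Idm_left T.Cmp_Idm_right U.Idm_closed T.Idm_closed
  lact_zero_left lact_zero_right ract_zero_left ract_zero_right lact_Idm ract_Idm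

abbreviation "incT \<equiv> \<lambda>(S, X). (Idm T S, \<zero>\<^bsub>fobj M (X, S)\<^esub>, \<zero>\<^bsub>Hom U Z X\<^esub>)"
abbreviation "prjT \<equiv> \<lambda>(S, X). (Idm T S, \<zero>\<^bsub>fobj M (Z, S)\<^esub>, \<zero>\<^bsub>Hom U X Z\<^esub>)"
abbreviation "incU \<equiv> \<lambda>(S, X). (\<zero>\<^bsub>Hom T W S\<^esub>, \<zero>\<^bsub>fobj M (X, W)\<^esub>, Idm U X)"
abbreviation "prjU \<equiv> \<lambda>(S, X). (\<zero>\<^bsub>Hom T S W\<^esub>, \<zero>\<^bsub>fobj M (X, S)\<^esub>, Idm U X)"
abbreviation "arT \<equiv> \<lambda>S S' t. (t, \<zero>\<^bsub>fobj M (Z, S)\<^esub>, \<zero>\<^bsub>Hom U Z Z\<^esub>)"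
abbreviation "arU \<equiv> \<lambda>X X' u. (\<zero>\<^bsub>Hom T W W\<^esub>, \<zero>\<^bsub>fobj M (X', W)\<^esub>, u)"

lemma T_corner: "corner K Lam T (\<lambda>S. (S, Z)) arT fst fst
  incT prjT"
  by (intro corner.intro corner_axioms.intro Lam.k_category_axioms T.k_category_axioms)
    (auto simp: zero_simps)

lemma U_corner: "corner K Lam U (\<lambda>X. (W, X)) arU (\<lambda>h. snd (snd h)) snd
  incU prjU"
  by (intro corner.intro corner_axioms.intro Lam.k_category_axioms U.k_category_axioms)
    (auto simp: zero_simps)

end

sublocale triangular_zero \<subseteq> TC: corner K "tri_cat K U T M" T "\<lambda>S. (S, Z)"
    "arT" fst fst
    "incT"
    "prjT"
  by (rule T_corner)

sublocale triangular_zero \<subseteq> UC: corner K "tri_cat K U T M" U "\<lambda>X. (W, X)"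
    "arU" "\<lambda>h. snd (snd h)" snd
    "incU"
    "prjU"
  by (rule U_corner)

context triangular_zero
begin

lemma corner_idems:
  assumes "S \<in> Ob T" "X \<in> Ob U"
  shows "TC.corner_idem (S, X) = (Idm T S, \<zero>\<^bsub>fobj M (X, S)\<^esub>, \<zero>\<^bsub>Hom U X X\<^esub>)"
    and "UC.corner_idem (S, X) = (\<zero>\<^bsub>Hom T S S\<^esub>, \<zero>\<^bsub>fobj M (X, S)\<^esub>, Idm U X)"
  using assms by (simp_all add: TC.corner_idem_def UC.corner_idem_def zero_simps)

lemma corner_idem_sum:
  "A \<in> Ob Lam \<Longrightarrow> TC.corner_idem A \<oplus>\<^bsub>Hom Lam A A\<^esub> UC.corner_idem A = Idm Lam A"
  by (cases A) (simp add: corner_idems zero_simps)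

text \<open>The entries of a morphism to \<open>(S', Z)\<close> in \<open>M\<close> and
  \<open>U\<close> vanish, and these are the ones that the idempotent removes.\<close>

lemma TC_cosupported: "A \<in> Ob Lam \<Longrightarrow> TC.cosupported A"
  by (cases A) (auto simp: TC.cosupported_def corner_idems zero_simps)

text \<open>Composition with the idempotent kills the entry of a morphism in M(Y, S); for zero
  \<open>S\<close> there is nothing to kill.\<close>

lemma UC_cosupported: "zero_object T S \<Longrightarrow> X \<in> Ob U \<Longrightarrow> UC.cosupported (S, X)"
  by (auto simp: UC.cosupported_def corner_idems zero_simps T.zero_object_iff M_zero_right)

lemma zero_object_Lam:
  "zero_object Lam (S, X) \<longleftrightarrow> zero_object T S \<and> zero_object U X"
  by (auto simp: Lam.zero_object_iff T.zero_object_iff U.zero_object_iff Lam_simps)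

text \<open>The idempotents are complementary, so an element at \<open>A\<close> is composed of its
  parts from the two corners.\<close>

lemma act_corner_idems:
  assumes F: "F \<in> Modules Lam" and A: "A \<in> Ob Lam" and x: "x \<in> carrier (val F A)"
  shows "act F A A (TC.corner_idem A) x \<otimes>\<^bsub>val F A\<^esub> act F A A (UC.corner_idem A) x = x"
  using Modules_act_add[OF F A A TC.corner_idem_closed[OF A] UC.corner_idem_closed[OF A] x]
  unfolding corner_idem_sum[OF A] Modules_act_Idm[OF F A x] by (rule sym)

end

section \<open>Standard modules of the triangular matrix category\<close>

lemma quasi_hereditaryD:
  assumes "quasi_hereditary C J B"
  shows quasi_hereditary_mono: "\<forall>j. Suc j \<in> J \<longrightarrow> B j \<subseteq> B (Suc j)"
    and quasi_hereditary_exhaustive: "(\<Union>j\<in>J. B j) = Ob C"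
    and quasi_hereditary_ideal_0: "\<forall>X\<in>Ob C. \<forall>Y\<in>Ob C. ideal_through C (B 0) X Y = {\<zero>\<^bsub>Hom C X Y\<^esub>}"
proof -
  note qh = assms[unfolded quasi_hereditary_def exhaustive_filtration_def]
  note fil = conjunct2[OF conjunct1[OF qh]]
  show "\<forall>j. Suc j \<in> J \<longrightarrow> B j \<subseteq> B (Suc j)" by (rule conjunct1[OF fil])
  show "(\<Union>j\<in>J. B j) = Ob C" by (rule conjunct2[OF fil])
qed (rule conjunct1[OF conjunct2[OF assms[unfolded quasi_hereditary_def]]])

text \<open>The identity of \<open>X\<close> factors through \<open>X\<close> and thus lies in the
  ideal belonging to \<open>B 0\<close>, which is zero.\<close>

lemma (in k_category) quasi_hereditary_zero_objects:
  assumes qh: "quasi_hereditary C J B" and "0 \<in> J" and X: "X \<in> B 0"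
  shows "zero_object C X"
proof -
  note I = quasi_hereditary_ideal_0[OF qh]
  have X': "X \<in> Ob C"
    using X assms(2) unfolding quasi_hereditary_exhaustive[OF qh, symmetric] by (rule UN_I[rotated])
  have "Idm C X \<in> ideal_through C (B 0) X X"
    by (rule ideal_throughI[OF X Idm_closed[OF X'] Idm_closed[OF X'] Cmp_Idm_left[OF X' X' Idm_closed[OF X'], symmetric]])
  then show ?thesis using bspec[OF bspec[OF I X'] X'] X' by (simp add: zero_object_iff)
qed

lemma standardE:
  assumes "D \<in> standard C B i"
  obtains A where "A \<in> Ind C (B i) - Ind C (B (i - 1))" "D = quot_Mod (rep C A) (ideal_through C (B (i - 1)) A)"
  using assms unfolding standard_def by blast

lemma standardI:
  "A \<in> Ind C (B i) - Ind C (B (i - 1)) \<Longrightarrow> quot_Mod (rep C A) (ideal_through C (B (i - 1)) A) \<in> standard C B i"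
  unfolding standard_def by blast

text \<open>The conditions on \<open>Uf\<close> stop at \<open>n\<close>, where this filtration
  ends; by \<open>Uf_n\<close> it is exhausted there, on which the cut-off \<open>min j n\<close>
  below relies.\<close>

locale triangular_filtered = triangular_zero K U T M Z W
  for K :: "('k, 'x) ring_scheme" (structure) and U :: "('u, 'p, 'k) kcat" and T :: "('t, 'q, 'k) kcat"
    and M :: "('u, 'p, 't, 'q, 'k, 'v) bifun" and Z :: 'u and W :: 't +
  fixes n :: nat and Uf :: "nat \<Rightarrow> 'u set" and Tf :: "nat \<Rightarrow> 't set"
  assumes Uf_closed: "j \<le> n \<Longrightarrow> additively_closed U (Uf j)" and Tf_closed: "additively_closed T (Tf j)"
    and Uf_0: "X \<in> Uf 0 \<Longrightarrow> zero_object U X" and Tf_0: "S \<in> Tf 0 \<Longrightarrow> zero_object T S"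
    and Uf_mono: "j < n \<Longrightarrow> Uf j \<subseteq> Uf (Suc j)" and Tf_mono: "Tf j \<subseteq> Tf (Suc j)"
    and Uf_n: "Uf n = Ob U"
begin

abbreviation "Lf \<equiv> tri_filt K U T M n Uf Tf"

lemma Uf_sum_closed: "j \<le> n \<Longrightarrow> sum_closed U (Uf j)"
  by (rule U.additive_subcat_sum_closed[OF U.additively_closed_subcat[OF Uf_closed]])

lemma Tf_sum_closed: "sum_closed T (Tf j)"
  by (rule T.additive_subcat_sum_closed[OF T.additively_closed_subcat[OF Tf_closed]])

lemma Uf_subset: "j \<le> n \<Longrightarrow> Uf j \<subseteq> Ob U"
  by (rule subsetI) (rule U.sum_closed_subset[OF Uf_sum_closed])

lemma Tf_subset: "Tf j \<subseteq> Ob T"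
  by (rule subsetI) (rule T.sum_closed_subset[OF Tf_sum_closed])

lemma zero_in_Uf: "j \<le> n \<Longrightarrow> zero_object U X \<Longrightarrow> X \<in> Uf j"
  by (rule U.additively_closed_zero_object[OF Uf_closed])

lemma zero_in_Tf: "zero_object T S \<Longrightarrow> S \<in> Tf j"
  by (rule T.additively_closed_zero_object[OF Tf_closed])

lemma Tf_0_iff: "S \<in> Tf 0 \<longleftrightarrow> zero_object T S"
  using zero_in_Tf Tf_0 by blast

lemma Uf_0_iff: "X \<in> Uf 0 \<longleftrightarrow> zero_object U X"
  using zero_in_Uf[of 0] Uf_0 by blast

text \<open>Truncated subtraction gives \<open>Tf 0\<close>, the zero objects of \<open>T\<close>,
  as long as \<open>j \<le> n\<close>, and from \<open>n\<close> on the second factor is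
  \<open>Ob U\<close>. At \<open>j = 0\<close> the product consists of the zero objects of the
  matrix category.\<close>

lemma Lf_eq: "Lf j = Tf (j - n) \<times> Uf (min j n)"
proof (cases "j = 0")
  case True
  then show ?thesis by (auto simp: tri_filt_def zero_object_Lam Tf_0_iff Uf_0_iff)
next
  case False
  then show ?thesis by (auto simp: tri_filt_def Tf_0_iff Uf_n)
qed

lemma Lf_subset: "Lf j \<subseteq> Ob Lam"
  unfolding Lf_eq Lam_simps using Tf_subset Uf_subset[of "min j n"] by fastforce

lemma Lf_pred_subset: "Lf (j - 1) \<subseteq> Lf j"
proof (cases j)
  case (Suc i)
  have "Tf (i - n) \<subseteq> Tf (Suc i - n)" using Tf_mono[of "i - n"] by (cases "n \<le> i") (simp_all add: Suc_diff_le)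
  moreover have "Uf (min i n) \<subseteq> Uf (min (Suc i) n)" using Uf_mono[of i] by (cases "i < n") (simp_all add: min_def)
  ultimately show ?thesis unfolding Lf_eq Suc diff_Suc_1 by (rule Sigma_mono)
qed simp

lemma Lf_sum_closed: "sum_closed Lam (Lf j)"
proof -
  note T = Tf_sum_closed[of "j - n"] and U = Uf_sum_closed[of "min j n", OF min.cobounded2]
  have "\<exists>A\<in>Lf j. zero_object Lam A"
    using T.sum_closed_zero_object[OF T] U.sum_closed_zero_object[OF U] unfolding Lf_eq
    by (auto simp: zero_object_Lam)
  moreover have "\<exists>E\<in>Lf j. direct_sum Lam [A, B] E" if AB: "A \<in> Lf j" "B \<in> Lf j" for A B
  proof -
    obtain S X R Y where e: "A = (S, X)" "B = (R, Y)" and SX: "S \<in> Tf (j - n)" "R \<in> Tf (j - n)"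
      "X \<in> Uf (min j n)" "Y \<in> Uf (min j n)"
      using AB unfolding Lf_eq by (elim SigmaE)
    obtain Q V where Q: "Q \<in> Tf (j - n)" "direct_sum T [S, R] Q" and V: "V \<in> Uf (min j n)" "direct_sum U [X, Y] V"
      using T.sum_closed_direct_sum[OF T SX(1,2)] U.sum_closed_direct_sum[OF U SX(3,4)] by (elim bexE)
    from Q(2) obtain i p i' p' where "biproduct T S R Q i p i' p'" by (rule T.direct_sum_pairE)
    note Tds = biproductD[OF this]
    from V(2) obtain k q k' q' where "biproduct U X Y V k q k' q'" by (rule U.direct_sum_pairE)
    note Uds = biproductD[OF this]
    have "direct_sum Lam [(S, X), (R, Y)] (Q, V)"
      by (rule Lam.direct_sum_pairI[where i = "(i, \<zero>\<^bsub>fobj M (V, S)\<^esub>, k)" and p = "(p, \<zero>\<^bsub>fobj M (X, Q)\<^esub>, q)"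
            and j = "(i', \<zero>\<^bsub>fobj M (V, R)\<^esub>, k')" and q = "(p', \<zero>\<^bsub>fobj M (Y, Q)\<^esub>, q')"])
        (simp_all add: Tds Uds Lam_simps M_zero_closed ract_zero_right lact_zero_right M_l_zero)
    then show ?thesis using Q(1) V(1) unfolding e Lf_eq by blast
  qed
  ultimately show ?thesis unfolding sum_closed_def using Lf_subset by (intro conjI ballI)
qed

lemma TC_compatible: "TC.compatible (Lf j) (Tf (j - n))"
  unfolding TC.compatible_def
  using Lf_subset[of j] Tf_subset[of "j - n"] zero_in_Uf[of "min j n", OF _ Z] TC_cosupported
  by (auto simp: Lf_eq)

text \<open>Limited to \<open>j \<le> n\<close>, where all \<open>T\<close>-entries in
  \<open>Lf j\<close> are zero objects; otherwise cosupport over \<open>U\<close> could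
  fail.\<close>

lemma UC_compatible: "j \<le> n \<Longrightarrow> UC.compatible (Lf j) (Uf j)"
  unfolding UC.compatible_def
  using Lf_subset[of j] Uf_subset[of j] W UC_cosupported
  by (auto simp: Lf_eq min_def Tf_0_iff)

lemma standard_Lam_Modules: "D \<in> standard Lam Lf i \<Longrightarrow> D \<in> Modules Lam"
  by (rule Lam.standard_Modules[OF _ Lf_sum_closed Lf_subset])

lemma trivial_standard:
  assumes A: "A \<in> Ob Lam" and B: "B \<in> Ob Lam"
    and sub: "Mor Lam A B \<subseteq> ideal_through Lam (Lf i) A B"
  shows "trivial (val (quot_Mod (rep Lam A) (ideal_through Lam (Lf i) A)) B)"
proof (rule quot_Mod_trivial[OF Lam.rep_Modules[OF A] Lam.ideal_through_submodule[OF Lf_sum_closed A] B])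
  show "ideal_through Lam (Lf i) A B = carrier (val (rep Lam A) B)"
    using sub submodule_subset[OF Lam.ideal_through_submodule[OF Lf_sum_closed A] B] by auto
qed

text \<open>\<open>D\<close> comes from an indecomposable \<open>(S0, X)\<close> with
  \<open>S0\<close> zero. Its \<open>U\<close>-idempotent is the identity, so it is isomorphic to
  its retract, and it has no nonzero morphism to any \<open>(S, Z)\<close>.\<close>

lemma standard_low:
  assumes i: "1 \<le> i" "i \<le> n" and D: "D \<in> standard Lam Lf i"
  shows "\<exists>E\<in>standard U Uf i. Mod_iso U (UC.pull D) E"
    and "S \<in> Ob T \<Longrightarrow> trivial (val D (S, Z))"
proof -
  from D obtain A where A: "A \<in> Ind Lam (Lf i) - Ind Lam (Lf (i - 1))"
    and De: "D = quot_Mod (rep Lam A) (ideal_through Lam (Lf (i - 1)) A)" by (rule standardE)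
  obtain S0 X where AX: "A = (S0, X)" by (cases A)
  have "A \<in> Lf i" using DiffD1[OF A] unfolding Lam.Ind_iff[OF Lf_subset] by simp
  then have S0: "zero_object T S0" and X: "X \<in> Uf i" using i by (simp_all add: AX Lf_eq min_def Tf_0_iff)
  have o: "S0 \<in> Ob T" "X \<in> Ob U" "A \<in> Ob Lam"
    using S0 X Uf_subset[OF i(2)] by (auto simp: T.zero_object_iff AX Lam_simps)
  have im: "i - 1 \<le> n" using i by simp
  have idem: "UC.corner_idem A = Idm Lam A"
    using S0 o by (simp add: AX corner_idems zero_simps T.zero_object_iff)
  have "snd A \<in> Ind U (Uf i) - Ind U (Uf (i - 1))"
  proof (rule UC.pi_Ind_diff[OF UC_compatible[OF i(2)] Lf_pred_subset Uf_subset[OF im] A idem])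
    assume "snd A \<in> Uf (i - 1)"
    then have "A \<in> Lf (i - 1)" using S0 im by (simp add: AX Lf_eq min_def Tf_0_iff zero_in_Tf)
    then show "zero_object U (snd A) \<or> A \<in> Lf (i - 1)" by simp
  qed
  then have "quot_Mod (rep U (snd A)) (ideal_through U (Uf (i - 1)) (snd A)) \<in> standard U Uf i"
    by (rule standardI)
  moreover have "Mod_iso U (UC.pull D) (quot_Mod (rep U (snd A)) (ideal_through U (Uf (i - 1)) (snd A)))"
    unfolding De by (rule UC.pull_standard[OF o(3) _ UC_compatible[OF im]])
      (use UC_cosupported[OF S0 o(2)] in \<open>simp add: AX\<close>)
  ultimately show "\<exists>E\<in>standard U Uf i. Mod_iso U (UC.pull D) E" by (rule rev_bexI)
  assume S: "S \<in> Ob T"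
  then have SZ: "(S, Z) \<in> Ob Lam" by (simp add: zero_simps)
  have "\<zero>\<^bsub>Hom Lam A (S, Z)\<^esub> \<in> ideal_through Lam (Lf (i - 1)) A (S, Z)"
    using subgroup.one_closed[OF submodule_subgroup[OF Lam.ideal_through_submodule[OF Lf_sum_closed o(3)] SZ]] by simp
  moreover have "Mor Lam A (S, Z) \<subseteq> {\<zero>\<^bsub>Hom Lam A (S, Z)\<^esub>}"
    using S o T.zero_object_Mor(2)[OF S0 S] by (auto simp: AX zero_simps)
  ultimately show "trivial (val D (S, Z))"
    unfolding De by (intro trivial_standard[OF o(3) SZ]) blast
qed

text \<open>An indecomposable \<open>(S, Y)\<close> at this level is the sum of
  \<open>(S, Z)\<close> and \<open>(W, Y)\<close>. It lies outside the previous term, so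
  \<open>S\<close> is not zero and \<open>Y\<close> has to be: up to isomorphism it is an object of
  the \<open>T\<close>-corner.\<close>

lemma standard_high:
  assumes j: "1 \<le> j" and D: "D \<in> standard Lam Lf (n + j)"
  shows "\<exists>E\<in>standard T Tf j. Mod_iso T (TC.pull D) E"
    and "X \<in> Ob U \<Longrightarrow> trivial (val D (W, X))"
proof -
  \<comment> \<open>The preceding index. As \<open>j\<close> is positive, \<open>k\<close> is at
    least \<open>n\<close>, so the second factor of \<open>Lf k\<close> is still
    \<open>Ob U\<close>, even for \<open>j = 1\<close>, where the first factor is
    \<open>Tf 0\<close>.\<close>
  define k where "k = n + j - 1"
  have k: "k - n = j - 1" "min k n = n" "n + j - n = j" "min (n + j) n = n" using j by (simp_all add: k_def)
  have Lfj: "Lf (n + j) = Tf j \<times> Ob U" and Lfk: "Lf k = Tf (j - 1) \<times> Ob U"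
    by (simp_all only: Lf_eq k Uf_n)
  have Lfk_sub: "Lf k \<subseteq> Lf (n + j)" unfolding k_def by (rule Lf_pred_subset)
  from D obtain A where A: "A \<in> Ind Lam (Lf (n + j)) - Ind Lam (Lf k)"
    and De: "D = quot_Mod (rep Lam A) (ideal_through Lam (Lf k) A)" unfolding k_def by (rule standardE)
  obtain S Y where AX: "A = (S, Y)" by (cases A)
  have A': "A \<in> Lf (n + j)" "\<And>B E. B \<in> Lf (n + j) \<Longrightarrow> E \<in> Lf (n + j) \<Longrightarrow> direct_sum Lam [B, E] A \<Longrightarrow>
      zero_object Lam B \<or> zero_object Lam E"
    using DiffD1[OF A] unfolding Lam.Ind_iff[OF Lf_subset] by simp_all
  have S: "S \<in> Tf j" "S \<in> Ob T" and Y: "Y \<in> Ob U" and AO: "A \<in> Ob Lam"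
    using A'(1) Tf_subset[of j] by (auto simp: AX Lfj Lfk Lam_simps)
  have not: "A \<notin> Lf k"
    using Lam.Ind_mono[OF DiffD1[OF A] Lfk_sub Lf_subset] DiffD2[OF A] by blast
  have "direct_sum Lam [(S, Z), (W, Y)] A"
    unfolding AX
    by (rule Lam.direct_sum_pairI[where i = "(Idm T S, \<zero>\<^bsub>fobj M (Y, S)\<^esub>, \<zero>\<^bsub>Hom U Z Y\<^esub>)"
          and p = "(Idm T S, \<zero>\<^bsub>fobj M (Z, S)\<^esub>, \<zero>\<^bsub>Hom U Y Z\<^esub>)"
          and j = "(\<zero>\<^bsub>Hom T W S\<^esub>, \<zero>\<^bsub>fobj M (Y, W)\<^esub>, Idm U Y)"
          and q = "(\<zero>\<^bsub>Hom T S W\<^esub>, \<zero>\<^bsub>fobj M (Y, S)\<^esub>, Idm U Y)"])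
      (simp_all add: S Y zero_simps)
  \<comment> \<open>Relative indecomposability applies because both summands belong to
    \<open>Lf (n + j)\<close>.\<close>
  then have "zero_object Lam (S, Z) \<or> zero_object Lam (W, Y)"
    using S Y Z W zero_in_Tf[of W j] by (intro A'(2)) (simp_all add: Lfj Lfk zero_simps)
  moreover have "\<not> zero_object T S"
    using not zero_in_Tf[of S "j - 1"] Y unfolding AX Lfk by blast
  ultimately have Y0: "zero_object U Y" by (simp add: zero_object_Lam)
  have idem: "TC.corner_idem A = Idm Lam A"
    using Y0 S by (simp add: AX corner_idems zero_simps U.zero_object_iff)
  have comp: "TC.compatible (Lf (n + j)) (Tf j)" "TC.compatible (Lf k) (Tf (j - 1))"
    using TC_compatible[of "n + j"] TC_compatible[of k] by (simp_all only: k)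
  have "fst A \<in> Ind T (Tf j) - Ind T (Tf (j - 1))"
  proof (rule TC.pi_Ind_diff[OF comp(1) Lfk_sub Tf_subset A idem])
    assume "fst A \<in> Tf (j - 1)"
    then have "A \<in> Lf k" using Y by (simp add: AX Lfj Lfk)
    then show "zero_object T (fst A) \<or> A \<in> Lf k" by simp
  qed
  then have "quot_Mod (rep T (fst A)) (ideal_through T (Tf (j - 1)) (fst A)) \<in> standard T Tf j"
    by (rule standardI)
  moreover have "Mod_iso T (TC.pull D) (quot_Mod (rep T (fst A)) (ideal_through T (Tf (j - 1)) (fst A)))"
    unfolding De by (rule TC.pull_standard[OF AO TC_cosupported[OF AO] comp(2)])
  ultimately show "\<exists>E\<in>standard T Tf j. Mod_iso T (TC.pull D) E" by (rule rev_bexI)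
  assume X: "X \<in> Ob U"
  then have WX: "(W, X) \<in> Ob Lam" "(W, X) \<in> Lf k"
    using zero_in_Tf[OF W] by (simp_all add: zero_simps Lfj Lfk)
  \<comment> \<open>The target \<open>(W, X)\<close> already belongs to \<open>Lf k\<close>, so
    \<open>f\<close> factors through it by way of the identity.\<close>
  have "f \<in> ideal_through Lam (Lf k) A (W, X)" if "f \<in> Mor Lam A (W, X)" for f
    using ideal_throughI[OF WX(2) that Lam.Idm_closed[OF WX(1)] refl] Lam.Cmp_Idm_left[OF AO WX(1) that] by simp
  then show "trivial (val D (W, X))"
    unfolding De by (intro trivial_standard[OF AO WX(1)] subsetI)
qed

text \<open>The lift is the standard module of the embedded object, which stays indecomposable in
  its filtration term and outside the previous one by \<open>ob_Ind_diff\<close>.\<close>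

lemma standard_U_lift:
  assumes i: "1 \<le> i" "i \<le> n" and E: "E \<in> standard U Uf i"
  shows "\<exists>D\<in>standard Lam Lf i. Mod_iso U (UC.pull D) E"
proof -
  from E obtain X where X: "X \<in> Ind U (Uf i) - Ind U (Uf (i - 1))"
    and Ee: "E = quot_Mod (rep U X) (ideal_through U (Uf (i - 1)) X)" by (rule standardE)
  have im: "i - 1 \<le> n" using i by simp
  have XO: "X \<in> Ob U" using DiffD1[OF X] Uf_subset[OF i(2)] unfolding U.Ind_iff[OF Uf_subset[OF i(2)]] by (elim conjE) (rule subsetD)
  then have WX: "(W, X) \<in> Ob Lam" by (simp add: zero_simps)
  have "Uf (i - 1) \<subseteq> Uf i" using Uf_mono[of "i - 1"] i by simp
  then have "(W, X) \<in> Ind Lam (Lf i) - Ind Lam (Lf (i - 1))"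
    by (rule UC.ob_Ind_diff[OF UC_compatible[OF i(2)] UC_compatible[OF im] _ X])
  from standardI[where B = Lf, OF this] show ?thesis
    using UC.pull_standard[OF WX UC_cosupported[OF W XO] UC_compatible[OF im]] unfolding Ee snd_conv by (rule rev_bexI)
qed

lemma standard_T_lift:
  assumes j: "1 \<le> j" and E: "E \<in> standard T Tf j"
  shows "\<exists>D\<in>standard Lam Lf (n + j). Mod_iso T (TC.pull D) E"
proof -
  from E obtain S where S: "S \<in> Ind T (Tf j) - Ind T (Tf (j - 1))"
    and Ee: "E = quot_Mod (rep T S) (ideal_through T (Tf (j - 1)) S)" by (rule standardE)
  have nj: "n + j - 1 - n = j - 1" "n + j - n = j" using j by simp_all
  have comp: "TC.compatible (Lf (n + j)) (Tf j)" "TC.compatible (Lf (n + j - 1)) (Tf (j - 1))"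
    using TC_compatible[of "n + j"] TC_compatible[of "n + j - 1"] by (simp_all only: nj)
  have SO: "S \<in> Ob T" using DiffD1[OF S] Tf_subset unfolding T.Ind_iff[OF Tf_subset] by (elim conjE) (rule subsetD)
  then have SZ: "(S, Z) \<in> Ob Lam" by (simp add: zero_simps)
  have "Tf (j - 1) \<subseteq> Tf j" using Tf_mono[of "j - 1"] j by simp
  then have "(S, Z) \<in> Ind Lam (Lf (n + j)) - Ind Lam (Lf (n + j - 1))"
    by (rule TC.ob_Ind_diff[OF comp _ S])
  from standardI[where B = Lf, OF this] show ?thesis
    using TC.pull_standard[OF SZ TC_cosupported[OF SZ] comp(2)] unfolding Ee fst_conv by (rule rev_bexI)
qed

end

section \<open>Filtered modules\<close>

lemma filtE:
  assumes "F \<in> filt C I B" "i \<in> I" "1 \<le> i"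
  obtains Ds where "set Ds \<subseteq> standard C B i"
    "Mod_iso C (trace_layer C B F i (i - 1)) (dsum_Mod Ds)"
proof -
  have "\<forall>j\<in>I. j \<ge> 1 \<longrightarrow> (\<exists>Ds. set Ds \<subseteq> standard C B j \<and>
       Mod_iso C (trace_layer C B F j (j - 1)) (dsum_Mod Ds))"
    using assms(1) unfolding filt_def mem_Collect_eq by (rule conjunct2)
  from bspec[OF this assms(2), THEN mp, OF assms(3)] show thesis using that by (elim exE conjE)
qed

lemma subgroup_preimages:
  assumes G: "group G" and h: "h \<in> hom G H" "group H" "subgroup P H" and k: "k \<in> hom G H'" "group H'" "subgroup Q H'"
  shows "subgroup {x \<in> carrier G. h x \<in> P \<and> k x \<in> Q} G"
proof -
  interpret h: group_hom G H h using G h by (simp add: group_hom_def group_hom_axioms_def)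
  interpret k: group_hom G H' k using G k by (simp add: group_hom_def group_hom_axioms_def)
  interpret P: subgroup P H by (rule h(3))
  interpret Q: subgroup Q H' by (rule k(3))
  show ?thesis
    by (rule h.G.subgroupI) (auto intro!: exI[of _ "\<one>\<^bsub>G\<^esub>"])
qed

context triangular_filtered
begin

text \<open>Here \<open>j - n\<close> is 0, so on the \<open>T\<close>-corner this is a trace of the
  zero objects in \<open>Tf 0\<close>.\<close>

lemma trace_Mod_low_T:
  assumes F: "F \<in> Modules Lam" and j: "j \<le> n"
  shows "Mod_iso T (TC.pull (trace_Mod Lam Lf F j)) zero_Mod"
proof (rule Mod_isoI[where \<eta> = "\<lambda>S x. ()"])
  fix S assume S: "S \<in> Ob T"
  have comp: "TC.compatible (Lf j) (Tf 0)" using TC_compatible[of j] j by simp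
  have "trace_filt Lam Lf F j (S, Z) = trace_filt T Tf (TC.pull F) 0 S"
    by (rule TC.trace_filt_pull[where B' = Lf and B = Tf, OF F comp S])
  also have "\<dots> = {\<one>\<^bsub>val F (S, Z)\<^esub>}"
    using T.trace_filt_zero_objects[where B = Tf and j = 0, OF TC.pull_Modules[OF F] Tf_0 S] by simp
  finally show "(\<lambda>x. ()) \<in> iso (val (TC.pull (trace_Mod Lam Lf F j)) S) (val zero_Mod S)"
    by (simp add: trace_Mod_def zero_Mod_def singleton_group_def iso_def hom_def bij_betw_def)
qed (simp add: zero_Mod_def)

text \<open>Every \<open>(W, X)\<close> is itself an object of \<open>Lf j\<close>, so the trace at
  it is everything.\<close>

lemma trace_Mod_high_U:
  assumes F: "F \<in> Modules Lam" and j: "n < j"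
  shows "Mod_iso U (UC.pull (trace_Mod Lam Lf F j)) (UC.pull F)"
proof (rule Mod_iso_cong)
  fix X assume "X \<in> Ob U"
  then have "(W, X) \<in> Lf j" using j zero_in_Tf[OF W] by (simp add: Lf_eq Uf_n)
  then have "trace_filt Lam Lf F j (W, X) = carrier (val F (W, X))"
    by (rule Lam.trace_filt_full[where B = Lf, OF F Lf_subset])
  then show "val (UC.pull (trace_Mod Lam Lf F j)) X = val (UC.pull F) X"
    by (simp add: trace_Mod_def)
qed (simp add: trace_Mod_def)

text \<open>Layer \<open>j\<close> over \<open>T\<close> is the restriction of layer
  \<open>n + j\<close>, whose summands restrict to standard modules of index
  \<open>j\<close>.\<close>

lemma filt_T:
  assumes Ff: "F \<in> filt Lam UNIV Lf"
  shows "TC.pull F \<in> filt T UNIV Tf"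
proof -
  have F: "F \<in> Modules Lam" using Ff unfolding filt_def mem_Collect_eq by (rule conjunct1)
  have "\<exists>Ds. set Ds \<subseteq> standard T Tf j \<and>
       Mod_iso T (trace_layer T Tf (TC.pull F) j (j - 1)) (dsum_Mod Ds)"
    if j: "1 \<le> j" for j
  proof -
    have nj: "1 \<le> n + j" using j by simp
    obtain Ds where Ds: "set Ds \<subseteq> standard Lam Lf (n + j)"
      "Mod_iso Lam (trace_layer Lam Lf F (n + j) (n + j - 1)) (dsum_Mod Ds)"
      by (rule filtE[OF Ff UNIV_I nj])
    note D = subsetD[OF Ds(1)]
    have "\<exists>Es. set Es \<subseteq> standard T Tf j \<and>
      Mod_iso T (TC.pull (trace_layer Lam Lf F (n + j) (n + j - 1))) (dsum_Mod Es)"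
      by (rule TC.Mod_iso_pull_dsum[OF Ds(2) standard_Lam_Modules[OF D] disjI2[OF standard_high(1)[OF j D]]])
    then obtain Es where Es: "set Es \<subseteq> standard T Tf j"
      "Mod_iso T (TC.pull (trace_layer Lam Lf F (n + j) (n + j - 1))) (dsum_Mod Es)"
      by (elim exE conjE)
    have "n + j - n = j" "n + j - 1 - n = j - 1" using j by simp_all
    then have "TC.compatible (Lf (n + j)) (Tf j)" "TC.compatible (Lf (n + j - 1)) (Tf (j - 1))"
      using TC_compatible[of "n + j"] TC_compatible[of "n + j - 1"] by (simp_all only:)
    from Mod_iso_trans[OF TC.trace_quot_pull[where B' = Lf and B = Tf, OF F this] Es(2)] Es(1)
    show ?thesis by (intro exI conjI)
  qed
  then show ?thesis
    unfolding filt_def mem_Collect_eq using TC.pull_Modules[OF F] by (intro conjI ballI impI)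
qed

lemma filt_U:
  assumes Ff: "F \<in> filt Lam UNIV Lf"
  shows "UC.pull F \<in> filt U {..n} Uf"
proof -
  have F: "F \<in> Modules Lam" using Ff unfolding filt_def mem_Collect_eq by (rule conjunct1)
  have "\<exists>Ds. set Ds \<subseteq> standard U Uf j \<and>
       Mod_iso U (trace_layer U Uf (UC.pull F) j (j - 1)) (dsum_Mod Ds)"
    if "j \<in> {..n}" and j: "1 \<le> j" for j
  proof -
    have j': "j \<le> n" "j - 1 \<le> n" using that by simp_all
    obtain Ds where Ds: "set Ds \<subseteq> standard Lam Lf j"
      "Mod_iso Lam (trace_layer Lam Lf F j (j - 1)) (dsum_Mod Ds)"
      by (rule filtE[OF Ff UNIV_I j])
    note D = subsetD[OF Ds(1)]
    have "\<exists>Es. set Es \<subseteq> standard U Uf j \<and>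
      Mod_iso U (UC.pull (trace_layer Lam Lf F j (j - 1))) (dsum_Mod Es)"
      by (rule UC.Mod_iso_pull_dsum[OF Ds(2) standard_Lam_Modules[OF D] disjI2[OF standard_low(1)[OF j j'(1) D]]])
    then obtain Es where Es: "set Es \<subseteq> standard U Uf j"
      "Mod_iso U (UC.pull (trace_layer Lam Lf F j (j - 1))) (dsum_Mod Es)"
      by (elim exE conjE)
    from Mod_iso_trans[OF UC.trace_quot_pull[where B' = Lf and B = Uf, OF F UC_compatible[OF j'(1)] UC_compatible[OF j'(2)]] Es(2)] Es(1)
    show ?thesis by (intro exI conjI)
  qed
  then show ?thesis
    unfolding filt_def mem_Collect_eq using UC.pull_Modules[OF F] by (intro conjI ballI impI)
qed

lemma high_index: "\<not> i \<le> n \<Longrightarrow> \<exists>j\<ge>1. i = n + j"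
  by (rule exI[of _ "i - n"]) simp

text \<open>Unlike a trace layer, a layer here may mix standard modules of both kinds. Those of
  index at most \<open>n\<close> vanish on the \<open>T\<close>-corner, those of index
  \<open>n + j\<close> restrict to index \<open>j\<close>.\<close>

lemma filt_fin_T:
  assumes "F \<in> filt_fin Lam UNIV Lf"
  shows "TC.pull F \<in> filt_fin T UNIV Tf"
proof (rule TC.filt_fin_pull[OF assms])
  fix i D assume i: "i \<noteq> (0 :: nat)" and D: "D \<in> standard Lam Lf i"
  show "D \<in> Modules Lam \<and> ((\<forall>X\<in>Ob T. trivial (val D (X, Z))) \<or>
      (\<exists>j\<in>UNIV - {0}. \<exists>E\<in>standard T Tf j. Mod_iso T (TC.pull D) E))"
    (is "_ \<and> (?triv \<or> ?std)")
  proof (rule conjI[OF standard_Lam_Modules[OF D]], cases "i \<le> n")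
    case True
    then show "?triv \<or> ?std"
      using standard_low(2)[OF _ True D] i by simp
  next
    case False
    then obtain j where j: "1 \<le> j" "i = n + j" using high_index by blast
    have *: "\<exists>E\<in>standard T Tf j. Mod_iso T (TC.pull D) E" using standard_high(1)[OF j(1)] D j(2) by simp
    have "j \<in> UNIV - {0}" using j(1) by simp
    then have ?std using * by (rule rev_bexI)
    then show "?triv \<or> ?std" by (rule disjI2)
  qed
qed

lemma filt_fin_U:
  assumes "F \<in> filt_fin Lam UNIV Lf"
  shows "UC.pull F \<in> filt_fin U {..n} Uf"
proof (rule UC.filt_fin_pull[OF assms])
  fix i D assume i: "i \<noteq> (0 :: nat)" and D: "D \<in> standard Lam Lf i"
  show "D \<in> Modules Lam \<and> ((\<forall>X\<in>Ob U. trivial (val D (W, X))) \<or>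
      (\<exists>j\<in>{..n} - {0}. \<exists>E\<in>standard U Uf j. Mod_iso U (UC.pull D) E))"
    (is "_ \<and> (?triv \<or> ?std)")
  proof (rule conjI[OF standard_Lam_Modules[OF D]], cases "i \<le> n")
    case True
    have *: "\<exists>E\<in>standard U Uf i. Mod_iso U (UC.pull D) E" using standard_low(1)[OF _ True D] i by simp
    have "i \<in> {..n} - {0}" using i True by simp
    then have ?std using * by (rule rev_bexI)
    then show "?triv \<or> ?std" by (rule disjI2)
  next
    case False
    then obtain j where j: "1 \<le> j" "i = n + j" using high_index by blast
    then show "?triv \<or> ?std"
      using standard_high(2)[OF j(1)] D by simp
  qed
qed

section \<open>Supported modules and the gluing of submodules\<close>

lemma TC_supportedI:
  assumes F: "F \<in> Modules Lam" and triv: "\<And>X. X \<in> Ob U \<Longrightarrow> trivial (val F (W, X))"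
  shows "TC.supported F"
  unfolding TC.supported_def
proof (intro ballI)
  fix A x assume A: "A \<in> Ob Lam" and x: "x \<in> carrier (val F A)"
  obtain S X where AX: "A = (S, X)" by (cases A)
  interpret group "val F A" by (rule Modules_group[OF F A])
  have P: "(W, snd A) \<in> Ob Lam" using UC.pi_closed[OF A] by (rule UC.ob_closed)
  note prj = UC.prj_closed[OF A] and inc = UC.inc_closed[OF A]
  have "act F A (W, snd A) (prjU A) x = \<one>\<^bsub>val F (W, snd A)\<^esub>"
    using Modules_act_closed[OF F A P prj x] triv[OF UC.pi_closed[OF A]] by simp
  then have "act F A A (UC.corner_idem A) x = \<one>\<^bsub>val F A\<^esub>"
    unfolding UC.corner_idem_def Modules_act_Cmp[OF F A P A prj inc x]
    using Modules_act_one[OF F P A inc] by simp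
  then show "act F A A (TC.corner_idem A) x = x"
    using act_corner_idems[OF F A x] Modules_act_closed[OF F A A TC.corner_idem_closed[OF A] x] by simp
qed

text \<open>The two idempotents act as complementary projections, so an element without
  \<open>T\<close>-component is its own \<open>U\<close>-component. The elementwise form applies
  also to modules that do not vanish on the \<open>T\<close>-corner, as gluing demands.\<close>

lemma UC_act_idem:
  assumes F: "F \<in> Modules Lam" and A: "A \<in> Ob Lam" and x: "x \<in> carrier (val F A)"
    and "act F A (fst A, Z) (prjT A) x = \<one>\<^bsub>val F (fst A, Z)\<^esub>"
  shows "act F A A (UC.corner_idem A) x = x"
proof -
  interpret group "val F A" by (rule Modules_group[OF F A])
  have P: "(fst A, Z) \<in> Ob Lam" using TC.pi_closed[OF A] by (rule TC.ob_closed)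
  note prj = TC.prj_closed[OF A] and inc = TC.inc_closed[OF A]
  have "act F A A (TC.corner_idem A) x = \<one>\<^bsub>val F A\<^esub>"
    unfolding TC.corner_idem_def Modules_act_Cmp[OF F A P A prj inc x] assms(4)
    by (rule Modules_act_one[OF F P A inc])
  then show ?thesis
    using act_corner_idems[OF F A x] Modules_act_closed[OF F A A UC.corner_idem_closed[OF A] x] by simp
qed

lemma UC_supportedI:
  assumes F: "F \<in> Modules Lam" and triv: "\<And>S. S \<in> Ob T \<Longrightarrow> trivial (val F (S, Z))"
  shows "UC.supported F"
  unfolding UC.supported_def
proof (intro ballI)
  fix A x assume A: "A \<in> Ob Lam" and x: "x \<in> carrier (val F A)"
  have P: "(fst A, Z) \<in> Ob Lam" using TC.pi_closed[OF A] by (rule TC.ob_closed)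
  show "act F A A (UC.corner_idem A) x = x"
    by (rule UC_act_idem[OF F A x])
      (use Modules_act_closed[OF F A P TC.prj_closed[OF A] x] triv[OF TC.pi_closed[OF A]] in simp)
qed

text \<open>Values at \<open>A\<close> are not literally pairs, so the submodule with corner parts
  \<open>P\<close> and \<open>Q\<close> is cut out by the projections to the corners.\<close>

definition glue :: "('t \<times> 'u, 'q \<times> 'v \<times> 'p, 'a) cmod \<Rightarrow> ('t \<Rightarrow> 'a set) \<Rightarrow> ('u \<Rightarrow> 'a set) \<Rightarrow> 't \<times> 'u \<Rightarrow> 'a set"
  where "glue F P Q A = {x \<in> carrier (val F A).
    act F A (fst A, Z) (prjT A) x \<in> P (fst A) \<and>
    act F A (W, snd A) (prjU A) x \<in> Q (snd A)}"

text \<open>In general the action of \<open>M\<close> has to carry \<open>P\<close> into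
  \<open>Q\<close>. \<open>PQ\<close> describes the two extremes where this is automatic.\<close>

lemma glue_submodule:
  assumes F: "F \<in> Modules Lam" and P: "submodule T P (TC.pull F)" and Q: "submodule U Q (UC.pull F)"
    and PQ: "(\<forall>S\<in>Ob T. P S = {\<one>\<^bsub>val F (S, Z)\<^esub>}) \<or> (\<forall>X\<in>Ob U. Q X = carrier (val F (W, X)))"
  shows "submodule Lam (glue F P Q) F"
  unfolding submodule_def
proof (intro conjI ballI)
  fix A assume A: "A \<in> Ob Lam"
  have o: "(fst A, Z) \<in> Ob Lam" "(W, snd A) \<in> Ob Lam"
    using TC.ob_closed[OF TC.pi_closed[OF A]] UC.ob_closed[OF UC.pi_closed[OF A]] .
  show "subgroup (glue F P Q A) (val F A)"
    unfolding glue_def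
    by (rule subgroup_preimages[OF Modules_group[OF F A]
          Modules_act_hom[OF F A o(1) TC.prj_closed[OF A]] Modules_group[OF F o(1)] _
          Modules_act_hom[OF F A o(2) UC.prj_closed[OF A]] Modules_group[OF F o(2)]])
      (use submodule_subgroup[OF P TC.pi_closed[OF A]] submodule_subgroup[OF Q UC.pi_closed[OF A]] in simp_all)
next
  fix A B f assume A: "A \<in> Ob Lam" and B: "B \<in> Ob Lam" and f: "f \<in> Mor Lam A B"
  have o: "(fst A, Z) \<in> Ob Lam" "(W, snd A) \<in> Ob Lam" "(W, snd B) \<in> Ob Lam"
    using TC.ob_closed[OF TC.pi_closed[OF A]] UC.ob_closed[OF UC.pi_closed[OF A]]
      UC.ob_closed[OF UC.pi_closed[OF B]] .
  show "act F A B f ` glue F P Q A \<subseteq> glue F P Q B"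
  proof (rule image_subsetI)
    fix x assume "x \<in> glue F P Q A"
    then have x: "x \<in> carrier (val F A)"
      and xP: "act F A (fst A, Z) (prjT A) x \<in> P (fst A)"
      and xQ: "act F A (W, snd A) (prjU A) x \<in> Q (snd A)"
      unfolding glue_def by simp_all
    have fx: "act F A B f x \<in> carrier (val F B)" by (rule Modules_act_closed[OF F A B f x])
    moreover have "act F B (fst B, Z) (prjT B) (act F A B f x) \<in> P (fst B)"
    proof -
      note act = TC.prj_act_supported[OF F A B f x disjI1[OF TC_cosupported[OF A]]]
      show ?thesis
        unfolding act(1) by (rule submodule_act[OF P TC.pi_closed[OF A] TC.pi_closed[OF B] act(2) xP])
    qed
    moreover have "act F B (W, snd B) (prjU B) (act F A B f x) \<in> Q (snd B)"
      using PQ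
    proof
      \<comment> \<open>The elements concerned have no \<open>T\<close>-component and are fixed by
        the \<open>U\<close>-idempotent. This stands in for cosupport, which \<open>A\<close> may
        lack over \<open>U\<close>.\<close>
      assume "\<forall>S\<in>Ob T. P S = {\<one>\<^bsub>val F (S, Z)\<^esub>}"
      then have "act F A (fst A, Z) (prjT A) x = \<one>\<^bsub>val F (fst A, Z)\<^esub>"
        using xP TC.pi_closed[OF A] by simp
      note sup = UC_act_idem[OF F A x this]
      note act = UC.prj_act_supported[OF F A B f x disjI2[OF sup]]
      show ?thesis
        unfolding act(1) by (rule submodule_act[OF Q UC.pi_closed[OF A] UC.pi_closed[OF B] act(2) xQ])
    next
      assume "\<forall>X\<in>Ob U. Q X = carrier (val F (W, X))"
      then show ?thesis
        using Modules_act_closed[OF F B o(3) UC.prj_closed[OF B] fx] UC.pi_closed[OF B] by simp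
    qed
    ultimately show "act F A B f x \<in> glue F P Q B" unfolding glue_def by simp
  qed
qed

text \<open>At \<open>(S, Z)\<close> the projection to the \<open>T\<close>-corner is an identity,
  and the other one ends at a zero object, where its condition always holds.\<close>

lemma glue_T:
  assumes F: "F \<in> Modules Lam" and P: "submodule T P (TC.pull F)" and Q: "submodule U Q (UC.pull F)"
    and S: "S \<in> Ob T"
  shows "glue F P Q (S, Z) = P S"
proof -
  have o: "(S, Z) \<in> Ob Lam" "(W, Z) \<in> Ob Lam" "zero_object Lam (W, Z)"
    using S Z W by (simp_all add: zero_simps zero_object_Lam)
  have "(Idm T S, \<zero>\<^bsub>fobj M (Z, S)\<^esub>, \<zero>\<^bsub>Hom U Z Z\<^esub>) = Idm Lam (S, Z)" by (simp add: zero_simps)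
  moreover have "act F (S, Z) (W, Z) (\<zero>\<^bsub>Hom T S W\<^esub>, \<zero>\<^bsub>fobj M (Z, S)\<^esub>, Idm U Z) x \<in> Q Z"
    if x: "x \<in> carrier (val F (S, Z))" for x
  proof -
    have "act F (S, Z) (W, Z) (\<zero>\<^bsub>Hom T S W\<^esub>, \<zero>\<^bsub>fobj M (Z, S)\<^esub>, Idm U Z) x = \<one>\<^bsub>val F (W, Z)\<^esub>"
      using Modules_act_closed[OF F o(1,2) UC.prj_closed[OF o(1), simplified] x] Lam.Modules_zero_object[OF F o(3)] by simp
    then show ?thesis using subgroup.one_closed[OF submodule_subgroup[OF Q ZOb(1)]] by simp
  qed
  ultimately show ?thesis
    using submodule_subset[OF P S] Modules_act_Idm[OF F o(1)] unfolding glue_def by auto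
qed

lemma glue_U:
  assumes F: "F \<in> Modules Lam" and P: "submodule T P (TC.pull F)" and Q: "submodule U Q (UC.pull F)"
    and X: "X \<in> Ob U"
  shows "glue F P Q (W, X) = Q X"
proof -
  have o: "(W, X) \<in> Ob Lam" "(W, Z) \<in> Ob Lam" "zero_object Lam (W, Z)"
    using X Z W by (simp_all add: zero_simps zero_object_Lam)
  have "(\<zero>\<^bsub>Hom T W W\<^esub>, \<zero>\<^bsub>fobj M (X, W)\<^esub>, Idm U X) = Idm Lam (W, X)" by (simp add: zero_simps)
  moreover have "act F (W, X) (W, Z) (Idm T W, \<zero>\<^bsub>fobj M (Z, W)\<^esub>, \<zero>\<^bsub>Hom U X Z\<^esub>) x \<in> P W"
    if x: "x \<in> carrier (val F (W, X))" for x
  proof -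
    have "act F (W, X) (W, Z) (Idm T W, \<zero>\<^bsub>fobj M (Z, W)\<^esub>, \<zero>\<^bsub>Hom U X Z\<^esub>) x = \<one>\<^bsub>val F (W, Z)\<^esub>"
      using Modules_act_closed[OF F o(1,2) TC.prj_closed[OF o(1), simplified] x] Lam.Modules_zero_object[OF F o(3)] by simp
    then show ?thesis using subgroup.one_closed[OF submodule_subgroup[OF P ZOb(2)]] by simp
  qed
  ultimately show ?thesis
    using submodule_subset[OF Q X] Modules_act_Idm[OF F o(1)] unfolding glue_def by auto
qed

lemma filt_fin_glue:
  assumes F: "F \<in> Modules Lam" and T: "TC.pull F \<in> filt_fin T UNIV Tf" and U: "UC.pull F \<in> filt_fin U {..n} Uf"
  shows "F \<in> filt_fin Lam UNIV Lf"
proof -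
  from T obtain s P where "delta_filtration T UNIV Tf (TC.pull F) s P" unfolding filt_fin_iff by (elim conjE exE)
  note P = delta_filtrationD[OF this]
  from U obtain r Q where "delta_filtration U {..n} Uf (UC.pull F) r Q" unfolding filt_fin_iff by (elim conjE exE)
  note Q = delta_filtrationD[OF this]
  \<comment> \<open>For \<open>i \<le> r\<close> the \<open>T\<close>-part is \<open>P 0\<close>,
    which is zero, while the \<open>U\<close>-part climbs through \<open>Q\<close>. Afterwards the
    \<open>U\<close>-part stays at \<open>Q r\<close>, which is everything, and the
    \<open>T\<close>-part climbs through \<open>P\<close>. So the condition of
    \<open>glue_submodule\<close> holds at every index.\<close>
  define R where "R i = glue F (P (i - r)) (Q (min i r))" for i
  have PQ: "submodule T (P (i - r)) (TC.pull F)" "submodule U (Q (min i r)) (UC.pull F)" if "i \<le> r + s" for i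
    using that by (auto intro: P(1) Q(1))
  have R_sub: "submodule Lam (R i) F" if "i \<le> r + s" for i
    unfolding R_def
  proof (rule glue_submodule[OF F PQ[OF that]])
    show "(\<forall>S\<in>Ob T. P (i - r) S = {\<one>\<^bsub>val F (S, Z)\<^esub>}) \<or> (\<forall>X\<in>Ob U. Q (min i r) X = carrier (val F (W, X)))"
      using P(2) Q(3) by (cases "i \<le> r") (simp_all add: min_def)
  qed
  have R_T: "R i (S, Z) = P (i - r) S" if "i \<le> r + s" "S \<in> Ob T" for i S
    unfolding R_def by (rule glue_T[OF F PQ[OF that(1)] that(2)])
  have R_U: "R i (W, X) = Q (min i r) X" if "i \<le> r + s" "X \<in> Ob U" for i X
    unfolding R_def by (rule glue_U[OF F PQ[OF that(1)] that(2)])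
  have R_mono: "R i A \<subseteq> R (Suc i) A" if "i < r + s" "A \<in> Ob Lam" for i A
  proof -
    have "P (i - r) (fst A) \<subseteq> P (Suc i - r) (fst A)"
      using P(4)[of "i - r" "fst A"] that TC.pi_closed[OF that(2)] by (cases "r \<le> i") (auto simp: Suc_diff_le)
    moreover have "Q (min i r) (snd A) \<subseteq> Q (min (Suc i) r) (snd A)"
      using Q(4)[of i "snd A"] UC.pi_closed[OF that(2)] by (cases "i < r") (auto simp: min_def)
    ultimately show ?thesis unfolding R_def glue_def by blast
  qed
  have R_0: "R 0 A = {\<one>\<^bsub>val F A\<^esub>}" if A: "A \<in> Ob Lam" for A
  proof
    have o: "(W, snd A) \<in> Ob Lam" by (rule UC.ob_closed[OF UC.pi_closed[OF A]])
    show "R 0 A \<subseteq> {\<one>\<^bsub>val F A\<^esub>}"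
    proof
      fix x assume "x \<in> R 0 A"
      then have x: "x \<in> carrier (val F A)"
        and xP: "act F A (fst A, Z) (prjT A) x = \<one>\<^bsub>val F (fst A, Z)\<^esub>"
        and xQ: "act F A (W, snd A) (prjU A) x = \<one>\<^bsub>val F (W, snd A)\<^esub>"
        using P(2)[OF TC.pi_closed[OF A]] Q(2)[OF UC.pi_closed[OF A]] unfolding R_def glue_def by simp_all
      \<comment> \<open>Without \<open>T\<close>-component, \<open>x\<close> is fixed by the
        \<open>U\<close>-idempotent, whose action passes through the \<open>U\<close>-component, and
        this is trivial as well.\<close>
      have "x = act F A A (UC.corner_idem A) x" by (rule UC_act_idem[OF F A x xP, symmetric])
      also have "\<dots> = \<one>\<^bsub>val F A\<^esub>"
        unfolding UC.corner_idem_def Modules_act_Cmp[OF F A o A UC.prj_closed[OF A] UC.inc_closed[OF A] x] xQ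
        by (rule Modules_act_one[OF F o A UC.inc_closed[OF A]])
      finally show "x \<in> {\<one>\<^bsub>val F A\<^esub>}" by simp
    qed
    show "{\<one>\<^bsub>val F A\<^esub>} \<subseteq> R 0 A"
      using subgroup.one_closed[OF submodule_subgroup[OF R_sub[of 0] A]] by simp
  qed
  have R_r: "R (r + s) A = carrier (val F A)" if A: "A \<in> Ob Lam" for A
  proof -
    have o: "(fst A, Z) \<in> Ob Lam" "(W, snd A) \<in> Ob Lam"
      using TC.ob_closed[OF TC.pi_closed[OF A]] UC.ob_closed[OF UC.pi_closed[OF A]] .
    show ?thesis
      using P(3)[OF TC.pi_closed[OF A]] Q(3)[OF UC.pi_closed[OF A]]
        Modules_act_closed[OF F A o(1) TC.prj_closed[OF A]] Modules_act_closed[OF F A o(2) UC.prj_closed[OF A]]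
      unfolding R_def glue_def by auto
  qed
  let ?S = "\<Union>j\<in>UNIV - {0}. standard Lam Lf j"
  have step: "\<exists>Ds. set Ds \<subseteq> ?S \<and> Mod_iso Lam (quot_Mod (restrict_Mod F (R (Suc i))) (R i)) (dsum_Mod Ds)"
    if i: "i < r + s" for i
  proof -
    have i': "i \<le> r + s" "Suc i \<le> r + s" using i by simp_all
    let ?G = "restrict_Mod F (R (Suc i))"
    let ?Q = "quot_Mod ?G (R i)"
    have G: "?G \<in> Modules Lam" by (rule restrict_Mod_Modules[OF F R_sub[OF i'(2)]])
    have sub: "submodule Lam (R i) ?G"
      by (rule submodule_restrict_Mod[OF F R_sub[OF i'(1)] R_sub[OF i'(2)] R_mono[OF i]])
    have QM: "?Q \<in> Modules Lam" by (rule Lam.quot_Mod_Modules[OF G sub])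
    have triv: "trivial (val ?Q A)" if "A \<in> Ob Lam" "R i A = R (Suc i) A" for A
      by (rule quot_Mod_trivial[OF G sub that(1)]) (simp add: that(2))
    show ?thesis
    proof (cases "i < r")
      case True
      \<comment> \<open>In this range only the \<open>U\<close>-part moves, so the layer vanishes on
        the \<open>T\<close>-corner and is determined by its restriction to
        \<open>U\<close>.\<close>
      have m: "min i r = i" "min (Suc i) r = Suc i" "i - r = 0" "Suc i - r = 0" using True by simp_all
      have "UC.supported ?Q"
      proof (rule UC_supportedI[OF QM triv])
        fix S assume S: "S \<in> Ob T"
        then show "(S, Z) \<in> Ob Lam" by (rule TC.ob_closed)
        show "R i (S, Z) = R (Suc i) (S, Z)" unfolding R_T[OF i'(1) S] R_T[OF i'(2) S] m ..
      qed
      moreover obtain Es where Es: "set Es \<subseteq> (\<Union>j\<in>{..n} - {0}. standard U Uf j)"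
        "Mod_iso U (quot_Mod (restrict_Mod (UC.pull F) (Q (Suc i))) (Q i)) (dsum_Mod Es)"
        using Q(5)[OF True] by (elim exE conjE)
      have "Mod_iso U (UC.pull ?Q) (quot_Mod (restrict_Mod (UC.pull F) (Q (Suc i))) (Q i))"
        unfolding pull_Mod_quot_Mod pull_Mod_restrict_Mod
        by (rule quot_restrict_Mod_cong) (simp_all only: R_U[OF i'(1)] R_U[OF i'(2)] m)
      from Mod_iso_trans[OF this Es(2)] have iso: "Mod_iso U (UC.pull ?Q) (dsum_Mod Es)" .
      \<comment> \<open>The index stays at most \<open>n\<close>, where \<open>standard_low\<close>
        provides modules that are supported on the \<open>U\<close>-corner; lifting a direct sum
        relies on this.\<close>
      let ?S' = "\<Union>j\<in>{..n} - {0}. standard Lam Lf j"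
      have "\<exists>Ds. set Ds \<subseteq> ?S' \<and> Mod_iso Lam ?Q (dsum_Mod Ds)"
      proof (rule UC.Mod_iso_lift_dsum[OF QM calculation iso])
        fix D assume "D \<in> ?S'"
        then obtain j where j: "1 \<le> j" "j \<le> n" "D \<in> standard Lam Lf j" by (auto simp: Suc_le_eq)
        show "D \<in> Modules Lam \<and> UC.supported D"
          using UC_supportedI[OF standard_Lam_Modules[OF j(3)] standard_low(2)[OF j]] standard_Lam_Modules[OF j(3)] by simp
      next
        fix E assume "E \<in> set Es"
        then have "E \<in> (\<Union>j\<in>{..n} - {0}. standard U Uf j)" by (rule subsetD[OF Es(1)])
        then obtain j where j: "1 \<le> j" "j \<le> n" "E \<in> standard U Uf j" by (auto simp: Suc_le_eq)
        from standard_U_lift[OF j] j(1,2) show "\<exists>D\<in>?S'. Mod_iso U (UC.pull D) E" by fastforce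
      qed
      then show ?thesis by fastforce
    next
      case False
      \<comment> \<open>Now only the \<open>T\<close>-part moves: the layer vanishes on the
        \<open>U\<close>-corner, and its summands are lifted to standard modules of index beyond
        \<open>n\<close>.\<close>
      have m: "min i r = r" "min (Suc i) r = r" "Suc i - r = Suc (i - r)" using False by (simp_all add: Suc_diff_le)
      have "TC.supported ?Q"
      proof (rule TC_supportedI[OF QM triv])
        fix X assume X: "X \<in> Ob U"
        then show "(W, X) \<in> Ob Lam" by (rule UC.ob_closed)
        show "R i (W, X) = R (Suc i) (W, X)" unfolding R_U[OF i'(1) X] R_U[OF i'(2) X] m ..
      qed
      moreover have "i - r < s" using False i by simp
      from P(5)[OF this] obtain Es where Es: "set Es \<subseteq> (\<Union>j\<in>UNIV - {0}. standard T Tf j)"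
        "Mod_iso T (quot_Mod (restrict_Mod (TC.pull F) (P (Suc (i - r)))) (P (i - r))) (dsum_Mod Es)"
        by (elim exE conjE)
      have "Mod_iso T (TC.pull ?Q) (quot_Mod (restrict_Mod (TC.pull F) (P (Suc (i - r)))) (P (i - r)))"
        unfolding pull_Mod_quot_Mod pull_Mod_restrict_Mod
        by (rule quot_restrict_Mod_cong) (simp_all only: R_T[OF i'(1)] R_T[OF i'(2)] m)
      from Mod_iso_trans[OF this Es(2)] have iso: "Mod_iso T (TC.pull ?Q) (dsum_Mod Es)" .
      let ?S' = "\<Union>j\<in>{1..}. standard Lam Lf (n + j)"
      have "\<exists>Ds. set Ds \<subseteq> ?S' \<and> Mod_iso Lam ?Q (dsum_Mod Ds)"
      proof (rule TC.Mod_iso_lift_dsum[OF QM calculation iso])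
        fix D assume "D \<in> ?S'"
        then obtain j where j: "1 \<le> j" "D \<in> standard Lam Lf (n + j)" by (auto simp: Suc_le_eq)
        show "D \<in> Modules Lam \<and> TC.supported D"
          using TC_supportedI[OF standard_Lam_Modules[OF j(2)] standard_high(2)[OF j]] standard_Lam_Modules[OF j(2)] by simp
      next
        fix E assume "E \<in> set Es"
        then have "E \<in> (\<Union>j\<in>UNIV - {0}. standard T Tf j)" by (rule subsetD[OF Es(1)])
        then obtain j where j: "1 \<le> j" "E \<in> standard T Tf j" by (auto simp: Suc_le_eq)
        from standard_T_lift[OF j] j(1) show "\<exists>D\<in>?S'. Mod_iso T (TC.pull D) E" by fastforce
      qed
      moreover have "?S' \<subseteq> ?S" by fastforce
      ultimately show ?thesis by (meson order_trans)
    qed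
  qed
  show ?thesis
    unfolding filt_fin_iff delta_filtration_def
    by (rule conjI[OF F], rule exI[of _ "r + s"], rule exI[of _ R])
      (intro conjI allI impI ballI; (rule R_sub R_0 R_r R_mono step; assumption))
qed

lemma filt_fin_Lam:
  "filt_fin Lam UNIV Lf = {F. F \<in> Modules Lam \<and> TC.pull F \<in> filt_fin T UNIV Tf \<and> UC.pull F \<in> filt_fin U {..n} Uf}"
proof (intro equalityI subsetI)
  fix F assume F: "F \<in> filt_fin Lam UNIV Lf"
  then have "F \<in> Modules Lam" unfolding filt_fin_iff by (rule conjunct1)
  then show "F \<in> {F. F \<in> Modules Lam \<and> TC.pull F \<in> filt_fin T UNIV Tf \<and> UC.pull F \<in> filt_fin U {..n} Uf}"
    using filt_fin_T[OF F] filt_fin_U[OF F] by simp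
qed (unfold mem_Collect_eq, elim conjE, rule filt_fin_glue)

end

text \<open>Justifies the choice behind \<open>zero_ob\<close>, and with it the use of the corners
  from which \<open>triple_of\<close> is read off.\<close>

lemma (in k_category) zero_ob_zero_object:
  assumes "additive_subcat C B" shows "zero_object C (zero_ob C)"
proof -
  obtain Z where "zero_object C Z" using additive_subcat_zero_object[OF assms] by (elim bexE)
  then show ?thesis unfolding zero_ob_def by (rule someI)
qed

theorem theorem3p9:
  fixes K :: "('k, 'x) ring_scheme"
    and U :: "('u, 'p, 'k) kcat" and T :: "('t, 'q, 'k) kcat"
    and Uf :: "nat \<Rightarrow> 'u set" and Tf :: "nat \<Rightarrow> 't set" and n :: nat
    and M :: "('u, 'p, 't, 'q, 'k, 'v) bifun"
    and \<Lambda> :: "('t \<times> 'u, 'q \<times> 'v \<times> 'p, 'k) kcat" and \<Lambda>f :: "nat \<Rightarrow> ('t \<times> 'u) set"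
    and F :: "('t \<times> 'u, 'q \<times> 'v \<times> 'p, 'a) cmod"
    and F1 :: "('t, 'q, 'a) cmod" and f :: "'t \<Rightarrow> 'a \<Rightarrow> 'u \<Rightarrow> 'v \<Rightarrow> 'a" and F2 :: "('u, 'p, 'a) cmod"
    and G1 :: "nat \<Rightarrow> ('t, 'q, 'a) cmod" and g :: "nat \<Rightarrow> 't \<Rightarrow> 'a \<Rightarrow> 'u \<Rightarrow> 'v \<Rightarrow> 'a"
    and G2 :: "nat \<Rightarrow> ('u, 'p, 'a) cmod"
  assumes "field K"
    and "k_category K U" and "hom_finite K U" and "krull_schmidt U"
    and "k_category K T" and "hom_finite K T" and "krull_schmidt T"
    and "\<forall>j\<le>n. additively_closed U (Uf j)" and "quasi_hereditary U {..n} Uf"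
    and "\<forall>j. additively_closed T (Tf j)" and "quasi_hereditary T UNIV Tf"
    and "modK_functor K (tensor_cat K U (op_cat T)) M"
    and "\<forall>S\<in>Ob T. M_at K U T M S \<in> filt U {..n} Uf"
    and "\<Lambda> = tri_cat K U T M" and "\<Lambda>f = tri_filt K U T M n Uf Tf"
    and "F \<in> Modules \<Lambda>"
    and "triple_of U T M F = (F1, f, F2)"
    and "\<forall>j. triple_of U T M (trace_Mod \<Lambda> \<Lambda>f F j) = (G1 j, g j, G2 j)"
  shows "((\<forall>j\<le>n. Mod_iso T (G1 j) zero_Mod) \<and> (\<forall>j>n. Mod_iso U (G2 j) F2)) \<and>
    (F \<in> filt \<Lambda> UNIV \<Lambda>f \<longrightarrow> F1 \<in> filt T UNIV Tf \<and> F2 \<in> filt U {..n} Uf) \<and>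
    filt_fin \<Lambda> UNIV \<Lambda>f =
      {N :: ('t \<times> 'u, 'q \<times> 'v \<times> 'p, 'a) cmod. N \<in> Modules \<Lambda> \<and>
         (\<exists>N1 h N2. triple_of U T M N = (N1, h, N2) \<and>
            N1 \<in> filt_fin T UNIV Tf \<and> N2 \<in> filt_fin U {..n} Uf)}"
proof -
  interpret U: k_category K U by fact
  interpret T: k_category K T by fact
  interpret M: modK_functor K "tensor_cat K U (op_cat T)" M by fact
  have Uf_closed: "additively_closed U (Uf j)" if "j \<le> n" for j using assms(8) that by simp
  have Tf_closed: "additively_closed T (Tf j)" for j using assms(10) by simp
  have Uf_mono: "Uf j \<subseteq> Uf (Suc j)" if "j < n" for j
    using quasi_hereditary_mono[OF assms(9)] that by simp
  have Tf_mono: "Tf j \<subseteq> Tf (Suc j)" for j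
    using quasi_hereditary_mono[OF assms(11)] by simp
  \<comment> \<open>An increasing chain ending at \<open>n\<close> has its last term as union, so
    exhaustiveness makes \<open>Uf n\<close> the whole category.\<close>
  have Uf_le: "Uf j \<subseteq> Uf n" if "j \<le> n" for j
    using that by (induction rule: inc_induct) (use Uf_mono in blast)+
  have Uf_n: "Uf n = Ob U"
    unfolding quasi_hereditary_exhaustive[OF assms(9), symmetric] using Uf_le by fastforce
  interpret triangular_filtered K U T M "zero_ob U" "zero_ob T" n Uf Tf
  proof
    show "zero_object U (zero_ob U)"
      by (rule U.zero_ob_zero_object[OF U.additively_closed_subcat[OF Uf_closed[OF order_refl]]])
    show "zero_object T (zero_ob T)"
      by (rule T.zero_ob_zero_object[OF T.additively_closed_subcat[OF Tf_closed]])
    show "zero_object U X" if "X \<in> Uf 0" for X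
      by (rule U.quasi_hereditary_zero_objects[OF assms(9) _ that]) simp
    show "zero_object T S" if "S \<in> Tf 0" for S
      by (rule T.quasi_hereditary_zero_objects[OF assms(11) _ that]) simp
  qed (use Uf_closed Tf_closed Uf_mono Tf_mono Uf_n in blast)+
  \<comment> \<open>The outer components of \<open>triple_of\<close> unfold to the restrictions to
    the two corners at the chosen zero objects, so all claims become claims about
    \<open>TC.pull\<close> and \<open>UC.pull\<close>.\<close>
  have triple: "triple_of U T M N = (TC.pull N, fst (snd (triple_of U T M N)), UC.pull N)"
    for N :: "('t \<times> 'u, 'q \<times> 'v \<times> 'p, 'a) cmod"
    by (simp add: triple_of_def pull_Mod_def Let_def)
  have F12: "F1 = TC.pull F" "F2 = UC.pull F"
    using triple[of F] assms(17) by simp_all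
  have G12: "G1 j = TC.pull (trace_Mod Lam Lf F j)" "G2 j = UC.pull (trace_Mod Lam Lf F j)" for j
    using triple[of "trace_Mod Lam Lf F j"] spec[OF assms(18), of j] unfolding assms(14,15) by simp_all
  have F: "F \<in> Modules Lam" using assms(16) unfolding assms(14) .
  \<comment> \<open>A module has exactly one triple, so the existential over triples
    collapses.\<close>
  have iii: "(\<exists>N1 h N2. triple_of U T M N = (N1, h, N2) \<and>
            N1 \<in> filt_fin T UNIV Tf \<and> N2 \<in> filt_fin U {..n} Uf)
     \<longleftrightarrow> TC.pull N \<in> filt_fin T UNIV Tf \<and> UC.pull N \<in> filt_fin U {..n} Uf"
    for N :: "('t \<times> 'u, 'q \<times> 'v \<times> 'p, 'a) cmod"
    by (subst triple) auto
  show ?thesis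
    unfolding assms(14,15) F12 G12 iii filt_fin_Lam[symmetric]
    using trace_Mod_low_T[OF F] trace_Mod_high_U[OF F] filt_T[of F] filt_U[of F] by simp
qed

end
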